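(* Let $d\ge1$, let $\psi:\mathbb{R}^d_\xi\to\mathbb{R}$ be a fixed smooth compactly supported function, and let $\alpha=(\alpha_1,\dots,\alpha_d)$ with real $\alpha_j\ge0$ and $|\alpha|=\alpha_1+\dots+\alpha_d<\frac12$. Then there exist $\gamma$ with $0<\gamma<1-2|\alpha|$ and constants $K_1=K_1(\alpha,\gamma)$, $K_2=K_2(\alpha,\gamma)$ such that the following holds. Let $Q,E\in V_2$ be nonzero, let $M\in V_2$ satisfy $$\xi\cdot\nabla_x M(x,\xi)=Q(x,\xi),$$ and, for the choice $$\lambda=\lambda_{\rm opt}=K_2\left(\frac{\|Q\|_{V_2}}{\|E\|_{V_2}}\right)^{\frac1{1+|\alpha|}},$$ let $f\in V_2$ satisfy $$\xi\cdot\nabla_x f+\lambda f=\lambda M+\lambda\,\frac{\partial^\alpha E}{\partial x^\alpha}.$$ Then $\rho_\psi(x)=\int_{\mathbb{R}^d}(f-M)(x,\xi)\,\psi(\xi)\,d\xi$ satisfies $$\|\rho_\psi\|_{\dot H^{\gamma/2}(\mathbb{R}^d_x)}^2\le K_1\,\|E\|_{V_2}^{\frac{2-\gamma}{1+|\alpha|}}\,\|Q\|_{V_2}^{\frac{2|\alpha|+\gamma}{1+|\alpha|}};$$ in particular this error tends to zero as $\|E\|_{V_2}$ tends to zero (with $Q$ fixed).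
   Context: Here both $x$ and $\xi$ range over $\mathbb{R}^d$ and $V_2=L^2(\mathbb{R}^d_x\times\mathbb{R}^d_\xi)$. Equations hold in the sense of distributions. The space Fourier transform is $\widehat g(k,\xi)=\int_{\mathbb{R}^d}g(x,\xi)e^{ik\cdot x}\,dx$; the (possibly fractional) derivative $\partial^\alpha E/\partial x^\alpha$ is the Fourier multiplier in $x$ with symbol $\prod_j(-ik_j)^{\alpha_j}$ (principal branch), whose modulus is $\prod_j|k_j|^{\alpha_j}\le|k|^{|\alpha|}$. The homogeneous Sobolev seminorm is $\|\rho\|_{\dot H^{s}}^2=\int_{\mathbb{R}^d}|k|^{2s}|\widehat\rho(k)|^2\,dk$. *)

theory Defs
  imports "HOL-Analysis.Analysis"
begin

text \<open>
  Square-integrable functions are handled through Borel measurable, complex-valued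
  representatives; real-valued functions are a special case. Everything below depends on a
  representative only up to null sets.
\<close>

definition L2 :: "('a::euclidean_space \<Rightarrow> complex) set" where
  "L2 = {f. f \<in> borel_measurable lborel \<and> integrable lborel (\<lambda>x. (cmod (f x))\<^sup>2)}"

definition L2norm :: "('a::euclidean_space \<Rightarrow> complex) \<Rightarrow> real" where
  "L2norm f = sqrt (LINT x|lborel. (cmod (f x))\<^sup>2)"

definition L2_nonzero :: "('a::euclidean_space \<Rightarrow> complex) \<Rightarrow> bool" where
  "L2_nonzero f \<longleftrightarrow> \<not> (AE x in lborel. f x = 0)"

definition L2_lim :: "(nat \<Rightarrow> 'a::euclidean_space \<Rightarrow> complex) \<Rightarrow> ('a \<Rightarrow> complex) \<Rightarrow> bool" where
  "L2_lim g G \<longleftrightarrow> (\<lambda>n. \<integral>\<^sup>+x. ennreal ((cmod (g n x - G x))\<^sup>2) \<partial>lborel) \<longlonglongrightarrow> 0"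


text \<open>\<open>Ck k f\<close>: \<open>f\<close> is \<open>k\<close> times continuously differentiable on the whole space.\<close>

primrec Ck :: "nat \<Rightarrow> ('a::euclidean_space \<Rightarrow> 'b::real_normed_vector) \<Rightarrow> bool" where
  "Ck 0 f \<longleftrightarrow> continuous_on UNIV f"
| "Ck (Suc k) f \<longleftrightarrow>
     (\<forall>x. f differentiable (at x)) \<and> (\<forall>v. Ck k (\<lambda>x. frechet_derivative f (at x) v))"

definition Cc_infinity :: "('a::euclidean_space \<Rightarrow> 'b::real_normed_vector) set" where
  "Cc_infinity = {f. (\<forall>k. Ck k f) \<and> compact (closure {x. f x \<noteq> 0})}"


text \<open>
  Fourier transforms use the kernel \<open>exp (i k \<bullet> x)\<close>, without normalising factor. On \<open>L2\<close> the
  integral need not converge absolutely, so the transform is the usual Plancherel extension: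
  the \<open>L2\<close> limit of the transforms of the truncations to balls, unique up to null sets.
  \<open>fourier_x\<close> transforms only the first variable of a function of \<open>(x, \<xi>)\<close>; its limit is taken
  in \<open>L2\<close> of the product space, which makes the result jointly measurable.
\<close>

definition fourier :: "('a::euclidean_space \<Rightarrow> complex) \<Rightarrow> 'a \<Rightarrow> complex" where
  "fourier g = (SOME G. G \<in> L2 \<and>
     L2_lim (\<lambda>n k. LINT x:cball 0 (real n)|lborel. g x * cis (k \<bullet> x)) G)"

definition fourier_x ::
  "('a::euclidean_space \<times> 'b::euclidean_space \<Rightarrow> complex) \<Rightarrow> 'a \<times> 'b \<Rightarrow> complex" where
  "fourier_x g = (SOME G. G \<in> L2 \<and>
     L2_lim (\<lambda>n (k, \<xi>). LINT x:cball 0 (real n)|lborel. g (x, \<xi>) * cis (k \<bullet> x)) G)"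

text \<open>Only applied to test functions, for which the integral converges absolutely.\<close>

definition inv_fourier_x ::
  "('a::euclidean_space \<times> 'b::euclidean_space \<Rightarrow> complex) \<Rightarrow> 'a \<times> 'b \<Rightarrow> complex" where
  "inv_fourier_x \<phi> = (\<lambda>(k, \<xi>).
     (LINT x|lborel. \<phi> (x, \<xi>) * cis (- (k \<bullet> x))) / of_real ((2 * pi) ^ DIM('a)))"

text \<open>Squared seminorm, with values in \<open>[0, \<infinity>]\<close>, so that a finite bound includes finiteness.\<close>

definition Hdot_seminorm_sq :: "real \<Rightarrow> ('a::euclidean_space \<Rightarrow> complex) \<Rightarrow> ennreal" where
  "Hdot_seminorm_sq s \<rho> =
     (\<integral>\<^sup>+k. ennreal (norm k powr (2 * s) * (cmod (fourier \<rho> k))\<^sup>2) \<partial>lborel)"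


definition order_of :: "real ^ 'n \<Rightarrow> real" where
  "order_of \<alpha> = (\<Sum>j\<in>UNIV. \<alpha> $ j)"

text \<open>
  Complex \<open>powr\<close> is the principal branch. The case distinction is needed because
  \<open>0 powr 0 = 0\<close> in the library, whereas here a zero exponent means no derivative.
\<close>

definition deriv_symbol :: "real ^ 'n \<Rightarrow> real ^ 'n \<Rightarrow> complex" where
  "deriv_symbol \<alpha> k =
     (\<Prod>j\<in>UNIV. if \<alpha> $ j = 0 then 1 else (- \<i> * of_real (k $ j)) powr of_real (\<alpha> $ j))"


text \<open>
  Distributions on phase space are functionals on complex test functions. For \<open>E\<close> in \<open>L2\<close> the
  fractional derivative is in general only a (tempered) distribution, namely the inverse
  Fourier transform in \<open>x\<close> of the function \<open>deriv_symbol \<alpha> k * fourier_x E (k, \<xi>)\<close>; as usual,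
  the inverse transform of a distribution is moved onto the test function.
\<close>

type_synonym 'n phase = "(real ^ 'n) \<times> (real ^ 'n)"

definition distr_of :: "('n::finite phase \<Rightarrow> complex) \<Rightarrow> ('n phase \<Rightarrow> complex) \<Rightarrow> complex" where
  "distr_of f \<phi> = (LINT z|lborel. f z * \<phi> z)"

text \<open>The distribution \<open>\<xi> \<bullet> \<nabla>\<^sub>x f\<close>; note that \<open>\<xi>\<close> commutes with \<open>\<nabla>\<^sub>x\<close>.\<close>

definition transport :: "('n::finite phase \<Rightarrow> complex) \<Rightarrow> ('n phase \<Rightarrow> complex) \<Rightarrow> complex" where
  "transport f \<phi> =
     - (LINT (x, \<xi>)|lborel. f (x, \<xi>) * frechet_derivative \<phi> (at (x, \<xi>)) (\<xi>, 0))"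

definition frac_deriv ::
  "real ^ 'n \<Rightarrow> ('n::finite phase \<Rightarrow> complex) \<Rightarrow> ('n phase \<Rightarrow> complex) \<Rightarrow> complex" where
  "frac_deriv \<alpha> E \<phi> =
     (LINT (k, \<xi>)|lborel. deriv_symbol \<alpha> k * fourier_x E (k, \<xi>) * inv_fourier_x \<phi> (k, \<xi>))"

definition transport_eq :: "('n::finite phase \<Rightarrow> complex) \<Rightarrow> ('n phase \<Rightarrow> complex) \<Rightarrow> bool" where
  "transport_eq M Q \<longleftrightarrow> (\<forall>\<phi>\<in>Cc_infinity. transport M \<phi> = distr_of Q \<phi>)"

definition relaxation_eq ::
  "real ^ 'n \<Rightarrow> real \<Rightarrow> ('n::finite phase \<Rightarrow> complex) \<Rightarrow> ('n phase \<Rightarrow> complex) \<Rightarrow>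
     ('n phase \<Rightarrow> complex) \<Rightarrow> bool" where
  "relaxation_eq \<alpha> lam M E f \<longleftrightarrow> (\<forall>\<phi>\<in>Cc_infinity.
     transport f \<phi> + of_real lam * distr_of f \<phi>
       = of_real lam * distr_of M \<phi> + of_real lam * frac_deriv \<alpha> E \<phi>)"

definition lambda_opt ::
  "real \<Rightarrow> real ^ 'n \<Rightarrow> ('n::finite phase \<Rightarrow> complex) \<Rightarrow> ('n phase \<Rightarrow> complex) \<Rightarrow> real" where
  "lambda_opt K \<alpha> Q E = K * (L2norm Q / L2norm E) powr (1 / (1 + order_of \<alpha>))"

definition moment :: "(real ^ 'n \<Rightarrow> real) \<Rightarrow> ('n::finite phase \<Rightarrow> complex) \<Rightarrow> real ^ 'n \<Rightarrow> complex" where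
  "moment \<psi> g x = (LINT \<xi>|lborel. g (x, \<xi>) * of_real (\<psi> \<xi>))"

end

theory Submission
  imports Defs "HOL-Probability.Probability"
begin

text \<open>
  With \<open>g = f - M\<close> the two equations combine to \<open>\<xi> \<bullet> \<nabla>\<^sub>x g + \<lambda> g = \<lambda> \<partial>\<^sup>\<alpha> E - Q\<close>, so after a Fourier
  transform in \<open>x\<close> one can divide by \<open>\<lambda> - i k \<bullet> \<xi>\<close>. Cauchy-Schwarz in \<open>\<xi>\<close> bounds the squared transform
  of the moment at \<open>k\<close> by \<open>2 (\<lambda>\<^sup>2 norm k powr (2a) e(k) + q(k))\<close>, where \<open>e(k)\<close> and \<open>q(k)\<close> are the
  squared norms of the transforms of \<open>E\<close> and \<open>Q\<close> at \<open>k\<close> and \<open>a\<close> is the order of \<open>\<alpha>\<close>, times the integral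
  of \<open>\<psi>\<^sup>2 / (\<lambda>\<^sup>2 + (k \<bullet> \<xi>)\<^sup>2)\<close>, which is at most a constant times the minimum of \<open>1 / (\<lambda> norm k)\<close> and
  \<open>1 / \<lambda>\<^sup>2\<close>. As \<open>2a + \<gamma> \<le> 1\<close>, multiplying by \<open>norm k powr \<gamma>\<close> and integrating over \<open>k\<close> gives
  \<open>\<lambda> powr (2a + \<gamma>) (norm E)\<^sup>2 + \<lambda> powr (\<gamma> - 2) (norm Q)\<^sup>2\<close> up to a constant, and the prescribed \<open>\<lambda>\<close>
  balances the two terms.

  The Plancherel inequality, the weak form of Parseval's identity and the uniqueness theorem for
  the Fourier transform of integrable functions all come from inserting a Gaussian factor and letting it
  tend to 1.
\<close>

section \<open>Gaussians and their Fourier transform\<close>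

text \<open>The obstacle is that \<open>f\<close>, \<open>M\<close>, \<open>E\<close> and
  \<open>Q\<close> are only square-integrable. Their transforms are limits picked by
  \<open>SOME\<close> and known up to null sets, and the equations are known only against compactly
  supported test functions, whose transforms cannot be localised near a chosen frequency. Everything
  is therefore tested against products \<open>u (fst z) * v (snd z)\<close>: for these the transport
  term is a finite sum of products, the integrals converge absolutely, and Parseval's identity acts
  in \<open>x\<close> alone. The relation between the transforms is recovered where
  \<open>\<psi>\<close> does not vanish, which is all that the moment sees. Norm estimates are made
  with squares in \<open>ennreal\<close>, and the factors 2 lost in this way end up in
  \<open>K1\<close>. The function \<open>\<psi>\<^sup>2\<close> is replaced by a multiple of a
  Gaussian, because the Gaussian average of the resolvent can be computed through a Laplace
  integral; this multiple is how \<open>K1\<close> depends on \<open>\<psi>\<close>.\<close>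

lemma integral_lborel_affine:
  fixes f :: "'a::euclidean_space \<Rightarrow> 'b::{banach,second_countable_topology}"
  assumes "c \<noteq> 0" and [measurable]: "f \<in> borel_measurable borel"
  shows "(LINT x|lborel. f x) = \<bar>c\<bar> ^ DIM('a) *\<^sub>R (LINT x|lborel. f (t + c *\<^sub>R x))"
  by (subst lborel_affine[OF assms(1), of t])
     (simp add: integral_density integral_distr)

lemma integrable_lborel_affine:
  fixes f :: "'a::euclidean_space \<Rightarrow> 'b::{banach,second_countable_topology}"
  assumes "c \<noteq> 0" and "integrable lborel f"
  shows "integrable lborel (\<lambda>x. f (t + c *\<^sub>R x))"
proof -
  have [measurable]: "f \<in> borel_measurable borel" using assms(2) by auto
  have "integrable (density (distr lborel borel (\<lambda>x. t + c *\<^sub>R x)) (\<lambda>_. \<bar>c\<bar> ^ DIM('a))) f"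
    using assms(2) lborel_affine[OF assms(1), of t] by metis
  then have "integrable (distr lborel borel (\<lambda>x. t + c *\<^sub>R x)) (\<lambda>x. \<bar>c\<bar> ^ DIM('a) *\<^sub>R f x)"
    by (subst (asm) integrable_density) auto
  then have "integrable lborel (\<lambda>x. \<bar>c\<bar> ^ DIM('a) *\<^sub>R f (t + c *\<^sub>R x))"
    by (subst (asm) integrable_distr_eq) auto
  then have "integrable lborel (\<lambda>x. inverse (\<bar>c\<bar> ^ DIM('a)) *\<^sub>R (\<bar>c\<bar> ^ DIM('a) *\<^sub>R f (t + c *\<^sub>R x)))"
    by (rule integrable_scaleR_right)
  then show ?thesis using assms(1) by simp
qed

text \<open>Unnormalised on purpose: \<open>gauss 0 = 1\<close>, so
  \<open>gauss (e *\<^sub>R k)\<close> tends to 1 as \<open>e\<close> tends to 0, and the function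
  is its own Fourier transform up to the factor \<open>sqrt (2 * pi) ^ DIM('a)\<close>.\<close>

definition gauss :: "'a::euclidean_space \<Rightarrow> real" where
  "gauss x = exp (- (norm x)\<^sup>2 / 2)"

lemma gauss_measurable[measurable]: "gauss \<in> borel_measurable borel"
  unfolding gauss_def by measurable

lemma gauss_nonneg[simp]: "0 \<le> gauss x" and gauss_pos[simp]: "0 < gauss x"
  and gauss_le_1[simp]: "gauss x \<le> 1" and gauss_minus[simp]: "gauss (- x) = gauss x"
  by (auto simp: gauss_def)

text \<open>This is the characteristic function of the standard normal distribution, rescaled by the
  factor \<open>sqrt (2 * pi)\<close> of its density.\<close>

lemma gauss_cis_1:
  fixes s :: real
  shows "integrable lborel (\<lambda>t. complex_of_real (exp (- t\<^sup>2 / 2)) * cis (t * s))"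
    and "(LINT t|lborel. complex_of_real (exp (- t\<^sup>2 / 2)) * cis (t * s))
           = of_real (sqrt (2 * pi) * exp (- s\<^sup>2 / 2))"
proof -
  have eq: "exp (- t\<^sup>2 / 2) = sqrt (2 * pi) * std_normal_density t" for t :: real
    by (simp add: std_normal_density_def)
  show "integrable lborel (\<lambda>t. complex_of_real (exp (- t\<^sup>2 / 2)) * cis (t * s))"
  proof (rule Bochner_Integration.integrable_bound)
    show "integrable lborel (\<lambda>t::real. sqrt (2 * pi) * std_normal_density t)" by simp
    show "AE t in lborel. norm (complex_of_real (exp (- t\<^sup>2 / 2)) * cis (t * s))
        \<le> norm (sqrt (2 * pi) * std_normal_density t)"
      unfolding eq by (auto simp: norm_mult abs_mult)
  qed (unfold cis_conv_exp, measurable)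
  have "char std_normal_distribution s = exp (- (s^2) / 2)"
    by (simp add: char_std_normal_distribution)
  then have *: "(LINT t|lborel. std_normal_density t *\<^sub>R iexp (s * t)) = complex_of_real (exp (- (s^2) / 2))"
    unfolding char_def
    by (subst (asm) integral_density) auto
  have "(LINT t|lborel. complex_of_real (exp (- t\<^sup>2 / 2)) * cis (t * s))
     = (LINT t|lborel. complex_of_real (sqrt (2 * pi)) * (std_normal_density t *\<^sub>R iexp (s * t)))"
    unfolding eq by (simp add: cis_conv_exp scaleR_conv_of_real mult_ac)
  also have "\<dots> = of_real (sqrt (2 * pi)) * complex_of_real (exp (- (s^2) / 2))"
    unfolding * [symmetric] by (rule integral_mult_right_zero)
  finally show "(LINT t|lborel. complex_of_real (exp (- t\<^sup>2 / 2)) * cis (t * s))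
           = of_real (sqrt (2 * pi) * exp (- s\<^sup>2 / 2))" by simp
qed

lemma norm_sq_Basis: "(norm x)\<^sup>2 = (\<Sum>b\<in>Basis. (x \<bullet> b)\<^sup>2)" for x :: "'a::euclidean_space"
  unfolding power2_norm_eq_inner by (subst euclidean_inner) (simp add: power2_eq_square)

lemma cis_sum: "cis (sum f A) = (\<Prod>i\<in>A. cis (f i))"
  by (cases "finite A", induction A rule: finite_induct) (auto simp: cis_mult[symmetric])

text \<open>Gaussian and character both factor over the coordinates, and \<open>lborel\<close> is
  the image of a product measure, so the integral is a product of one-dimensional ones.\<close>

lemma gauss_cis:
  fixes x :: "'a::euclidean_space"
  shows "integrable lborel (\<lambda>k::'a. complex_of_real (gauss k) * cis (k \<bullet> x))"
    and "(LINT k|lborel. complex_of_real (gauss k) * cis (k \<bullet> x))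
           = of_real (sqrt (2 * pi) ^ DIM('a) * gauss x)"
proof -
  interpret product_sigma_finite "\<lambda>_::'a. lborel :: real measure" ..
  define F :: "'a \<Rightarrow> real \<Rightarrow> complex"
    where "F b t = complex_of_real (exp (- t\<^sup>2 / 2)) * cis (t * (x \<bullet> b))" for b t
  have F[measurable]: "F b \<in> borel_measurable borel" for b
    unfolding F_def cis_conv_exp by measurable
  have eq: "complex_of_real (gauss k) * cis (k \<bullet> x) = (\<Prod>b\<in>Basis. F b (k \<bullet> b))" for k
  proof -
    have "gauss k = (\<Prod>b\<in>Basis. exp (- (k \<bullet> b)\<^sup>2 / 2))"
      by (simp add: gauss_def norm_sq_Basis exp_sum[symmetric] sum_divide_distrib sum_negf)
    moreover have "cis (k \<bullet> x) = (\<Prod>b\<in>Basis. cis ((k \<bullet> b) * (x \<bullet> b)))"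
      by (subst euclidean_inner) (simp add: cis_sum)
    ultimately show ?thesis by (simp add: F_def prod.distrib)
  qed
  have 1: "integrable (\<Pi>\<^sub>M b\<in>Basis. lborel) (\<lambda>f. \<Prod>b\<in>Basis. F b (f b))"
    by (rule product_integrable_prod, simp, unfold F_def, rule gauss_cis_1)
  have 2: "(\<integral>f. (\<Prod>b\<in>Basis. F b (f b)) \<partial>(\<Pi>\<^sub>M b\<in>Basis. lborel))
      = (\<Prod>b\<in>Basis. of_real (sqrt (2 * pi) * exp (- (x \<bullet> b)\<^sup>2 / 2)))"
    by (subst product_integral_prod, simp, unfold F_def, rule gauss_cis_1, unfold gauss_cis_1, rule refl)
  have 3: "(\<Prod>b\<in>Basis. sqrt (2 * pi) * exp (- (x \<bullet> b)\<^sup>2 / 2)) = sqrt (2 * pi) ^ DIM('a) * gauss x"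
    by (simp add: prod.distrib gauss_def norm_sq_Basis exp_sum[symmetric] sum_divide_distrib sum_negf)
  show "integrable lborel (\<lambda>k::'a. complex_of_real (gauss k) * cis (k \<bullet> x))"
    unfolding eq by (subst lborel_eq, subst integrable_distr_eq) (use 1 in simp_all)
  show "(LINT k|lborel. complex_of_real (gauss k) * cis (k \<bullet> x))
           = of_real (sqrt (2 * pi) ^ DIM('a) * gauss x)"
  proof -
    have "(LINT k|lborel. complex_of_real (gauss (k::'a)) * cis (k \<bullet> x))
        = (\<integral>f. (\<Prod>b\<in>Basis. F b (f b)) \<partial>(\<Pi>\<^sub>M b\<in>Basis. lborel))"
      unfolding eq by (subst lborel_eq, subst integral_distr) simp_all
    then show ?thesis
      unfolding 2 of_real_prod[symmetric] 3 .
  qed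
qed

lemma gauss_integrable[simp]: "integrable lborel (gauss :: 'a::euclidean_space \<Rightarrow> real)"
  and integral_gauss: "(LINT k|lborel. gauss (k::'a)) = sqrt (2 * pi) ^ DIM('a)"
proof -
  have "integrable lborel (\<lambda>k::'a. complex_of_real (gauss k))"
    using gauss_cis(1)[of "0::'a"] by simp
  then show "integrable lborel (gauss :: 'a::euclidean_space \<Rightarrow> real)"
    by (rule integrable_Re[where f="\<lambda>k. complex_of_real (gauss k)", simplified])
  have "(LINT k|lborel. complex_of_real (gauss (k::'a))) = of_real (sqrt (2 * pi) ^ DIM('a))"
    using gauss_cis(2)[of "0::'a"] by (simp add: gauss_def)
  then show "(LINT k|lborel. gauss (k::'a)) = sqrt (2 * pi) ^ DIM('a)"
    unfolding integral_complex_of_real of_real_eq_iff .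
qed

section \<open>The Fourier transform of integrable functions\<close>

lemma cis_measurable[measurable]: "cis \<in> borel_measurable borel"
  by (intro borel_measurable_continuous_onI continuous_on_cis continuous_on_id)

lemma cnj_measurable[measurable]: "cnj \<in> borel_measurable borel"
  by (intro borel_measurable_continuous_onI continuous_intros)

lemma integrable_pair_mult:
  fixes h :: "'a::euclidean_space \<Rightarrow> complex" and w :: "'b::euclidean_space \<Rightarrow> complex"
  assumes "integrable lborel h" "integrable lborel w"
  shows "integrable (lborel \<Otimes>\<^sub>M lborel) (\<lambda>(x, y). h x * w y)"
proof (rule lborel_pair.Fubini_integrable)
  have [measurable]: "h \<in> borel_measurable borel" "w \<in> borel_measurable borel" using assms by auto
  show "(\<lambda>(x, y). h x * w y) \<in> borel_measurable (lborel \<Otimes>\<^sub>M lborel)" by measurable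
  show "integrable lborel (\<lambda>x. LINT y|lborel. norm (case (x, y) of (x, y) \<Rightarrow> h x * w y))"
    using assms(1) by (simp add: norm_mult)
  show "AE x in lborel. integrable lborel (\<lambda>y. case (x, y) of (x, y) \<Rightarrow> h x * w y)"
    using assms(2) by simp
qed

text \<open>The transform as an honest integral, meaningful for integrable functions;
  \<open>fourier\<close> and \<open>fourier_x\<close> are limits of it along truncations.\<close>

definition FT :: "('a::euclidean_space \<Rightarrow> complex) \<Rightarrow> 'a \<Rightarrow> complex" where
  "FT h k = (LINT x|lborel. h x * cis (k \<bullet> x))"

lemma FT_measurable[measurable (raw)]:
  assumes [measurable]: "h \<in> borel_measurable borel" "g \<in> borel_measurable M"
  shows "(\<lambda>x. FT h (g x)) \<in> borel_measurable M"
proof -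
  have "FT h \<in> borel_measurable lborel"
    unfolding FT_def by measurable
  then have [measurable]: "FT h \<in> borel_measurable borel" by simp
  show ?thesis by measurable
qed

lemma integrable_mult_cis:
  fixes h :: "'a::euclidean_space \<Rightarrow> complex"
  assumes "integrable lborel h"
  shows "integrable lborel (\<lambda>x. h x * cis (k \<bullet> x))"
proof (rule Bochner_Integration.integrable_bound[OF assms])
  have [measurable]: "h \<in> borel_measurable borel" using assms by auto
  show "(\<lambda>x. h x * cis (k \<bullet> x)) \<in> borel_measurable lborel" by measurable
qed (simp add: norm_mult)

lemma norm_FT_le:
  assumes "integrable lborel h"
  shows "cmod (FT h k) \<le> (LINT x|lborel. cmod (h x))"
  unfolding FT_def using integral_norm_bound[of lborel "\<lambda>x. h x * cis (k \<bullet> x)"]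
  by (simp add: norm_mult)

lemma integrable_bounded_mult:
  fixes f w :: "'a \<Rightarrow> complex"
  assumes w: "integrable M w" and "f \<in> borel_measurable M" and B: "\<And>x. cmod (f x) \<le> B"
  shows "integrable M (\<lambda>x. f x * w x)"
proof (rule Bochner_Integration.integrable_bound)
  show "integrable M (\<lambda>x. B * cmod (w x))" using w by simp
  have "0 \<le> B" using order_trans[OF norm_ge_zero B[of undefined]] .
  then show "AE x in M. norm (f x * w x) \<le> norm (B * cmod (w x))"
    using B by (auto simp: norm_mult intro!: mult_right_mono)
qed (use assms in measurable)

text \<open>The kernel \<open>cis (k \<bullet> x)\<close> is symmetric in its arguments and of
  modulus 1, so the double integral is dominated by that of \<open>h x * w k\<close> and Fubini
  applies.\<close>

lemma FT_mult_swap: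
  fixes h w :: "'a::euclidean_space \<Rightarrow> complex"
  assumes h: "integrable lborel h" and w: "integrable lborel w"
  shows "(LINT k|lborel. FT h k * w k) = (LINT x|lborel. h x * FT w x)"
proof -
  have [measurable]: "h \<in> borel_measurable borel" "w \<in> borel_measurable borel" using assms by auto
  have "integrable (lborel \<Otimes>\<^sub>M lborel) (\<lambda>z. cis (snd z \<bullet> fst z) * (\<lambda>(x, k). h x * w k) z)"
    by (rule integrable_bounded_mult[OF integrable_pair_mult[OF h w], where B=1]) auto
  then have int: "integrable (lborel \<Otimes>\<^sub>M lborel) (\<lambda>(x, k). h x * cis (k \<bullet> x) * w k)"
    by (simp add: case_prod_unfold mult_ac)
  have "(LINT k|lborel. FT h k * w k) = (LINT k|lborel. LINT x|lborel. h x * cis (k \<bullet> x) * w k)"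
    unfolding FT_def by (subst integral_mult_left_zero[symmetric]) (rule refl)
  also have "\<dots> = (LINT x|lborel. LINT k|lborel. h x * cis (k \<bullet> x) * w k)"
    by (rule lborel_pair.Fubini_integral[OF int])
  also have "\<dots> = (LINT x|lborel. h x * FT w x)"
  proof -
    have "(LINT k|lborel. h x * cis (k \<bullet> x) * w k) = h x * FT w x" for x
      unfolding FT_def integral_mult_right_zero[symmetric]
      by (intro Bochner_Integration.integral_cong refl) (simp only: mult_ac inner_commute)
    then show ?thesis by simp
  qed
  finally show ?thesis .
qed

text \<open>\<open>FT u\<close> is merely bounded; the Gaussian factor makes the frequency integral
  converge absolutely. Moved onto \<open>h\<close>, the product becomes an average of
  \<open>u\<close> around \<open>x\<close> at scale \<open>e\<close>, an approximate identity as
  \<open>e\<close> tends to 0.\<close>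

lemma FT_regularised:
  fixes h u :: "'a::euclidean_space \<Rightarrow> complex"
  assumes h: "integrable lborel h" and u: "integrable lborel u" and e: "e > 0"
  shows "(LINT k|lborel. FT h k * (FT u (- k) * gauss (e *\<^sub>R k)))
    = of_real (sqrt (2 * pi) ^ DIM('a)) *
      (LINT x|lborel. h x * (LINT z|lborel. u (x + e *\<^sub>R z) * gauss z))"
proof -
  have [measurable]: "h \<in> borel_measurable borel" "u \<in> borel_measurable borel" using assms by auto
  have gi: "integrable lborel (\<lambda>k::'a. complex_of_real (gauss (e *\<^sub>R k)))"
    using integrable_lborel_affine[of e "gauss :: 'a \<Rightarrow> real" 0] e by auto
  have w: "integrable lborel (\<lambda>k. FT u (- k) * complex_of_real (gauss (e *\<^sub>R k)))"
    by (rule integrable_bounded_mult[OF gi _ norm_FT_le[OF u]]) measurable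
  have inner: "FT (\<lambda>k. FT u (- k) * complex_of_real (gauss (e *\<^sub>R k))) x
      = of_real (sqrt (2 * pi) ^ DIM('a)) * (LINT z|lborel. u (x + e *\<^sub>R z) * gauss z)" for x
  proof -
    \<comment> \<open>Centring at \<open>x\<close> and rescaling by \<open>e\<close> absorbs the
      phase \<open>cis (k \<bullet> x)\<close> and leaves the transform of \<open>v\<close> at
      \<open>(- e) *\<^sub>R k\<close> with the Jacobian \<open>e ^ DIM('a)\<close>.\<close>
    define v where "v z = u (x + e *\<^sub>R z)" for z
    have v: "integrable lborel v"
      unfolding v_def using integrable_lborel_affine[OF _ u, of e x] e by auto
    have [measurable]: "v \<in> borel_measurable borel" using v by auto
    have FTu: "FT u (- k) * cis (k \<bullet> x) = e ^ DIM('a) *\<^sub>R FT v ((- e) *\<^sub>R k)" for k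
    proof -
      have "FT u (- k) = e ^ DIM('a) *\<^sub>R (LINT z|lborel. u (x + e *\<^sub>R z) * cis ((-k) \<bullet> (x + e *\<^sub>R z)))"
        unfolding FT_def using e by (subst integral_lborel_affine[where c=e and t=x]) auto
      then have "FT u (- k) * cis (k \<bullet> x) =
          e ^ DIM('a) *\<^sub>R (LINT z|lborel. u (x + e *\<^sub>R z) * cis ((-k) \<bullet> (x + e *\<^sub>R z)) * cis (k \<bullet> x))"
        by (simp add: integral_mult_left_zero)
      also have "(\<lambda>z. u (x + e *\<^sub>R z) * cis ((-k) \<bullet> (x + e *\<^sub>R z)) * cis (k \<bullet> x))
          = (\<lambda>z. v z * cis (((- e) *\<^sub>R k) \<bullet> z))"
        by (auto simp: v_def cis_mult mult.assoc inner_simps)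
      finally show ?thesis unfolding FT_def .
    qed
    have "FT (\<lambda>k. FT u (- k) * complex_of_real (gauss (e *\<^sub>R k))) x
       = (LINT k|lborel. e ^ DIM('a) *\<^sub>R (FT v ((- e) *\<^sub>R k) * gauss ((- e) *\<^sub>R k)))"
      unfolding FT_def[of _ x]
    proof (rule Bochner_Integration.integral_cong[OF refl])
      fix k
      have "FT u (- k) * complex_of_real (gauss (e *\<^sub>R k)) * cis (x \<bullet> k)
         = (FT u (- k) * cis (k \<bullet> x)) * complex_of_real (gauss (e *\<^sub>R k))"
        by (simp add: inner_commute)
      also have "\<dots> = e ^ DIM('a) *\<^sub>R (FT v ((- e) *\<^sub>R k) * gauss ((- e) *\<^sub>R k))"
        unfolding FTu by simp
      finally show "FT u (- k) * complex_of_real (gauss (e *\<^sub>R k)) * cis (x \<bullet> k) = \<dots>" .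
    qed
    \<comment> \<open>Dilation by \<open>- e\<close> undoes the Jacobian, which depends only on the
      modulus of the ratio.\<close>
    also have "\<dots> = (LINT k|lborel. FT v k * gauss k)"
      using e by (subst (2) integral_lborel_affine[where c="-e" and t=0]) auto
    also have "\<dots> = (LINT z|lborel. v z * FT (\<lambda>k. complex_of_real (gauss k)) z)"
      by (rule FT_mult_swap[OF v]) simp
    also have "\<dots> = (LINT z|lborel. of_real (sqrt (2 * pi) ^ DIM('a)) * (v z * gauss z))"
    proof -
      have "FT (\<lambda>k. complex_of_real (gauss k)) z = of_real (sqrt (2 * pi) ^ DIM('a) * gauss z)" for z :: 'a
        unfolding FT_def using gauss_cis(2)[of z] by (simp add: inner_commute)
      then show ?thesis by (simp add: mult_ac)
    qed
    also have "\<dots> = of_real (sqrt (2 * pi) ^ DIM('a)) * (LINT z|lborel. v z * gauss z)"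
      by (rule integral_mult_right_zero)
    finally show ?thesis unfolding v_def .
  qed
  show ?thesis
    unfolding FT_mult_swap[OF h w] inner integral_mult_right_zero[symmetric]
    by (intro Bochner_Integration.integral_cong refl) (simp only: mult_ac)
qed

section \<open>The Plancherel inequality\<close>

lemma nn_integral_lborel_translate:
  fixes f :: "'a::euclidean_space \<Rightarrow> ennreal"
  assumes [measurable]: "f \<in> borel_measurable borel"
  shows "(\<integral>\<^sup>+x. f (x + t) \<partial>lborel) = (\<integral>\<^sup>+x. f x \<partial>lborel)"
proof -
  have "(\<integral>\<^sup>+x. f x \<partial>lborel) = (\<integral>\<^sup>+x. f x \<partial>distr lborel borel ((+) t))"
    unfolding lborel_distr_plus ..
  also have "\<dots> = (\<integral>\<^sup>+x. f (t + x) \<partial>lborel)"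
    by (rule nn_integral_distr) simp_all
  finally show ?thesis by (simp only: add.commute)
qed

text \<open>A non-integrable \<open>f\<close> has Bochner integral 0, so the bound is
  unconditional.\<close>

lemma norm_integral_le_nn_integral:
  fixes f :: "'a \<Rightarrow> 'b::{banach,second_countable_topology}"
  shows "ennreal (norm (integral\<^sup>L M f)) \<le> (\<integral>\<^sup>+x. norm (f x) \<partial>M)"
  by (cases "integrable M f") (auto simp: integral_norm_bound_ennreal not_integrable_integral_eq)

lemma gauss_scale_tendsto:
  "(\<lambda>n. gauss ((1 / real (Suc n)) *\<^sub>R k)) \<longlonglongrightarrow> 1"
proof -
  have "(\<lambda>n. 1 / real (Suc n)) \<longlonglongrightarrow> 0"
    using LIMSEQ_inverse_real_of_nat by (simp add: inverse_eq_divide)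
  then have lim: "(\<lambda>n. (1 / real (Suc n)) *\<^sub>R k) \<longlonglongrightarrow> 0 *\<^sub>R k"
    by (rule tendsto_scaleR) (rule tendsto_const)
  have cont: "isCont gauss (0 *\<^sub>R k)"
    unfolding gauss_def by (intro continuous_intros) auto
  show ?thesis
    using isCont_tendsto_compose[OF cont lim] by (simp add: gauss_def)
qed

lemma power_sqrt_2pi: "sqrt (2 * pi) ^ n * sqrt (2 * pi) ^ n = (2 * pi) ^ n"
  unfolding power_mult_distrib[symmetric] by simp

lemma ennreal_half_sum:
  assumes "0 \<le> a" "0 \<le> b" "0 \<le> g"
  shows "ennreal g * ((ennreal a + ennreal b) / 2) = ennreal (g * ((a + b) / 2))"
proof -
  have "(ennreal a + ennreal b) / 2 = ennreal (a + b) / ennreal 2"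
    using assms by (simp add: ennreal_plus)
  also have "\<dots> = ennreal ((a + b) / 2)"
    using assms by (subst divide_ennreal) auto
  finally show ?thesis
    using ennreal_mult[of g "(a + b) / 2"] assms by simp
qed

lemma ennreal_half_double: "((N::ennreal) + N) / 2 = N"
  by (simp add: mult_2[symmetric] ennreal_mult_divide_eq mult.commute[of 2])

text \<open>\<open>FT_regularised\<close> with \<open>u\<close> the conjugate of \<open>h\<close>
  expresses the Gaussian-weighted square norm of \<open>FT h\<close> as a correlation of
  \<open>h\<close> with its translates. The arithmetic-geometric mean inequality and translation
  invariance bound it uniformly in \<open>e\<close>; Fatou's lemma then removes the weight.\<close>

lemma FT_Plancherel_le:
  fixes h :: "'a::euclidean_space \<Rightarrow> complex"
  assumes h: "integrable lborel h"
  shows "(\<integral>\<^sup>+k. (cmod (FT h k))\<^sup>2 \<partial>lborel) \<le> ennreal ((2 * pi) ^ DIM('a)) * (\<integral>\<^sup>+x. (cmod (h x))\<^sup>2 \<partial>lborel)"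
    (is "_ \<le> ?C * ?N")
proof -
  have [measurable]: "h \<in> borel_measurable borel" using h by auto
  define c where "c = sqrt (2 * pi) ^ DIM('a)"
  have cnj: "FT (\<lambda>x. cnj (h x)) (- k) = cnj (FT h k)" for k
  proof -
    have "cnj (FT h k) = (LINT x|lborel. cnj (h x * cis (k \<bullet> x)))"
      unfolding FT_def by (rule Bochner_Integration.integral_cnj[symmetric])
    then show ?thesis unfolding FT_def by (simp add: cis_cnj)
  qed
  have gauss_nn: "(\<integral>\<^sup>+z. gauss (z::'a) \<partial>lborel) = ennreal c"
    unfolding c_def integral_gauss[symmetric] by (rule nn_integral_eq_integral) auto
  have bound: "(\<integral>\<^sup>+k. ennreal ((cmod (FT h k))\<^sup>2 * gauss (e *\<^sub>R k)) \<partial>lborel) \<le> ?C * ?N"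
    if e: "e > 0" for e :: real
  proof -
    have gi: "integrable lborel (\<lambda>k::'a. complex_of_real (gauss (e *\<^sub>R k)))"
      using integrable_lborel_affine[of e "gauss :: 'a \<Rightarrow> real" 0] e by auto
    have i0: "integrable lborel (\<lambda>k. (FT h k * cnj (FT h k)) * complex_of_real (gauss (e *\<^sub>R k)))"
      by (rule integrable_bounded_mult[OF gi, where B="(LINT x|lborel. cmod (h x))\<^sup>2"])
        (measurable, simp add: norm_mult power2_eq_square mult_mono norm_FT_le h)
    have eq0: "(\<lambda>k. (FT h k * cnj (FT h k)) * complex_of_real (gauss (e *\<^sub>R k)))
       = (\<lambda>k. complex_of_real ((cmod (FT h k))\<^sup>2 * gauss (e *\<^sub>R k)))"
      by (simp only: complex_norm_square of_real_mult)
    have i1: "integrable lborel (\<lambda>k. (cmod (FT h k))\<^sup>2 * gauss (e *\<^sub>R k))"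
      using i0 unfolding eq0 complex_of_real_integrable_eq .
    have "(\<integral>\<^sup>+k. ennreal ((cmod (FT h k))\<^sup>2 * gauss (e *\<^sub>R k)) \<partial>lborel)
        = ennreal (LINT k|lborel. (cmod (FT h k))\<^sup>2 * gauss (e *\<^sub>R k))"
      by (rule nn_integral_eq_integral[OF i1]) simp
    also have "(LINT k|lborel. (cmod (FT h k))\<^sup>2 * gauss (e *\<^sub>R k))
        = cmod (LINT k|lborel. complex_of_real ((cmod (FT h k))\<^sup>2 * gauss (e *\<^sub>R k)))"
      by (subst integral_complex_of_real) (simp add: integral_nonneg_AE del: of_real_mult)
    also have "(LINT k|lborel. complex_of_real ((cmod (FT h k))\<^sup>2 * gauss (e *\<^sub>R k)))
        = (LINT k|lborel. FT h k * (FT (\<lambda>x. cnj (h x)) (- k) * gauss (e *\<^sub>R k)))"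
      unfolding eq0[symmetric] cnj by (simp add: mult.assoc)
    also have "\<dots> = of_real c *
      (LINT x|lborel. h x * (LINT z|lborel. cnj (h (x + e *\<^sub>R z)) * gauss z))"
      unfolding c_def using h e by (intro FT_regularised) auto
    also have "ennreal (cmod \<dots>) = ennreal c *
       ennreal (cmod (LINT x|lborel. h x * (LINT z|lborel. cnj (h (x + e *\<^sub>R z)) * gauss z)))"
      unfolding norm_mult norm_of_real by (subst ennreal_mult[symmetric]) (simp_all add: c_def)
    also have "\<dots> \<le> ennreal c * (\<integral>\<^sup>+x. \<integral>\<^sup>+z. ennreal (gauss z) * ((ennreal ((cmod (h x))\<^sup>2)
        + ennreal ((cmod (h (x + e *\<^sub>R z)))\<^sup>2)) / 2) \<partial>lborel \<partial>lborel)"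
    proof (intro mult_left_mono order_trans[OF norm_integral_le_nn_integral] nn_integral_mono)
      fix x
      have "ennreal (cmod (h x * (LINT z|lborel. cnj (h (x + e *\<^sub>R z)) * gauss z)))
        = cmod (LINT z|lborel. h x * (cnj (h (x + e *\<^sub>R z)) * gauss z))"
        by (simp only: integral_mult_right_zero)
      also have "\<dots> \<le> (\<integral>\<^sup>+z. cmod (h x * (cnj (h (x + e *\<^sub>R z)) * gauss z)) \<partial>lborel)"
        by (rule norm_integral_le_nn_integral)
      also have "\<dots> \<le> (\<integral>\<^sup>+z. ennreal (gauss z) * ((ennreal ((cmod (h x))\<^sup>2)
        + ennreal ((cmod (h (x + e *\<^sub>R z)))\<^sup>2)) / 2) \<partial>lborel)"
      proof (rule nn_integral_mono)
        fix z
        have "cmod (h x) * cmod (h (x + e *\<^sub>R z)) \<le> ((cmod (h x))\<^sup>2 + (cmod (h (x + e *\<^sub>R z)))\<^sup>2) / 2"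
          using sum_squares_bound[of "cmod (h x)" "cmod (h (x + e *\<^sub>R z))"] by simp
        from mult_left_mono[OF this gauss_nonneg[of z]]
        have "cmod (h x * (cnj (h (x + e *\<^sub>R z)) * gauss z))
          \<le> gauss z * (((cmod (h x))\<^sup>2 + (cmod (h (x + e *\<^sub>R z)))\<^sup>2) / 2)"
          by (simp add: norm_mult mult_ac)
        then have "ennreal (cmod (h x * (cnj (h (x + e *\<^sub>R z)) * gauss z)))
          \<le> ennreal (gauss z * (((cmod (h x))\<^sup>2 + (cmod (h (x + e *\<^sub>R z)))\<^sup>2) / 2))"
          by (rule ennreal_leI)
        then show "ennreal (cmod (h x * (cnj (h (x + e *\<^sub>R z)) * gauss z)))
          \<le> ennreal (gauss z) * ((ennreal ((cmod (h x))\<^sup>2)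
            + ennreal ((cmod (h (x + e *\<^sub>R z)))\<^sup>2)) / 2)"
          by (subst ennreal_half_sum) auto
      qed
      finally show "ennreal (cmod (h x * (LINT z|lborel. cnj (h (x + e *\<^sub>R z)) * gauss z)))
        \<le> (\<integral>\<^sup>+z. ennreal (gauss z) * ((ennreal ((cmod (h x))\<^sup>2)
        + ennreal ((cmod (h (x + e *\<^sub>R z)))\<^sup>2)) / 2) \<partial>lborel)" .
    qed simp
    also have "(\<integral>\<^sup>+x. \<integral>\<^sup>+z. ennreal (gauss z) * ((ennreal ((cmod (h x))\<^sup>2)
        + ennreal ((cmod (h (x + e *\<^sub>R z)))\<^sup>2)) / 2) \<partial>lborel \<partial>lborel)
       = (\<integral>\<^sup>+z. \<integral>\<^sup>+x. ennreal (gauss z) * ((ennreal ((cmod (h x))\<^sup>2)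
        + ennreal ((cmod (h (x + e *\<^sub>R z)))\<^sup>2)) / 2) \<partial>lborel \<partial>lborel)"
      by (rule lborel_pair.Fubini') measurable
    also have "\<dots> = (\<integral>\<^sup>+z. ennreal (gauss (z::'a)) * ((?N + ?N) / 2) \<partial>lborel)"
    proof (rule nn_integral_cong)
      \<comment> \<open>With \<open>z\<close> frozen by the exchange of integrals,
        \<open>x + e *\<^sub>R z\<close> is a fixed translation of \<open>x\<close>, so both squares
        integrate to the same norm.\<close>
      fix z :: 'a
      have "(\<integral>\<^sup>+x. ennreal ((cmod (h (x + e *\<^sub>R z)))\<^sup>2) \<partial>lborel) = ?N"
        by (rule nn_integral_lborel_translate[where f="\<lambda>x. ennreal ((cmod (h x))\<^sup>2)"]) measurable
      then show "(\<integral>\<^sup>+x. ennreal (gauss z) * ((ennreal ((cmod (h x))\<^sup>2)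
        + ennreal ((cmod (h (x + e *\<^sub>R z)))\<^sup>2)) / 2) \<partial>lborel) = ennreal (gauss z) * ((?N + ?N) / 2)"
        by (simp add: nn_integral_cmult nn_integral_divide nn_integral_add)
    qed
    also have "\<dots> = ennreal c * ?N"
      unfolding ennreal_half_double by (simp add: nn_integral_multc gauss_nn)
    also have "ennreal c * (ennreal c * ?N) = ?C * ?N"
      by (simp add: mult.assoc[symmetric] ennreal_mult[symmetric] c_def power_sqrt_2pi)
    finally show ?thesis .
  qed
  have "(\<integral>\<^sup>+k. (cmod (FT h k))\<^sup>2 \<partial>lborel)
    = (\<integral>\<^sup>+k. liminf (\<lambda>n. ennreal ((cmod (FT h k))\<^sup>2 * gauss ((1 / real (Suc n)) *\<^sub>R k))) \<partial>lborel)"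
  proof (rule nn_integral_cong)
    fix k
    have "(\<lambda>n. ennreal ((cmod (FT h k))\<^sup>2 * gauss ((1 / real (Suc n)) *\<^sub>R k))) \<longlonglongrightarrow> ennreal ((cmod (FT h k))\<^sup>2 * 1)"
      by (intro tendsto_intros tendsto_ennrealI gauss_scale_tendsto)
    from lim_imp_Liminf[OF _ this]
    show "ennreal ((cmod (FT h k))\<^sup>2) = liminf (\<lambda>n. ennreal ((cmod (FT h k))\<^sup>2 * gauss ((1 / real (Suc n)) *\<^sub>R k)))"
      by simp
  qed
  also have "\<dots> \<le> liminf (\<lambda>n. \<integral>\<^sup>+k. ennreal ((cmod (FT h k))\<^sup>2 * gauss ((1 / real (Suc n)) *\<^sub>R k)) \<partial>lborel)"
    by (rule nn_integral_liminf) measurable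
  also have "\<dots> \<le> ?C * ?N"
    using bound by (intro Liminf_le always_eventually allI) simp_all
  finally show ?thesis .
qed

lemma L2_measurable: "f \<in> L2 \<Longrightarrow> f \<in> borel_measurable borel"
  by (simp add: L2_def)

lemma L2_iff_nn: "f \<in> L2 \<longleftrightarrow> f \<in> borel_measurable borel \<and> (\<integral>\<^sup>+x. ennreal ((cmod (f x))\<^sup>2) \<partial>lborel) < \<infinity>"
  unfolding L2_def by (auto simp: integrable_iff_bounded)

lemma nn_integral_L2:
  assumes "f \<in> L2"
  shows "(\<integral>\<^sup>+x. ennreal ((cmod (f x))\<^sup>2) \<partial>lborel) = ennreal ((L2norm f)\<^sup>2)"
proof -
  have "0 \<le> (LINT x|lborel. (cmod (f x))\<^sup>2)" by (simp add: integral_nonneg_AE)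
  then show ?thesis
    using assms unfolding L2_def L2norm_def by (subst nn_integral_eq_integral) auto
qed

lemma L2_mult_integrable:
  assumes f: "f \<in> L2" and g: "g \<in> L2"
  shows "integrable lborel (\<lambda>x. f x * g x)"
proof (rule Bochner_Integration.integrable_bound)
  show "integrable lborel (\<lambda>x. (cmod (f x))\<^sup>2 + (cmod (g x))\<^sup>2)"
    using f g by (auto simp: L2_def)
  show "(\<lambda>x. f x * g x) \<in> borel_measurable lborel"
    using f g by (auto simp: L2_def)
  show "AE x in lborel. norm (f x * g x) \<le> norm ((cmod (f x))\<^sup>2 + (cmod (g x))\<^sup>2)"
  proof (rule AE_I2)
    fix x
    have "2 * (cmod (f x) * cmod (g x)) \<le> (cmod (f x))\<^sup>2 + (cmod (g x))\<^sup>2"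
      using sum_squares_bound[of "cmod (f x)" "cmod (g x)"] by simp
    then have "cmod (f x) * cmod (g x) \<le> (cmod (f x))\<^sup>2 + (cmod (g x))\<^sup>2"
      using mult_nonneg_nonneg[OF norm_ge_zero norm_ge_zero, of "f x" "g x"] by linarith
    then show "norm (f x * g x) \<le> norm ((cmod (f x))\<^sup>2 + (cmod (g x))\<^sup>2)"
      by (simp add: norm_mult)
  qed
qed

lemma FT_L2:
  assumes "integrable lborel h" "h \<in> L2"
  shows "FT h \<in> L2"
proof -
  have [measurable]: "h \<in> borel_measurable borel" using assms by auto
  have "(\<integral>\<^sup>+k. (cmod (FT h k))\<^sup>2 \<partial>lborel) < \<infinity>"
    by (rule le_less_trans[OF FT_Plancherel_le[OF assms(1)]])
      (use assms(2) in \<open>simp add: L2_iff_nn ennreal_mult_less_top\<close>)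
  moreover have "FT h \<in> borel_measurable borel" by measurable
  ultimately show ?thesis unfolding L2_iff_nn by blast
qed

text \<open>Dominated convergence twice: in \<open>z\<close> for each \<open>x\<close>, by
  continuity and boundedness of \<open>u\<close>, and then in \<open>x\<close>, dominated by a
  multiple of \<open>cmod (h x)\<close>. The constant is the total mass of the unnormalised
  Gaussian.\<close>

lemma gauss_mollify_tendsto:
  fixes h u :: "'a::euclidean_space \<Rightarrow> complex"
  assumes h: "integrable lborel h" and u: "continuous_on UNIV u" and B: "\<And>x. cmod (u x) \<le> B"
  shows "(\<lambda>n. LINT x|lborel. h x * (LINT z|lborel. u (x + (1 / real (Suc n)) *\<^sub>R z) * gauss z))
    \<longlonglongrightarrow> of_real (sqrt (2 * pi) ^ DIM('a)) * (LINT x|lborel. h x * u x)"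
proof -
  have um[measurable]: "u \<in> borel_measurable borel"
    using u by (rule borel_measurable_continuous_onI)
  have [measurable]: "h \<in> borel_measurable borel" using h by auto
  define c :: complex where "c = of_real (sqrt (2 * pi) ^ DIM('a))"
  define d where "d n = 1 / real (Suc n)" for n
  have d: "d \<longlonglongrightarrow> 0"
    unfolding d_def using LIMSEQ_inverse_real_of_nat by (simp add: inverse_eq_divide)
  have inner: "(\<lambda>n. LINT z|lborel. u (x + d n *\<^sub>R z) * gauss z) \<longlonglongrightarrow> c * u x" for x
  proof -
    have "(\<lambda>n. LINT z|lborel. u (x + d n *\<^sub>R z) * complex_of_real (gauss z))
        \<longlonglongrightarrow> (LINT z|lborel. u x * complex_of_real (gauss (z::'a)))"
    proof (rule integral_dominated_convergence)
      show "integrable lborel (\<lambda>z::'a. B * gauss z)" by simp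
      show "AE z in lborel. (\<lambda>n. u (x + d n *\<^sub>R z) * complex_of_real (gauss z)) \<longlonglongrightarrow> u x * complex_of_real (gauss z)"
      proof (rule AE_I2)
        fix z :: 'a
        have "(\<lambda>n. x + d n *\<^sub>R z) \<longlonglongrightarrow> x + 0 *\<^sub>R z"
          by (rule tendsto_add[OF tendsto_const tendsto_scaleR[OF d tendsto_const]])
        moreover have "isCont u (x + 0 *\<^sub>R z)"
          using u by (simp add: continuous_on_eq_continuous_at)
        ultimately have "(\<lambda>n. u (x + d n *\<^sub>R z)) \<longlonglongrightarrow> u (x + 0 *\<^sub>R z)"
          using isCont_tendsto_compose by blast
        then show "(\<lambda>n. u (x + d n *\<^sub>R z) * complex_of_real (gauss z)) \<longlonglongrightarrow> u x * complex_of_real (gauss z)"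
          using tendsto_mult[OF _ tendsto_const] by fastforce
      qed
      show "AE z in lborel. norm (u (x + d n *\<^sub>R z) * complex_of_real (gauss z)) \<le> B * gauss z" for n
        using B by (auto simp: norm_mult intro!: mult_right_mono)
    qed measurable
    also have "(LINT z|lborel. u x * complex_of_real (gauss (z::'a))) = u x * complex_of_real (LINT z|lborel. gauss (z::'a))"
      by simp
    also have "\<dots> = c * u x"
      unfolding integral_gauss c_def by simp
    finally show ?thesis .
  qed
  have bound: "cmod (LINT z|lborel. u (x + e *\<^sub>R z) * gauss z) \<le> B * (sqrt (2 * pi) ^ DIM('a))" for x e
  proof -
    have "cmod (LINT z|lborel. u (x + e *\<^sub>R z) * gauss z) \<le> (LINT z|lborel. B * gauss (z::'a))"
    proof (rule Bochner_Integration.integral_norm_bound_integral)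
      have gi: "integrable lborel (\<lambda>z::'a. complex_of_real (gauss z))" by simp
      show "integrable lborel (\<lambda>z. u (x + e *\<^sub>R z) * complex_of_real (gauss z))"
        by (rule integrable_bounded_mult[OF gi _ B]) measurable
    qed (use B in \<open>auto simp: norm_mult intro!: mult_right_mono\<close>)
    then show ?thesis by (simp add: integral_gauss)
  qed
  have "(\<lambda>n. LINT x|lborel. h x * (LINT z|lborel. u (x + d n *\<^sub>R z) * gauss z))
    \<longlonglongrightarrow> (LINT x|lborel. h x * (c * u x))"
  proof (rule integral_dominated_convergence)
    show "integrable lborel (\<lambda>x. cmod (h x) * (B * (sqrt (2 * pi) ^ DIM('a))))"
      using h by simp
    show "AE x in lborel. (\<lambda>n. h x * (LINT z|lborel. u (x + d n *\<^sub>R z) * gauss z)) \<longlonglongrightarrow> h x * (c * u x)"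
      by (rule AE_I2) (rule tendsto_mult[OF tendsto_const inner])
    show "AE x in lborel. norm (h x * (LINT z|lborel. u (x + d n *\<^sub>R z) * gauss z))
        \<le> cmod (h x) * (B * (sqrt (2 * pi) ^ DIM('a)))" for n
      by (rule AE_I2) (unfold norm_mult, intro mult_left_mono bound norm_ge_zero)
  qed measurable
  also have "(\<lambda>x. h x * (c * u x)) = (\<lambda>x. c * (h x * u x))"
    by (simp add: mult_ac)
  also have "(LINT x|lborel. c * (h x * u x)) = c * (LINT x|lborel. h x * u x)"
    by (rule integral_mult_right_zero)
  finally show ?thesis unfolding c_def d_def .
qed

text \<open>The Gaussian stays inside because \<open>FT h k * FT u (- k)\<close> need not be
  integrable for merely integrable \<open>h\<close>; the uniqueness theorem is derived from this
  form. The constant is the mass of the Gaussian times the factor in its transform.\<close>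

lemma FT_pairing_tendsto:
  fixes h u :: "'a::euclidean_space \<Rightarrow> complex"
  assumes h: "integrable lborel h" and ui: "integrable lborel u"
    and u: "continuous_on UNIV u" and B: "\<And>x. cmod (u x) \<le> B"
  shows "(\<lambda>n. LINT k|lborel. FT h k * (FT u (- k) * gauss ((1 / real (Suc n)) *\<^sub>R k)))
    \<longlonglongrightarrow> of_real ((2 * pi) ^ DIM('a)) * (LINT x|lborel. h x * u x)"
proof -
  have "(\<lambda>n. of_real (sqrt (2 * pi) ^ DIM('a)) *
      (LINT x|lborel. h x * (LINT z|lborel. u (x + (1 / real (Suc n)) *\<^sub>R z) * gauss z)))
    \<longlonglongrightarrow> of_real (sqrt (2 * pi) ^ DIM('a)) *
        (of_real (sqrt (2 * pi) ^ DIM('a)) * (LINT x|lborel. h x * u x))"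
    by (rule tendsto_mult[OF tendsto_const gauss_mollify_tendsto[OF h u B]])
  also have "of_real (sqrt (2 * pi) ^ DIM('a)) *
        (of_real (sqrt (2 * pi) ^ DIM('a)) * (LINT x|lborel. h x * u x))
      = of_real ((2 * pi) ^ DIM('a)) * (LINT x|lborel. h x * u x)"
    unfolding mult.assoc[symmetric] of_real_mult[symmetric] power_sqrt_2pi ..
  also have "(\<lambda>n. of_real (sqrt (2 * pi) ^ DIM('a)) *
      (LINT x|lborel. h x * (LINT z|lborel. u (x + (1 / real (Suc n)) *\<^sub>R z) * gauss z)))
    = (\<lambda>n. LINT k|lborel. FT h k * (FT u (- k) * gauss ((1 / real (Suc n)) *\<^sub>R k)))"
    by (intro ext FT_regularised[symmetric] h ui) simp
  finally show ?thesis .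
qed

text \<open>For square-integrable \<open>h\<close> and \<open>u\<close> the Plancherel inequality
  makes the product of the transforms integrable, so dominated convergence takes the Gaussian
  away.\<close>

lemma FT_Parseval:
  fixes h u :: "'a::euclidean_space \<Rightarrow> complex"
  assumes h: "integrable lborel h" "h \<in> L2" and ui: "integrable lborel u" "u \<in> L2"
    and u: "continuous_on UNIV u" and B: "\<And>x. cmod (u x) \<le> B"
  shows "(LINT k|lborel. FT h k * FT u (- k)) = of_real ((2 * pi) ^ DIM('a)) * (LINT x|lborel. h x * u x)"
proof (rule LIMSEQ_unique[OF _ FT_pairing_tendsto[OF h(1) ui(1) u B]])
  have [measurable]: "h \<in> borel_measurable borel" "u \<in> borel_measurable borel" using h ui by auto
  \<comment> \<open>The reflection exhibits \<open>FT u (- k)\<close> as a transform in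
    \<open>k\<close>, hence as square-integrable.\<close>
  define v where "v x = u (- x)" for x
  have "integrable lborel v"
    unfolding v_def using integrable_lborel_affine[OF _ ui(1), of "-1" 0] by simp
  moreover have "v \<in> L2"
    using ui(2) integrable_lborel_affine[of "-1" "\<lambda>x. (cmod (u x))\<^sup>2" 0]
    unfolding L2_def v_def by simp
  ultimately have "FT v \<in> L2" by (rule FT_L2)
  moreover have FTv: "FT v k = FT u (- k)" for k
    unfolding FT_def v_def by (subst integral_lborel_affine[of "-1" _ 0]) simp_all
  ultimately have "integrable lborel (\<lambda>k. FT h k * FT v k)"
    using FT_L2[OF h] by (intro L2_mult_integrable)
  then have int: "integrable lborel (\<lambda>k. FT h k * FT u (- k))" unfolding FTv .
  show "(\<lambda>n. LINT k|lborel. FT h k * (FT u (- k) * gauss ((1 / real (Suc n)) *\<^sub>R k)))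
    \<longlonglongrightarrow> (LINT k|lborel. FT h k * FT u (- k))"
  proof (rule integral_dominated_convergence)
    show "integrable lborel (\<lambda>k. cmod (FT h k * FT u (- k)))" using int by simp
    show "AE k in lborel. (\<lambda>n. FT h k * (FT u (- k) * gauss ((1 / real (Suc n)) *\<^sub>R k))) \<longlonglongrightarrow> FT h k * FT u (- k)"
    proof (rule AE_I2)
      fix k
      have "(\<lambda>n. FT h k * (FT u (- k) * gauss ((1 / real (Suc n)) *\<^sub>R k))) \<longlonglongrightarrow> FT h k * (FT u (- k) * of_real 1)"
        by (intro tendsto_mult tendsto_const tendsto_of_real gauss_scale_tendsto)
      then show "(\<lambda>n. FT h k * (FT u (- k) * gauss ((1 / real (Suc n)) *\<^sub>R k))) \<longlonglongrightarrow> FT h k * FT u (- k)"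
        by simp
    qed
    show "AE k in lborel. norm (FT h k * (FT u (- k) * gauss ((1 / real (Suc n)) *\<^sub>R k)))
      \<le> cmod (FT h k * FT u (- k))" for n
      by (rule AE_I2) (simp add: norm_mult mult.assoc[symmetric] mult_left_le)
  qed measurable
qed

text \<open>Open boxes are stable under intersection and generate the Borel sets. The total integral
  is a separate assumption because the whole space is not a box, and complements refer to
  it.\<close>

lemma integral_box_0_imp_AE_0:
  fixes h :: "'a::euclidean_space \<Rightarrow> complex"
  assumes h: "integrable lborel h" and all: "(LINT x|lborel. h x) = 0"
    and box: "\<And>a b. (LINT x:box a b|lborel. h x) = 0"
  shows "AE x in lborel. h x = 0"
proof (rule sigma_finite_measure.density_zero[OF sigma_finite_lborel h])
  have S: "set_integrable lborel A h" if "A \<in> sets borel" for A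
    using that h unfolding set_integrable_def by (intro integrable_mult_indicator) auto
  have *: "(LINT x:A|lborel. h x) = 0" if "A \<in> sets borel" for A
  proof -
    have gen: "sets (borel::'a measure) = sigma_sets UNIV (range (\<lambda>(a, b). box a b::'a set))"
      by (simp add: borel_eq_box)
    have "Int_stable (range (\<lambda>(a, b). box a b::'a set))"
      by (auto simp: Int_stable_def box_Int_box)
    moreover have "range (\<lambda>(a, b). box a b::'a set) \<subseteq> Pow UNIV" by simp
    moreover have "A \<in> sigma_sets UNIV (range (\<lambda>(a, b). box a b::'a set))" using that gen by simp
    ultimately show ?thesis
    proof (induction rule: sigma_sets_induct_disjoint)
      case (basic A)
      then show ?case using box by auto
    next
      case empty
      then show ?case by (simp add: set_lebesgue_integral_def)
    next
      case (compl A)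
      then have A: "A \<in> sets borel" by (simp add: gen)
      have "(LINT x|lborel. h x) = (LINT x:A \<union> (UNIV - A)|lborel. h x)"
        by (simp add: set_lebesgue_integral_def)
      also have "\<dots> = (LINT x:A|lborel. h x) + (LINT x:UNIV - A|lborel. h x)"
        by (rule set_integral_Un) (use A S in auto)
      finally show ?case using compl all by simp
    next
      case (union A)
      then have A: "A i \<in> sets borel" for i using gen by auto
      have "(LINT x:(\<Union>i. A i)|lborel. h x) = (\<Sum>i. (LINT x:(A i)|lborel. h x))"
        by (rule lebesgue_integral_countable_add)
          (use A S union(1) in \<open>auto simp: disjoint_family_on_def\<close>)
      then show ?case using union by simp
    qed
  qed
  show "(LINT x:A|lborel. h x) = 0" if "A \<in> sets lborel" for A
    using * that by simp
qed

text \<open>By \<open>FT_pairing_tendsto\<close> the integral of \<open>h x * u x\<close> vanishes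
  for every integrable continuous \<open>u\<close> bounded by 1, and such functions approximate the
  indicator of an open box from below.\<close>

lemma FT_eq_0_imp_AE_0:
  fixes h :: "'a::euclidean_space \<Rightarrow> complex"
  assumes h: "integrable lborel h" and z: "\<And>k. FT h k = 0"
  shows "AE x in lborel. h x = 0"
proof (rule integral_box_0_imp_AE_0[OF h])
  have [measurable]: "h \<in> borel_measurable borel" using h by auto
  show "(LINT x|lborel. h x) = 0"
    using z[of 0] by (simp add: FT_def)
  have zero: "(LINT x|lborel. h x * u x) = 0"
    if u: "integrable lborel u" "continuous_on UNIV u" and B: "\<And>x. cmod (u x) \<le> 1" for u :: "'a \<Rightarrow> complex"
  proof -
    have "(\<lambda>n. 0) \<longlonglongrightarrow> of_real ((2 * pi) ^ DIM('a)) * (LINT x|lborel. h x * u x)"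
      using FT_pairing_tendsto[OF h u B] by (simp add: z)
    from LIMSEQ_unique[OF this tendsto_const] show ?thesis by auto
  qed
  fix a b :: 'a
  define U where "U = box a b"
  have U: "open U" "U \<noteq> UNIV" "bounded U" "emeasure lborel U < \<infinity>"
    using bounded_box[of a b] not_bounded_UNIV emeasure_lborel_box_finite[of a b] by (auto simp: U_def open_box)
  have [measurable]: "U \<in> sets borel" using U by auto
  \<comment> \<open>Truncated multiples of the distance to the complement of the box. The complement
    is closed and nonempty, so the distance is positive exactly inside, and \<open>u n\<close>
    increases to the indicator.\<close>
  define u where "u n x = min 1 (real n * infdist x (- U))" for n x
  have uc: "continuous_on UNIV (u n)" for n
    unfolding u_def by (intro continuous_intros)
  then have [measurable]: "u n \<in> borel_measurable borel" for n
    by (rule borel_measurable_continuous_onI)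
  have u_bd: "0 \<le> u n x" "u n x \<le> indicat_real U x" for n x
    using U by (auto simp: u_def infdist_nonneg split: split_indicator)
  have lim: "(\<lambda>n. u n x) \<longlonglongrightarrow> indicat_real U x" for x
  proof (cases "x \<in> U")
    case True
    then have "infdist x (- U) > 0"
      using U by (intro infdist_pos_not_in_closed) (auto simp: closed_def)
    then obtain N :: nat where N: "1 \<le> real N * infdist x (- U)"
      using reals_Archimedean3[of "infdist x (- U)"] by (metis less_imp_le)
    have "u n x = 1" if "n \<ge> N" for n
    proof -
      have "real N * infdist x (- U) \<le> real n * infdist x (- U)"
        using that by (intro mult_right_mono infdist_nonneg) simp
      then show ?thesis using N by (simp add: u_def)
    qed
    then show ?thesis using True
      by (intro tendsto_eventually eventually_sequentiallyI[of N]) simp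
  next
    case False
    then have "u n x = 0" for n using u_bd[of n x] by simp
    then show ?thesis using False by simp
  qed
  have ui: "integrable lborel (\<lambda>x. complex_of_real (u n x))" for n
  proof -
    have "integrable lborel (indicat_real U)" using U by simp
    then have "integrable lborel (u n)"
      by (rule Bochner_Integration.integrable_bound) (use u_bd in \<open>auto simp: abs_of_nonneg\<close>)
    then show ?thesis by simp
  qed
  have "(\<lambda>n. LINT x|lborel. h x * complex_of_real (u n x)) \<longlonglongrightarrow> (LINT x|lborel. h x * complex_of_real (indicat_real U x))"
  proof (rule integral_dominated_convergence)
    show "integrable lborel (\<lambda>x. cmod (h x))" using h by simp
    show "AE x in lborel. (\<lambda>n. h x * complex_of_real (u n x)) \<longlonglongrightarrow> h x * complex_of_real (indicat_real U x)"
      by (intro AE_I2 tendsto_mult tendsto_const tendsto_of_real lim)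
    show "AE x in lborel. norm (h x * complex_of_real (u n x)) \<le> cmod (h x)" for n
      using u_bd[of n] by (intro AE_I2) (auto simp: norm_mult mult_left_le u_def)
  qed measurable
  moreover have "(LINT x|lborel. h x * complex_of_real (u n x)) = 0" for n
    using u_bd[of n] by (intro zero ui continuous_intros uc) (auto simp: u_def)
  ultimately have "(LINT x|lborel. h x * complex_of_real (indicat_real U x)) = 0"
    using LIMSEQ_unique[OF _ tendsto_const] by fastforce
  then show "(LINT x:box a b|lborel. h x) = 0"
    unfolding set_lebesgue_integral_def U_def[symmetric] by (simp add: scaleR_conv_of_real mult.commute)
qed

section \<open>Square-integrable functions\<close>

text \<open>The square of \<open>L2norm\<close> with values in \<open>ennreal\<close>, so that
  estimates and limits can precede any proof of membership in \<open>L2\<close>.\<close>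

definition L2sq :: "('a::euclidean_space \<Rightarrow> complex) \<Rightarrow> ennreal" where
  "L2sq f = (\<integral>\<^sup>+x. ennreal ((cmod (f x))\<^sup>2) \<partial>lborel)"

lemma L2_iff: "f \<in> L2 \<longleftrightarrow> f \<in> borel_measurable borel \<and> L2sq f < \<infinity>"
  unfolding L2_iff_nn L2sq_def ..

lemma L2_lim_iff: "L2_lim g G \<longleftrightarrow> (\<lambda>n. L2sq (\<lambda>x. g n x - G x)) \<longlonglongrightarrow> 0"
  unfolding L2_lim_def L2sq_def ..

text \<open>Stands in for Minkowski's inequality: working with squares avoids roots of extended
  reals at the price of factors 2.\<close>

lemma cmod_add_sq_le: "(cmod (a + b))\<^sup>2 \<le> 2 * (cmod a)\<^sup>2 + 2 * (cmod b)\<^sup>2"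
proof -
  have "(cmod (a + b))\<^sup>2 \<le> (cmod a + cmod b)\<^sup>2"
    by (intro power_mono norm_triangle_ineq) simp
  also have "\<dots> \<le> 2 * (cmod a)\<^sup>2 + 2 * (cmod b)\<^sup>2"
    using sum_squares_bound[of "cmod a" "cmod b"] by (simp add: power2_sum)
  finally show ?thesis .
qed

lemma L2sq_cong_AE: "AE x in lborel. f x = g x \<Longrightarrow> L2sq f = L2sq g"
  unfolding L2sq_def by (rule nn_integral_cong_AE) auto

lemma L2sq_minus_commute: "L2sq (\<lambda>x. f x - g x) = L2sq (\<lambda>x. g x - f x)"
  unfolding L2sq_def by (simp add: norm_minus_commute)

lemma L2sq_add_le:
  assumes [measurable]: "f \<in> borel_measurable borel" "g \<in> borel_measurable borel"
  shows "L2sq (\<lambda>x. f x + g x) \<le> 2 * L2sq f + 2 * L2sq g"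
proof -
  have "L2sq (\<lambda>x. f x + g x) \<le> (\<integral>\<^sup>+x. 2 * ennreal ((cmod (f x))\<^sup>2) + 2 * ennreal ((cmod (g x))\<^sup>2) \<partial>lborel)"
    unfolding L2sq_def
  proof (rule nn_integral_mono)
    fix x
    have "ennreal ((cmod (f x + g x))\<^sup>2) \<le> ennreal (2 * (cmod (f x))\<^sup>2 + 2 * (cmod (g x))\<^sup>2)"
      by (rule ennreal_leI[OF cmod_add_sq_le])
    then show "ennreal ((cmod (f x + g x))\<^sup>2) \<le> 2 * ennreal ((cmod (f x))\<^sup>2) + 2 * ennreal ((cmod (g x))\<^sup>2)"
      by (simp add: ennreal_mult)
  qed
  also have "\<dots> = 2 * L2sq f + 2 * L2sq g"
    unfolding L2sq_def by (simp add: nn_integral_add nn_integral_cmult)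
  finally show ?thesis .
qed

lemma L2sq_scale:
  assumes [measurable]: "f \<in> borel_measurable borel"
  shows "L2sq (\<lambda>x. c * f x) = ennreal ((cmod c)\<^sup>2) * L2sq f"
  unfolding L2sq_def by (simp add: norm_mult power_mult_distrib ennreal_mult nn_integral_cmult)

lemma L2_add: "f \<in> L2 \<Longrightarrow> g \<in> L2 \<Longrightarrow> (\<lambda>x. f x + g x) \<in> L2"
  unfolding L2_iff
  by (auto intro!: le_less_trans[OF L2sq_add_le] simp: ennreal_mult_less_top)

lemma L2_scale: "f \<in> L2 \<Longrightarrow> (\<lambda>x. c * f x) \<in> L2"
  unfolding L2_iff by (auto simp: L2sq_scale ennreal_mult_less_top)

lemma L2_diff: "f \<in> L2 \<Longrightarrow> g \<in> L2 \<Longrightarrow> (\<lambda>x. f x - g x) \<in> L2"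
  using L2_add[OF _ L2_scale[of g "-1"], of f] by simp

lemma L2_lim_unique:
  assumes [measurable]: "\<And>n. g n \<in> borel_measurable borel" "F \<in> borel_measurable borel" "G \<in> borel_measurable borel"
    and F: "L2_lim g F" and G: "L2_lim g G"
  shows "AE x in lborel. F x = G x"
proof -
  have "L2sq (\<lambda>x. F x - G x) \<le> 2 * L2sq (\<lambda>x. g n x - F x) + 2 * L2sq (\<lambda>x. g n x - G x)" for n
    using L2sq_add_le[of "\<lambda>x. F x - g n x" "\<lambda>x. g n x - G x"] L2sq_minus_commute[of F "g n"] by simp
  moreover have "(\<lambda>n. 2 * L2sq (\<lambda>x. g n x - F x) + 2 * L2sq (\<lambda>x. g n x - G x)) \<longlonglongrightarrow> 2 * 0 + 2 * 0"
    using F G unfolding L2_lim_iff by (intro tendsto_add ennreal_tendsto_cmult) auto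
  ultimately have "L2sq (\<lambda>x. F x - G x) \<le> 2 * 0 + 2 * 0"
    by (intro LIMSEQ_le_const) auto
  then have "(\<integral>\<^sup>+x. ennreal ((cmod (F x - G x))\<^sup>2) \<partial>lborel) = 0"
    by (simp add: L2sq_def)
  then have "AE x in lborel. ennreal ((cmod (F x - G x))\<^sup>2) = 0"
    by (subst (asm) nn_integral_0_iff_AE) auto
  then show ?thesis by eventually_elim (simp add: ennreal_eq_0_iff)
qed

text \<open>The factor 2 is the price of comparing \<open>G\<close> with \<open>g n\<close> by
  squares; it only enlarges the final constant.\<close>

lemma L2sq_lim_le:
  assumes [measurable]: "\<And>n. g n \<in> borel_measurable borel" "G \<in> borel_measurable borel"
    and G: "L2_lim g G" and C: "\<And>n. L2sq (g n) \<le> C"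
  shows "L2sq G \<le> 2 * C"
proof -
  have "L2sq G \<le> 2 * C + 2 * L2sq (\<lambda>x. g n x - G x)" for n
  proof -
    have "L2sq G \<le> 2 * L2sq (g n) + 2 * L2sq (\<lambda>x. g n x - G x)"
      using L2sq_add_le[of "g n" "\<lambda>x. G x - g n x"] L2sq_minus_commute[of G "g n"] by simp
    also have "\<dots> \<le> 2 * C + 2 * L2sq (\<lambda>x. g n x - G x)"
      by (intro add_mono mult_left_mono C) auto
    finally show ?thesis .
  qed
  moreover have "(\<lambda>n. 2 * C + 2 * L2sq (\<lambda>x. g n x - G x)) \<longlonglongrightarrow> 2 * C + 2 * 0"
    using G unfolding L2_lim_iff by (intro tendsto_add tendsto_const ennreal_tendsto_cmult) auto
  ultimately have "L2sq G \<le> 2 * C + 2 * 0"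
    by (intro LIMSEQ_le_const) auto
  then show ?thesis by simp
qed

text \<open>A subsequence with geometrically decaying increments converges almost everywhere; by
  Fatou its limit is also the limit in mean square.\<close>

lemma L2_complete:
  fixes g :: "nat \<Rightarrow> 'a::euclidean_space \<Rightarrow> complex"
  assumes gm[measurable]: "\<And>n. g n \<in> borel_measurable borel"
    and e: "e \<longlonglongrightarrow> 0" and cau: "\<And>n m. n \<le> m \<Longrightarrow> L2sq (\<lambda>x. g m x - g n x) \<le> e n"
  obtains G where "G \<in> borel_measurable borel" "L2_lim g G"
proof -
  have "\<exists>N. j \<le> N \<and> e N < ennreal ((1/4) ^ j)" for j :: nat
  proof -
    have "0 < ennreal ((1/4) ^ j)" by simp
    from order_tendstoD(2)[OF e this] eventually_ge_at_top[of j]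
    have "\<forall>\<^sub>F N in sequentially. j \<le> N \<and> e N < ennreal ((1/4) ^ j)" by eventually_elim auto
    then show ?thesis by (rule eventually_happens'[OF sequentially_bot])
  qed
  then obtain M where M: "\<And>j. j \<le> M j" "\<And>j. e (M j) < ennreal ((1/4) ^ j)" by metis
  \<comment> \<open>The running maximum of \<open>M\<close> makes the indices monotone. Increments
    are compared through the common index \<open>M j\<close>, which turns \<open>(1/4) ^ j\<close>
    into \<open>4 * (1/4) ^ j\<close>.\<close>
  define N where "N = rec_nat (M 0) (\<lambda>j n. max n (M (Suc j)))"
  have N_Suc: "N (Suc j) = max (N j) (M (Suc j))" for j by (simp add: N_def)
  have N_mono: "N j \<le> N (Suc j)" for j by (simp add: N_Suc)
  have M_le_N: "M j \<le> N j" for j by (cases j) (auto simp: N_def)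
  then have N_ge: "j \<le> N j" for j using order_trans[OF M(1)] by blast
  have inc: "L2sq (\<lambda>x. g (N (Suc j)) x - g (N j) x) \<le> ennreal (4 * (1/4) ^ j)" for j
  proof -
    have Mj: "L2sq (\<lambda>x. g m x - g (M j) x) \<le> ennreal ((1/4) ^ j)" if "M j \<le> m" for m
      using cau[OF that] M(2)[of j] by (simp add: order_trans less_imp_le)
    have "L2sq (\<lambda>x. g (N (Suc j)) x - g (N j) x)
      \<le> 2 * L2sq (\<lambda>x. g (N (Suc j)) x - g (M j) x) + 2 * L2sq (\<lambda>x. g (N j) x - g (M j) x)"
      using L2sq_add_le[of "\<lambda>x. g (N (Suc j)) x - g (M j) x" "\<lambda>x. g (M j) x - g (N j) x"]
        L2sq_minus_commute[of "g (M j)" "g (N j)"] by simp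
    also have "\<dots> \<le> 2 * ennreal ((1/4) ^ j) + 2 * ennreal ((1/4) ^ j)"
      using M_le_N[of j] N_mono[of j] by (intro add_mono mult_left_mono Mj) auto
    also have "\<dots> = ennreal (4 * (1/4) ^ j)"
    proof -
      have "2 * y + 2 * y = 4 * y" for y :: ennreal
        unfolding distrib_right[symmetric] by simp
      then show ?thesis by (subst ennreal_mult) simp_all
    qed
    finally show ?thesis .
  qed
  \<comment> \<open>With the weight \<open>2 ^ j\<close> the integrals are still summable, with
    ratio 1/2, while finiteness of the weighted sum at \<open>x\<close> forces increments of order
    \<open>sqrt (1/2) ^ j\<close>.\<close>
  define D where "D j x = ennreal (2 ^ j * (cmod (g (N (Suc j)) x - g (N j) x))\<^sup>2)" for j x
  have [measurable]: "D j \<in> borel_measurable borel" for j unfolding D_def by measurable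
  have "(\<integral>\<^sup>+x. (\<Sum>j. D j x) \<partial>lborel) = (\<Sum>j. \<integral>\<^sup>+x. D j x \<partial>lborel)"
    by (rule nn_integral_suminf) measurable
  also have "\<dots> \<le> (\<Sum>j. ennreal (4 * (1/2) ^ j))"
  proof (rule suminf_le)
    fix j
    have "(\<integral>\<^sup>+x. D j x \<partial>lborel) = ennreal (2 ^ j) * L2sq (\<lambda>x. g (N (Suc j)) x - g (N j) x)"
      unfolding D_def L2sq_def by (simp add: ennreal_mult nn_integral_cmult)
    also have "\<dots> \<le> ennreal (2 ^ j) * ennreal (4 * (1/4) ^ j)"
      by (intro mult_left_mono inc) simp
    also have "\<dots> = ennreal (4 * (1/2) ^ j)"
    proof -
      have "(2::real) ^ j * (4 * (1/4) ^ j) = 4 * (2 * (1/4)) ^ j"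
        unfolding power_mult_distrib by simp
      then show ?thesis by (subst ennreal_mult[symmetric]) simp_all
    qed
    finally show "(\<integral>\<^sup>+x. D j x \<partial>lborel) \<le> ennreal (4 * (1/2) ^ j)" .
  qed auto
  also have "\<dots> < \<infinity>"
    by (subst suminf_ennreal2) (auto intro!: summable_mult summable_geometric)
  finally have "AE x in lborel. (\<Sum>j. D j x) \<noteq> \<infinity>"
    by (intro nn_integral_PInf_AE) auto
  then have conv: "AE x in lborel. convergent (\<lambda>j. g (N j) x)"
  proof eventually_elim
    case (elim x)
    define K where "K = enn2real (\<Sum>j. D j x)"
    have K: "(\<Sum>j. D j x) = ennreal K" using elim by (simp add: K_def less_top)
    have "0 \<le> K" by (simp add: K_def)
    have "cmod (g (N (Suc j)) x - g (N j) x) \<le> sqrt K * sqrt (1/2) ^ j" for j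
    proof -
      have "D j x \<le> ennreal K"
      proof -
        have "sum (\<lambda>j. D j x) {j} \<le> (\<Sum>j. D j x)" by (rule sum_le_suminf) auto
        then show ?thesis unfolding K by simp
      qed
      then have "2 ^ j * (cmod (g (N (Suc j)) x - g (N j) x))\<^sup>2 \<le> K"
        using \<open>0 \<le> K\<close> by (simp add: D_def)
      then have "(cmod (g (N (Suc j)) x - g (N j) x))\<^sup>2 \<le> K / 2 ^ j"
        by (simp add: pos_le_divide_eq mult.commute)
      then have "(cmod (g (N (Suc j)) x - g (N j) x))\<^sup>2 \<le> K * (1/2) ^ j"
        by (simp add: power_one_over)
      then have "cmod (g (N (Suc j)) x - g (N j) x) \<le> sqrt (K * (1/2) ^ j)"
        by (rule real_le_rsqrt)
      then show ?thesis by (simp only: real_sqrt_mult real_sqrt_power)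
    qed
    then have bd: "norm (g (N (Suc j)) x - g (N j) x) \<le> sqrt K * sqrt (1/2) ^ j" if "j \<ge> 0" for j
      by blast
    have "summable (\<lambda>j. sqrt (1/2) ^ j)"
      by (rule summable_geometric) simp
    then have "summable (\<lambda>j. sqrt K * sqrt (1/2) ^ j)"
      by (rule summable_mult)
    then have "summable (\<lambda>j. g (N (Suc j)) x - g (N j) x)"
      using bd by (rule summable_comparison_test')
    then have "convergent (\<lambda>n. g (N n) x - g (N 0) x)"
      unfolding summable_iff_convergent sum_lessThan_telescope[where f="\<lambda>j. g (N j) x"] .
    from convergent_add[OF this convergent_const, of "g (N 0) x"] show ?case by simp
  qed
  define G where "G x = lim (\<lambda>j. g (N j) x)" for x
  have Gm[measurable]: "G \<in> borel_measurable borel" unfolding G_def by measurable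
  have le: "L2sq (\<lambda>x. g n x - G x) \<le> e n" for n
  proof -
    have "L2sq (\<lambda>x. g n x - G x) \<le> (\<integral>\<^sup>+x. liminf (\<lambda>j. ennreal ((cmod (g n x - g (N j) x))\<^sup>2)) \<partial>lborel)"
      unfolding L2sq_def
    proof (rule nn_integral_mono_AE, use conv in eventually_elim)
      case (elim x)
      then have "(\<lambda>j. g (N j) x) \<longlonglongrightarrow> G x" by (simp add: G_def convergent_LIMSEQ_iff)
      then have "(\<lambda>j. ennreal ((cmod (g n x - g (N j) x))\<^sup>2)) \<longlonglongrightarrow> ennreal ((cmod (g n x - G x))\<^sup>2)"
        by (intro tendsto_ennrealI tendsto_intros)
      from lim_imp_Liminf[OF _ this] show ?case by simp
    qed
    also have "\<dots> \<le> liminf (\<lambda>j. L2sq (\<lambda>x. g n x - g (N j) x))"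
      unfolding L2sq_def by (rule nn_integral_liminf) measurable
    also have "\<dots> \<le> e n"
    proof (rule Liminf_le)
      show "\<forall>\<^sub>F j in sequentially. L2sq (\<lambda>x. g n x - g (N j) x) \<le> e n"
        using eventually_ge_at_top[of n]
      proof eventually_elim
        case (elim j)
        then have "n \<le> N j" using N_ge[of j] by simp
        then show ?case using cau[of n "N j"] L2sq_minus_commute[of "g n" "g (N j)"] by simp
      qed
    qed simp
    finally show ?thesis .
  qed
  have "L2_lim g G"
    unfolding L2_lim_iff
    by (rule tendsto_sandwich[OF _ _ tendsto_const e]) (auto simp: le)
  from that[OF Gm this] show ?thesis .
qed

lemma L2_lim_imp_L2:
  assumes g: "\<And>n. g n \<in> L2" and G: "G \<in> borel_measurable borel" "L2_lim g G"
  shows "G \<in> L2"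
proof -
  have gm[measurable]: "g n \<in> borel_measurable borel" for n using L2_measurable[OF g] .
  note [measurable] = G(1)
  have "\<forall>\<^sub>F n in sequentially. L2sq (\<lambda>x. g n x - G x) < 1"
    using G(2) unfolding L2_lim_iff by (rule order_tendstoD(2)) simp
  then obtain n where n: "L2sq (\<lambda>x. g n x - G x) < 1"
    using eventually_happens'[OF sequentially_bot] by blast
  have "(\<lambda>x. g n x - G x) \<in> L2"
    unfolding L2_iff using n by (auto intro: less_trans)
  from L2_diff[OF g[of n] this] show ?thesis by simp
qed

section \<open>The partial Fourier transform\<close>

lemma fst_borel_measurable[measurable]: "fst \<in> borel_measurable (borel :: ('a::euclidean_space \<times> 'b::euclidean_space) measure)"
  and snd_borel_measurable[measurable]: "snd \<in> borel_measurable (borel :: ('a \<times> 'b) measure)"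
  by (intro borel_measurable_continuous_onI continuous_intros)+

definition trunc :: "nat \<Rightarrow> ('a::euclidean_space \<Rightarrow> complex) \<Rightarrow> 'a \<Rightarrow> complex" where
  "trunc n h x = indicat_real (cball 0 (real n)) x *\<^sub>R h x"

text \<open>The approximants whose mean-square limit defines \<open>fourier_x\<close>.\<close>

definition FTx :: "('a::euclidean_space \<times> 'b::euclidean_space \<Rightarrow> complex) \<Rightarrow> nat \<Rightarrow> 'a \<times> 'b \<Rightarrow> complex" where
  "FTx g n = (\<lambda>(k, \<xi>). FT (trunc n (\<lambda>x. g (x, \<xi>))) k)"

lemma set_integral_cball_cis:
  "(LINT x:cball 0 (real n)|lborel. h x * cis (k \<bullet> x)) = FT (trunc n h) k"
  by (simp add: FT_def trunc_def set_lebesgue_integral_def)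

lemma fourier_alt: "fourier g = (SOME G. G \<in> L2 \<and> L2_lim (\<lambda>n. FT (trunc n g)) G)"
  unfolding fourier_def set_integral_cball_cis ..

lemma fourier_x_alt: "fourier_x g = (SOME G. G \<in> L2 \<and> L2_lim (FTx g) G)"
  unfolding fourier_x_def set_integral_cball_cis FTx_def ..

lemma trunc_alt: "trunc n h x = (if norm x \<le> real n then h x else 0)"
  by (simp add: trunc_def)

lemma trunc_measurable[measurable]:
  assumes [measurable]: "h \<in> borel_measurable borel"
  shows "trunc n h \<in> borel_measurable borel"
  unfolding trunc_alt[abs_def] by measurable

lemma indicator_cball_L2: "(\<lambda>x. complex_of_real (indicat_real (cball 0 r) x)) \<in> L2"
proof -
  have "emeasure lborel (cball (0::'a) r) < \<infinity>"
    by (rule emeasure_lborel_cball_finite)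
  then have "integrable lborel (indicat_real (cball (0::'a) r))" by simp
  moreover have "(\<lambda>x. (cmod (complex_of_real (indicat_real (cball 0 r) x)))\<^sup>2) = indicat_real (cball (0::'a) r)"
    by (auto simp: fun_eq_iff split: split_indicator)
  ultimately show ?thesis unfolding L2_def by simp
qed

lemma trunc_integrable:
  assumes "h \<in> L2"
  shows "integrable lborel (trunc n h)"
proof -
  have "trunc n h = (\<lambda>x. complex_of_real (indicat_real (cball 0 (real n)) x) * h x)"
    by (simp add: fun_eq_iff trunc_def scaleR_conv_of_real)
  then show ?thesis using L2_mult_integrable[OF indicator_cball_L2 assms] by simp
qed

lemma cmod_trunc_le: "cmod (trunc n h x) \<le> cmod (h x)"
  by (auto simp: trunc_def split: split_indicator)

lemma L2sq_mono:
  assumes "\<And>x. cmod (f x) \<le> cmod (g x)"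
  shows "L2sq f \<le> L2sq g"
  unfolding L2sq_def by (intro nn_integral_mono ennreal_leI power_mono assms) simp

lemma trunc_L2: "h \<in> L2 \<Longrightarrow> trunc n h \<in> L2"
  unfolding L2_iff using L2sq_mono[of "trunc n h" h, OF cmod_trunc_le] by (auto intro: le_less_trans)

lemma L2sq_Plancherel_le:
  "integrable lborel h \<Longrightarrow> L2sq (FT h) \<le> ennreal ((2 * pi) ^ DIM('a)) * L2sq h"
  for h :: "'a::euclidean_space \<Rightarrow> complex"
  unfolding L2sq_def by (rule FT_Plancherel_le)

lemma FT_diff:
  assumes "integrable lborel f" "integrable lborel g"
  shows "FT (\<lambda>x. f x - g x) k = FT f k - FT g k"
  unfolding FT_def left_diff_distrib using assms by (intro Bochner_Integration.integral_diff integrable_mult_cis)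

lemma L2sq_pair:
  fixes F :: "'a::euclidean_space \<times> 'b::euclidean_space \<Rightarrow> complex"
  assumes [measurable]: "F \<in> borel_measurable borel"
  shows "L2sq F = (\<integral>\<^sup>+\<xi>. L2sq (\<lambda>x. F (x, \<xi>)) \<partial>lborel)"
    and "L2sq F = (\<integral>\<^sup>+x. L2sq (\<lambda>\<xi>. F (x, \<xi>)) \<partial>lborel)"
proof -
  have F: "L2sq F = (\<integral>\<^sup>+z. ennreal ((cmod (F z))\<^sup>2) \<partial>(lborel \<Otimes>\<^sub>M lborel))"
    by (simp add: L2sq_def lborel_prod)
  have m: "(\<lambda>z. ennreal ((cmod (F z))\<^sup>2)) \<in> borel_measurable (lborel \<Otimes>\<^sub>M lborel)"
    unfolding lborel_prod by measurable
  show "L2sq F = (\<integral>\<^sup>+\<xi>. L2sq (\<lambda>x. F (x, \<xi>)) \<partial>lborel)"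
    unfolding F unfolding L2sq_def by (rule lborel_pair.nn_integral_snd[OF m, symmetric])
  show "L2sq F = (\<integral>\<^sup>+x. L2sq (\<lambda>\<xi>. F (x, \<xi>)) \<partial>lborel)"
    unfolding F unfolding L2sq_def by (rule lborel.nn_integral_fst[OF m, symmetric])
qed

lemma L2sq_slice_measurable[measurable]:
  fixes F :: "'a::euclidean_space \<times> 'b::euclidean_space \<Rightarrow> complex"
  assumes [measurable]: "F \<in> borel_measurable borel"
  shows "(\<lambda>x. L2sq (\<lambda>\<xi>. F (x, \<xi>))) \<in> borel_measurable borel"
    and "(\<lambda>\<xi>. L2sq (\<lambda>x. F (x, \<xi>))) \<in> borel_measurable borel"
proof -
  have "(\<lambda>x. L2sq (\<lambda>\<xi>. F (x, \<xi>))) \<in> borel_measurable lborel" unfolding L2sq_def by measurable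
  then show "(\<lambda>x. L2sq (\<lambda>\<xi>. F (x, \<xi>))) \<in> borel_measurable borel" by simp
  have "(\<lambda>\<xi>. L2sq (\<lambda>x. F (x, \<xi>))) \<in> borel_measurable lborel" unfolding L2sq_def by measurable
  then show "(\<lambda>\<xi>. L2sq (\<lambda>x. F (x, \<xi>))) \<in> borel_measurable borel" by simp
qed

lemma AE_L2_slice:
  fixes F :: "'a::euclidean_space \<times> 'b::euclidean_space \<Rightarrow> complex"
  assumes F: "F \<in> L2"
  shows "AE \<xi> in lborel. (\<lambda>x. F (x, \<xi>)) \<in> L2" and "AE x in lborel. (\<lambda>\<xi>. F (x, \<xi>)) \<in> L2"
proof -
  have [measurable]: "F \<in> borel_measurable borel" using L2_measurable[OF F] .
  have fin: "L2sq F < \<infinity>" using F by (simp add: L2_iff)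
  have "AE \<xi> in lborel. L2sq (\<lambda>x. F (x, \<xi>)) \<noteq> \<infinity>"
    using fin unfolding L2sq_pair(1)[of F, simplified] by (intro nn_integral_PInf_AE) auto
  then show "AE \<xi> in lborel. (\<lambda>x. F (x, \<xi>)) \<in> L2"
    by eventually_elim (auto simp: L2_iff less_top)
  have "AE x in lborel. L2sq (\<lambda>\<xi>. F (x, \<xi>)) \<noteq> \<infinity>"
    using fin unfolding L2sq_pair(2)[of F, simplified] by (intro nn_integral_PInf_AE) auto
  then show "AE x in lborel. (\<lambda>\<xi>. F (x, \<xi>)) \<in> L2"
    by eventually_elim (auto simp: L2_iff less_top)
qed

lemma FTx_measurable[measurable]:
  fixes G :: "'a::euclidean_space \<times> 'b::euclidean_space \<Rightarrow> complex"
  assumes [measurable]: "G \<in> borel_measurable borel"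
  shows "FTx G n \<in> borel_measurable borel"
proof -
  have "FTx G n \<in> borel_measurable (borel \<Otimes>\<^sub>M borel)"
    unfolding FTx_def FT_def trunc_alt by measurable
  then show ?thesis by (simp add: borel_prod)
qed

text \<open>The squared mass of \<open>G\<close> outside the cylinder over the ball of radius
  \<open>n\<close>; it controls the Cauchy differences of the approximants
  \<open>FTx G\<close>.\<close>

definition tail_sq :: "('a::euclidean_space \<times> 'b::euclidean_space \<Rightarrow> complex) \<Rightarrow> nat \<Rightarrow> ennreal" where
  "tail_sq G n = (\<integral>\<^sup>+z. (if norm (fst z) > real n then ennreal ((cmod (G z))\<^sup>2) else 0) \<partial>lborel)"

lemma tail_sq_tendsto:
  assumes G: "G \<in> L2"
  shows "tail_sq G \<longlonglongrightarrow> 0"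
proof -
  have [measurable]: "G \<in> borel_measurable borel" using L2_measurable[OF G] .
  have "tail_sq G \<longlonglongrightarrow> (\<integral>\<^sup>+z. 0 \<partial>(lborel :: ('a \<times> 'b) measure))"
    unfolding tail_sq_def
  proof (rule nn_integral_dominated_convergence)
    show "(\<integral>\<^sup>+z. ennreal ((cmod (G z))\<^sup>2) \<partial>lborel) < \<infinity>"
      using G unfolding L2_iff_nn by simp
    show "AE z in lborel. (\<lambda>n. if norm (fst z) > real n then ennreal ((cmod (G z))\<^sup>2) else 0) \<longlonglongrightarrow> 0"
    proof (rule AE_I2)
      fix z :: "'a \<times> 'b"
      obtain N :: nat where "norm (fst z) \<le> real N" using real_arch_simple by blast
      then have "\<forall>n\<ge>N. \<not> norm (fst z) > real n" by (auto intro: order_trans)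
      then show "(\<lambda>n. if norm (fst z) > real n then ennreal ((cmod (G z))\<^sup>2) else 0) \<longlonglongrightarrow> 0"
        by (intro tendsto_eventually eventually_sequentiallyI[of N]) simp
    qed
  qed auto
  then show ?thesis by simp
qed

text \<open>The difference of two truncations of a slice lives where \<open>norm x\<close> exceeds
  \<open>n\<close>; the Plancherel inequality in \<open>x\<close> for almost every
  \<open>\<xi>\<close>, integrated over \<open>\<xi>\<close>, gives the tail.\<close>

lemma FTx_diff_le:
  fixes G :: "'a::euclidean_space \<times> 'b::euclidean_space \<Rightarrow> complex"
  assumes G: "G \<in> L2" and nm: "n \<le> m"
  shows "L2sq (\<lambda>z. FTx G m z - FTx G n z) \<le> ennreal ((2 * pi) ^ DIM('a)) * tail_sq G n"
proof -
  have [measurable]: "G \<in> borel_measurable borel" using L2_measurable[OF G] .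
  have "L2sq (\<lambda>z. FTx G m z - FTx G n z)
      = (\<integral>\<^sup>+\<xi>. L2sq (\<lambda>k. FTx G m (k, \<xi>) - FTx G n (k, \<xi>)) \<partial>lborel)"
    by (rule L2sq_pair(1)) measurable
  also have "\<dots> \<le> (\<integral>\<^sup>+\<xi>. ennreal ((2 * pi) ^ DIM('a)) *
      (\<integral>\<^sup>+x. (if norm x > real n then ennreal ((cmod (G (x, \<xi>)))\<^sup>2) else 0) \<partial>lborel) \<partial>lborel)"
  proof (rule nn_integral_mono_AE, use AE_L2_slice(1)[OF G] in eventually_elim)
    case (elim \<xi>)
    let ?h = "\<lambda>x. G (x, \<xi>)"
    have int: "integrable lborel (\<lambda>x. trunc m ?h x - trunc n ?h x)"
      using trunc_integrable[OF elim] by (intro Bochner_Integration.integrable_diff) auto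
    have "L2sq (\<lambda>k. FTx G m (k, \<xi>) - FTx G n (k, \<xi>)) = L2sq (FT (\<lambda>x. trunc m ?h x - trunc n ?h x))"
      by (simp add: FTx_def FT_diff[OF trunc_integrable[OF elim] trunc_integrable[OF elim], symmetric])
    also have "\<dots> \<le> ennreal ((2 * pi) ^ DIM('a)) * L2sq (\<lambda>x. trunc m ?h x - trunc n ?h x)"
      by (rule L2sq_Plancherel_le[OF int])
    also have "L2sq (\<lambda>x. trunc m ?h x - trunc n ?h x)
       \<le> (\<integral>\<^sup>+x. (if norm x > real n then ennreal ((cmod (?h x))\<^sup>2) else 0) \<partial>lborel)"
      unfolding L2sq_def
    proof (rule nn_integral_mono)
      fix x :: 'a
      show "ennreal ((cmod (trunc m ?h x - trunc n ?h x))\<^sup>2) \<le> (if norm x > real n then ennreal ((cmod (?h x))\<^sup>2) else 0)"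
        using nm by (auto simp: trunc_def split: split_indicator)
    qed
    finally show ?case by (simp add: mult_left_mono)
  qed
  also have "\<dots> = ennreal ((2 * pi) ^ DIM('a)) *
      (\<integral>\<^sup>+\<xi>. (\<integral>\<^sup>+x. (if norm x > real n then ennreal ((cmod (G (x, \<xi>)))\<^sup>2) else 0) \<partial>lborel) \<partial>lborel)"
    by (rule nn_integral_cmult) measurable
  also have "(\<integral>\<^sup>+\<xi>. (\<integral>\<^sup>+x. (if norm x > real n then ennreal ((cmod (G (x, \<xi>)))\<^sup>2) else 0) \<partial>lborel) \<partial>lborel)
      = tail_sq G n"
  proof -
    have "tail_sq G n = (\<integral>\<^sup>+z. (if norm (fst z) > real n then ennreal ((cmod (G z))\<^sup>2) else 0) \<partial>(lborel \<Otimes>\<^sub>M lborel))"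
      by (simp add: tail_sq_def lborel_prod)
    also have "\<dots> = (\<integral>\<^sup>+\<xi>. (\<integral>\<^sup>+x. (if norm (fst (x, \<xi>)) > real n then ennreal ((cmod (G (x, \<xi>)))\<^sup>2) else 0) \<partial>lborel) \<partial>lborel)"
      by (rule lborel_pair.nn_integral_snd[symmetric]) (unfold lborel_prod, measurable)
    finally show ?thesis by simp
  qed
  finally show ?thesis .
qed

lemma FTx_le:
  fixes G :: "'a::euclidean_space \<times> 'b::euclidean_space \<Rightarrow> complex"
  assumes G: "G \<in> L2"
  shows "L2sq (FTx G n) \<le> ennreal ((2 * pi) ^ DIM('a)) * L2sq G"
proof -
  have [measurable]: "G \<in> borel_measurable borel" using L2_measurable[OF G] .
  have "L2sq (FTx G n) = (\<integral>\<^sup>+\<xi>. L2sq (\<lambda>k. FTx G n (k, \<xi>)) \<partial>lborel)"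
    by (rule L2sq_pair(1)) measurable
  also have "\<dots> \<le> (\<integral>\<^sup>+\<xi>. ennreal ((2 * pi) ^ DIM('a)) * L2sq (\<lambda>x. G (x, \<xi>)) \<partial>lborel)"
  proof (rule nn_integral_mono_AE, use AE_L2_slice(1)[OF G] in eventually_elim)
    case (elim \<xi>)
    have "L2sq (\<lambda>k. FTx G n (k, \<xi>)) = L2sq (FT (trunc n (\<lambda>x. G (x, \<xi>))))"
      by (simp add: FTx_def)
    also have "\<dots> \<le> ennreal ((2 * pi) ^ DIM('a)) * L2sq (trunc n (\<lambda>x. G (x, \<xi>)))"
      by (rule L2sq_Plancherel_le[OF trunc_integrable[OF elim]])
    also have "\<dots> \<le> ennreal ((2 * pi) ^ DIM('a)) * L2sq (\<lambda>x. G (x, \<xi>))"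
      by (intro mult_left_mono L2sq_mono cmod_trunc_le) simp
    finally show ?case .
  qed
  also have "\<dots> = ennreal ((2 * pi) ^ DIM('a)) * L2sq G"
    by (subst nn_integral_cmult) (simp_all add: L2sq_pair(1)[of G])
  finally show ?thesis .
qed

lemma FTx_L2: "G \<in> L2 \<Longrightarrow> FTx G n \<in> L2"
  using FTx_le[of G n] by (auto simp: L2_iff ennreal_mult_less_top intro: le_less_trans)

text \<open>Vanishing tails make the approximants Cauchy, so by completeness the function chosen by
  \<open>SOME\<close> exists and has the properties in its definition.\<close>

lemma fourier_x:
  fixes G :: "'a::euclidean_space \<times> 'b::euclidean_space \<Rightarrow> complex"
  assumes G: "G \<in> L2"
  shows "fourier_x G \<in> L2" and "L2_lim (FTx G) (fourier_x G)"
    and "L2sq (fourier_x G) \<le> 2 * (ennreal ((2 * pi) ^ DIM('a)) * L2sq G)"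
proof -
  have [measurable]: "G \<in> borel_measurable borel" using L2_measurable[OF G] .
  have "(\<lambda>n. ennreal ((2 * pi) ^ DIM('a)) * tail_sq G n) \<longlonglongrightarrow> ennreal ((2 * pi) ^ DIM('a)) * 0"
    by (intro ennreal_tendsto_cmult tail_sq_tendsto G) simp
  then have lim: "(\<lambda>n. ennreal ((2 * pi) ^ DIM('a)) * tail_sq G n) \<longlonglongrightarrow> 0" by simp
  obtain F where F: "F \<in> borel_measurable borel" "L2_lim (FTx G) F"
    by (rule L2_complete[OF _ lim FTx_diff_le[OF G]]) measurable
  have "F \<in> L2" using L2_lim_imp_L2[OF FTx_L2[OF G] F] .
  with F(2) have "\<exists>F. F \<in> L2 \<and> L2_lim (FTx G) F" by blast
  from someI_ex[OF this] show 1: "fourier_x G \<in> L2" and 2: "L2_lim (FTx G) (fourier_x G)"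
    unfolding fourier_x_alt[symmetric] by auto
  show "L2sq (fourier_x G) \<le> 2 * (ennreal ((2 * pi) ^ DIM('a)) * L2sq G)"
    by (rule L2sq_lim_le[OF _ L2_measurable[OF 1] 2 FTx_le[OF G]]) measurable
qed

text \<open>Like \<open>moment\<close>, but with a complex weight and arbitrary spaces, so that it
  also describes pairing with the second factor of a product test function.\<close>

definition vmoment :: "('b::euclidean_space \<Rightarrow> complex) \<Rightarrow> ('a::euclidean_space \<times> 'b \<Rightarrow> complex) \<Rightarrow> 'a \<Rightarrow> complex" where
  "vmoment v G x = (LINT \<xi>|lborel. G (x, \<xi>) * v \<xi>)"

lemma ennreal_tendsto_0_le:
  fixes f g :: "nat \<Rightarrow> ennreal"
  assumes "\<And>n. f n \<le> g n * c" "g \<longlonglongrightarrow> 0" "c < \<infinity>"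
  shows "f \<longlonglongrightarrow> 0"
proof (rule tendsto_sandwich[OF _ _ tendsto_const])
  have "(\<lambda>n. c * g n) \<longlonglongrightarrow> c * 0"
    by (rule ennreal_tendsto_cmult) (use assms in simp_all)
  then show "(\<lambda>n. g n * c) \<longlonglongrightarrow> 0" by (simp add: mult.commute)
qed (use assms in auto)

lemma vmoment_measurable[measurable]:
  fixes G :: "'a::euclidean_space \<times> 'b::euclidean_space \<Rightarrow> complex"
  assumes [measurable]: "G \<in> borel_measurable borel" "v \<in> borel_measurable borel"
  shows "vmoment v G \<in> borel_measurable borel"
  unfolding vmoment_def by measurable

lemma norm_integral_mult_sq_le:
  fixes f g :: "'a::euclidean_space \<Rightarrow> complex"
  assumes [measurable]: "f \<in> borel_measurable borel" "g \<in> borel_measurable borel"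
  shows "ennreal ((cmod (LINT x|lborel. f x * g x))\<^sup>2) \<le> L2sq f * L2sq g"
proof -
  have "ennreal ((cmod (LINT x|lborel. f x * g x))\<^sup>2) = (ennreal (cmod (LINT x|lborel. f x * g x)))\<^sup>2"
    by (simp add: ennreal_power)
  also have "\<dots> \<le> (\<integral>\<^sup>+x. ennreal (cmod (f x)) * ennreal (cmod (g x)) \<partial>lborel)\<^sup>2"
    using norm_integral_le_nn_integral[of lborel "\<lambda>x. f x * g x"]
    by (intro power_mono) (simp_all add: norm_mult ennreal_mult)
  also have "\<dots> \<le> (\<integral>\<^sup>+x. (ennreal (cmod (f x)))\<^sup>2 \<partial>lborel) * (\<integral>\<^sup>+x. (ennreal (cmod (g x)))\<^sup>2 \<partial>lborel)"
    by (rule Cauchy_Schwarz_nn_integral) measurable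
  also have "\<dots> = L2sq f * L2sq g"
    by (simp add: L2sq_def ennreal_power)
  finally show ?thesis .
qed

lemma L2sq_vmoment_le:
  fixes G :: "'a::euclidean_space \<times> 'b::euclidean_space \<Rightarrow> complex"
  assumes [measurable]: "G \<in> borel_measurable borel" "v \<in> borel_measurable borel"
  shows "L2sq (vmoment v G) \<le> L2sq G * L2sq v"
proof -
  have "L2sq (vmoment v G) \<le> (\<integral>\<^sup>+x. L2sq (\<lambda>\<xi>. G (x, \<xi>)) * L2sq v \<partial>lborel)"
    unfolding L2sq_def[of "vmoment v G"] unfolding vmoment_def
    by (intro nn_integral_mono norm_integral_mult_sq_le) measurable
  also have "\<dots> = L2sq G * L2sq v"
    by (subst nn_integral_multc) (simp_all add: L2sq_pair(2)[of G])
  finally show ?thesis .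
qed

lemma vmoment_L2:
  assumes "G \<in> L2" "v \<in> L2"
  shows "vmoment v G \<in> L2"
proof -
  have m: "G \<in> borel_measurable borel" "v \<in> borel_measurable borel"
    using assms L2_measurable by auto
  show ?thesis
    unfolding L2_iff using vmoment_measurable[OF m] L2sq_vmoment_le[OF m] assms
    by (auto simp: L2_iff intro!: le_less_trans[OF L2sq_vmoment_le] ennreal_mult_less_top[THEN iffD2])
qed

lemma tensor_L2:
  fixes a :: "'a::euclidean_space \<Rightarrow> complex" and b :: "'b::euclidean_space \<Rightarrow> complex"
  assumes a: "a \<in> L2" and b: "b \<in> L2"
  shows "(\<lambda>z. a (fst z) * b (snd z)) \<in> L2"
proof -
  have [measurable]: "a \<in> borel_measurable borel" "b \<in> borel_measurable borel"
    using assms L2_measurable by auto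
  have m: "(\<lambda>z. a (fst z) * b (snd z)) \<in> borel_measurable borel" by measurable
  have "L2sq (\<lambda>z. a (fst z) * b (snd z)) = (\<integral>\<^sup>+x. ennreal ((cmod (a x))\<^sup>2) * L2sq b \<partial>lborel)"
    by (simp add: L2sq_pair(2)[OF m] L2sq_scale)
  also have "\<dots> = L2sq a * L2sq b"
    by (simp add: nn_integral_multc L2sq_def[of a])
  also have "\<dots> < \<infinity>" using a b by (simp add: L2_iff ennreal_mult_less_top)
  finally show ?thesis using m by (simp add: L2_iff)
qed

text \<open>A product of square-integrable factors is square-integrable on the product space, so
  Fubini applies in both orders. Comparing the two orders lets the moment in \<open>\<xi>\<close>
  commute with integration in \<open>x\<close>.\<close>

lemma integral_tensor:
  fixes G :: "'a::euclidean_space \<times> 'b::euclidean_space \<Rightarrow> complex"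
  assumes G: "G \<in> L2" and a: "a \<in> L2" and b: "b \<in> L2"
  shows "integrable lborel (\<lambda>z. G z * (a (fst z) * b (snd z)))"
    and "(LINT z|lborel. G z * (a (fst z) * b (snd z))) = (LINT x|lborel. vmoment b G x * a x)"
    and "(LINT z|lborel. G z * (a (fst z) * b (snd z)))
      = (LINT \<xi>|lborel. (LINT x|lborel. G (x, \<xi>) * a x) * b \<xi>)"
proof -
  show int: "integrable lborel (\<lambda>z. G z * (a (fst z) * b (snd z)))"
    by (rule L2_mult_integrable[OF G tensor_L2[OF a b]])
  have split: "(\<lambda>(x, \<xi>). G (x, \<xi>) * (a x * b \<xi>)) = (\<lambda>z. G z * (a (fst z) * b (snd z)))"
    by (auto simp: fun_eq_iff)
  have int'': "integrable (lborel \<Otimes>\<^sub>M lborel) (\<lambda>(x, \<xi>). G (x, \<xi>) * (a x * b \<xi>))"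
    unfolding lborel_prod split by (rule int)
  have eq: "(LINT z|lborel. G z * (a (fst z) * b (snd z)))
      = integral\<^sup>L (lborel \<Otimes>\<^sub>M lborel) (\<lambda>(x, \<xi>). G (x, \<xi>) * (a x * b \<xi>))"
    unfolding lborel_prod split ..
  show "(LINT z|lborel. G z * (a (fst z) * b (snd z))) = (LINT x|lborel. vmoment b G x * a x)"
    unfolding eq lborel_pair.integral_fst[OF int'', symmetric] vmoment_def integral_mult_left_zero[symmetric]
    by (simp only: mult_ac)
  show "(LINT z|lborel. G z * (a (fst z) * b (snd z)))
      = (LINT \<xi>|lborel. (LINT x|lborel. G (x, \<xi>) * a x) * b \<xi>)"
    unfolding eq lborel_pair.integral_snd[OF int'', symmetric] integral_mult_left_zero[symmetric]
    by (simp only: mult_ac)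
qed

text \<open>A character cut off to a ball is square-integrable, so both sides pair \<open>G\<close>
  with the same product function. The identity holds for every \<open>k\<close>, not merely for
  almost every one.\<close>

lemma FT_trunc_vmoment:
  fixes G :: "'a::euclidean_space \<times> 'b::euclidean_space \<Rightarrow> complex"
  assumes G: "G \<in> L2" and v: "v \<in> L2"
  shows "FT (trunc n (vmoment v G)) k = vmoment v (FTx G n) k"
proof -
  define a where "a x = (if norm x \<le> real n then cis (k \<bullet> x) else 0)" for x
  have am: "a \<in> borel_measurable borel" unfolding a_def[abs_def] by measurable
  have "L2sq a \<le> L2sq (\<lambda>x::'a. complex_of_real (indicat_real (cball 0 (real n)) x))"
    by (rule L2sq_mono) (simp add: a_def split: split_indicator)
  also have "\<dots> < \<infinity>" using indicator_cball_L2[of "real n"] unfolding L2_iff by blast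
  finally have a: "a \<in> L2" using am by (simp add: L2_iff)
  have tr: "trunc n h x * cis (k \<bullet> x) = h x * a x" for h x
    by (simp add: trunc_alt a_def)
  have "FT (trunc n (vmoment v G)) k = (LINT x|lborel. vmoment v G x * a x)"
    unfolding FT_def tr ..
  also have "\<dots> = (LINT \<xi>|lborel. (LINT x|lborel. G (x, \<xi>) * a x) * v \<xi>)"
    using integral_tensor(2,3)[OF G a v] by simp
  also have "\<dots> = vmoment v (FTx G n) k"
    unfolding vmoment_def FTx_def prod.case FT_def tr ..
  finally show ?thesis .
qed

lemma vmoment_diff:
  fixes F G :: "'a::euclidean_space \<times> 'b::euclidean_space \<Rightarrow> complex"
  assumes F: "F \<in> L2" and G: "G \<in> L2" and v: "v \<in> L2"
  shows "AE x in lborel. vmoment v (\<lambda>z. F z - G z) x = vmoment v F x - vmoment v G x"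
  using AE_L2_slice(2)[OF F] AE_L2_slice(2)[OF G]
proof eventually_elim
  case (elim x)
  show ?case
    unfolding vmoment_def left_diff_distrib
    by (intro Bochner_Integration.integral_diff L2_mult_integrable elim v)
qed

text \<open>By Cauchy-Schwarz the moment is bounded between the \<open>L2\<close> spaces, so it
  carries over the limit that defines \<open>fourier_x\<close>.\<close>

lemma vmoment_fourier_x_lim:
  fixes G :: "'a::euclidean_space \<times> 'b::euclidean_space \<Rightarrow> complex"
  assumes G: "G \<in> L2" and v: "v \<in> L2"
  shows "L2_lim (\<lambda>n. FT (trunc n (vmoment v G))) (vmoment v (fourier_x G))"
proof -
  have vm[measurable]: "v \<in> borel_measurable borel" using L2_measurable[OF v] .
  have [measurable]: "G \<in> borel_measurable borel" "fourier_x G \<in> borel_measurable borel"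
    using L2_measurable[OF G] L2_measurable[OF fourier_x(1)[OF G]] .
  have le: "L2sq (\<lambda>k. FT (trunc n (vmoment v G)) k - vmoment v (fourier_x G) k)
      \<le> L2sq (\<lambda>z. FTx G n z - fourier_x G z) * L2sq v" for n
  proof -
    have "L2sq (\<lambda>k. FT (trunc n (vmoment v G)) k - vmoment v (fourier_x G) k)
        = L2sq (vmoment v (\<lambda>z. FTx G n z - fourier_x G z))"
      unfolding FT_trunc_vmoment[OF G v]
      by (rule L2sq_cong_AE, rule AE_mp[OF vmoment_diff[OF FTx_L2[OF G, of n] fourier_x(1)[OF G] v]]) simp
    also have "\<dots> \<le> L2sq (\<lambda>z. FTx G n z - fourier_x G z) * L2sq v"
      by (rule L2sq_vmoment_le) measurable
    finally show ?thesis .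
  qed
  show ?thesis
    unfolding L2_lim_iff
    by (rule ennreal_tendsto_0_le[OF le fourier_x(2)[OF G, unfolded L2_lim_iff]])
      (use v in \<open>simp add: L2_iff\<close>)
qed

text \<open>Both sides are mean-square limits of the same truncated transforms. This links the
  seminorm, defined through \<open>fourier\<close>, to the equation, which speaks of
  \<open>fourier_x\<close>.\<close>

lemma fourier_vmoment:
  fixes G :: "'a::euclidean_space \<times> 'b::euclidean_space \<Rightarrow> complex"
  assumes G: "G \<in> L2" and v: "v \<in> L2"
  shows "AE k in lborel. fourier (vmoment v G) k = vmoment v (fourier_x G) k"
proof -
  have w: "vmoment v (fourier_x G) \<in> L2" by (rule vmoment_L2[OF fourier_x(1)[OF G] v])
  have "\<exists>F. F \<in> L2 \<and> L2_lim (\<lambda>n. FT (trunc n (vmoment v G))) F"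
    using w vmoment_fourier_x_lim[OF G v] by blast
  from someI_ex[OF this]
  have f: "fourier (vmoment v G) \<in> L2" "L2_lim (\<lambda>n. FT (trunc n (vmoment v G))) (fourier (vmoment v G))"
    unfolding fourier_alt by auto
  have [measurable]: "vmoment v G \<in> borel_measurable borel" using L2_measurable[OF vmoment_L2[OF G v]] .
  have "FT (trunc n (vmoment v G)) \<in> borel_measurable borel" for n by measurable
  then show ?thesis
    using L2_measurable[OF f(1)] L2_measurable[OF w] f(2) vmoment_fourier_x_lim[OF G v] by (rule L2_lim_unique)
qed

lemma L2_pairing_tendsto:
  assumes g: "\<And>n. g n \<in> L2" and G: "G \<in> L2" "L2_lim g G" and w: "w \<in> L2"
  shows "(\<lambda>n. LINT x|lborel. g n x * w x) \<longlonglongrightarrow> (LINT x|lborel. G x * w x)"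
proof -
  define d where "d n = cmod ((LINT x|lborel. g n x * w x) - (LINT x|lborel. G x * w x))" for n
  have le: "ennreal ((d n)\<^sup>2) \<le> L2sq (\<lambda>x. g n x - G x) * L2sq w" for n
  proof -
    have "(LINT x|lborel. g n x * w x) - (LINT x|lborel. G x * w x) = (LINT x|lborel. (g n x - G x) * w x)"
      unfolding left_diff_distrib
      by (intro Bochner_Integration.integral_diff[symmetric] L2_mult_integrable g G w)
    then show ?thesis
      unfolding d_def
      using norm_integral_mult_sq_le[OF L2_measurable[OF L2_diff[OF g G(1)]] L2_measurable[OF w]] by simp
  qed
  have "(\<lambda>n. ennreal ((d n)\<^sup>2)) \<longlonglongrightarrow> 0"
    by (rule ennreal_tendsto_0_le[OF le G(2)[unfolded L2_lim_iff]]) (use w in \<open>simp add: L2_iff\<close>)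
  then have "(\<lambda>n. (d n)\<^sup>2) \<longlonglongrightarrow> 0"
    by (subst (asm) ennreal_tendsto_0_iff) auto
  then have "d \<longlonglongrightarrow> 0" by simp
  then show ?thesis
    unfolding d_def by (subst LIM_zero_iff[symmetric]) (rule tendsto_norm_zero_cancel)
qed

lemma FT_reflect_L2:
  assumes u: "integrable lborel u" "u \<in> L2"
  shows "(\<lambda>k. FT u (- k)) \<in> L2"
proof -
  have [measurable]: "u \<in> borel_measurable borel" using u(1) by auto
  have "(\<lambda>k. FT u (- k)) \<in> borel_measurable borel" by measurable
  moreover have "FT u \<in> L2" by (rule FT_L2[OF u])
  ultimately show ?thesis
    using integrable_lborel_affine[of "-1" "\<lambda>x. (cmod (FT u x))\<^sup>2" 0]
    unfolding L2_def by simp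
qed

text \<open>Taking the moment against \<open>v\<close> leaves Parseval's identity in
  \<open>x\<close> for truncations of \<open>vmoment v G\<close>; the frequency side converges in
  mean square, the space side by domination.\<close>

lemma Parseval_tensor:
  fixes G :: "'a::euclidean_space \<times> 'b::euclidean_space \<Rightarrow> complex"
  assumes G: "G \<in> L2" and v: "v \<in> L2" and ui: "integrable lborel u" "u \<in> L2"
    and u: "continuous_on UNIV u" and B: "\<And>x. cmod (u x) \<le> B"
  shows "(LINT z|lborel. fourier_x G z * (FT u (- fst z) * v (snd z)))
    = of_real ((2 * pi) ^ DIM('a)) * (LINT z|lborel. G z * (u (fst z) * v (snd z)))"
proof -
  let ?h = "vmoment v G"
  have h: "?h \<in> L2" by (rule vmoment_L2[OF G v])
  have [measurable]: "?h \<in> borel_measurable borel" "u \<in> borel_measurable borel"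
    using L2_measurable[OF h] L2_measurable[OF ui(2)] .
  have w: "(\<lambda>k. FT u (- k)) \<in> L2" by (rule FT_reflect_L2[OF ui])
  have lim: "(\<lambda>n. LINT k|lborel. FT (trunc n ?h) k * FT u (- k))
      \<longlonglongrightarrow> (LINT k|lborel. vmoment v (fourier_x G) k * FT u (- k))"
    by (rule L2_pairing_tendsto[OF FT_L2[OF trunc_integrable[OF h] trunc_L2[OF h]]
        vmoment_L2[OF fourier_x(1)[OF G] v] vmoment_fourier_x_lim[OF G v] w])
  have eq: "(LINT k|lborel. FT (trunc n ?h) k * FT u (- k))
      = of_real ((2 * pi) ^ DIM('a)) * (LINT x|lborel. trunc n ?h x * u x)" for n
    by (rule FT_Parseval[OF trunc_integrable[OF h] trunc_L2[OF h] ui u B])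
  have lim': "(\<lambda>n. of_real ((2 * pi) ^ DIM('a)) * (LINT x|lborel. trunc n ?h x * u x))
      \<longlonglongrightarrow> of_real ((2 * pi) ^ DIM('a)) * (LINT x|lborel. ?h x * u x)"
  proof (intro tendsto_mult tendsto_const integral_dominated_convergence)
    show "integrable lborel (\<lambda>x. cmod (?h x * u x))"
      using L2_mult_integrable[OF h ui(2)] by simp
    show "AE x in lborel. (\<lambda>n. trunc n ?h x * u x) \<longlonglongrightarrow> ?h x * u x"
    proof (rule AE_I2)
      fix x :: 'a
      obtain N :: nat where "norm x \<le> real N" using real_arch_simple by blast
      then have "\<forall>n\<ge>N. trunc n ?h x = ?h x" by (auto simp: trunc_alt)
      then show "(\<lambda>n. trunc n ?h x * u x) \<longlonglongrightarrow> ?h x * u x"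
        by (intro tendsto_eventually eventually_sequentiallyI[of N]) simp
    qed
    show "AE x in lborel. norm (trunc n ?h x * u x) \<le> cmod (?h x * u x)" for n
      by (rule AE_I2) (unfold norm_mult, intro mult_right_mono cmod_trunc_le norm_ge_zero)
  qed measurable
  have "(LINT k|lborel. vmoment v (fourier_x G) k * FT u (- k))
      = of_real ((2 * pi) ^ DIM('a)) * (LINT x|lborel. ?h x * u x)"
    by (rule LIMSEQ_unique[OF lim[unfolded eq] lim'])
  then show ?thesis
    using integral_tensor(2)[OF fourier_x(1)[OF G] w v] integral_tensor(2)[OF G ui(2) v] by simp
qed

section \<open>Test functions\<close>

lemma Ck_continuous: "Ck k f \<Longrightarrow> continuous_on UNIV f"
  by (cases k) (auto intro!: differentiable_imp_continuous_within simp: continuous_on_eq_continuous_within)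

lemma Ck_SucD: "Ck (Suc k) f \<Longrightarrow> Ck k f"
proof (induction k arbitrary: f)
  case 0
  then show ?case using Ck_continuous[of "Suc 0" f] by simp
next
  case (Suc k)
  then show ?case by (metis Ck.simps(2))
qed

lemma Ck_const: "Ck k (\<lambda>x. c)"
proof (induction k arbitrary: c)
  case (Suc k)
  then show ?case by (simp add: frechet_derivative_const)
qed simp

lemma Ck_add:
  "Ck k f \<Longrightarrow> Ck k g \<Longrightarrow> Ck k (\<lambda>x. f x + g x)"
proof (induction k arbitrary: f g)
  case 0
  then show ?case by (auto intro: continuous_on_add)
next
  case (Suc k)
  have "frechet_derivative (\<lambda>x. f x + g x) (at x) v
      = frechet_derivative f (at x) v + frechet_derivative g (at x) v" for x v
  proof -
    have "((\<lambda>x. f x + g x) has_derivative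
        (\<lambda>v. frechet_derivative f (at x) v + frechet_derivative g (at x) v)) (at x)"
      using Suc.prems by (intro has_derivative_add) (simp_all add: frechet_derivative_works[symmetric])
    from frechet_derivative_at[OF this] show ?thesis by metis
  qed
  then show ?case using Suc by (auto intro: differentiable_add)
qed

lemma Ck_mult:
  fixes f g :: "'a::euclidean_space \<Rightarrow> complex"
  shows "Ck k f \<Longrightarrow> Ck k g \<Longrightarrow> Ck k (\<lambda>x. f x * g x)"
proof (induction k arbitrary: f g)
  case 0
  then show ?case by (auto intro: continuous_on_mult)
next
  case (Suc k)
  have "frechet_derivative (\<lambda>x. f x * g x) (at x) v
      = f x * frechet_derivative g (at x) v + frechet_derivative f (at x) v * g x" for x v
  proof -
    have "((\<lambda>x. f x * g x) has_derivative
        (\<lambda>v. f x * frechet_derivative g (at x) v + frechet_derivative f (at x) v * g x)) (at x)"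
      using Suc.prems by (intro has_derivative_mult) (simp_all add: frechet_derivative_works[symmetric])
    from frechet_derivative_at[OF this] show ?thesis by metis
  qed
  moreover have "Ck k (\<lambda>x. f x * frechet_derivative g (at x) v + frechet_derivative f (at x) v * g x)" for v
    using Suc.prems Ck_SucD[OF Suc.prems(1)] Ck_SucD[OF Suc.prems(2)] by (intro Ck_add Suc.IH) auto
  ultimately show ?case using Suc.prems by (auto intro: differentiable_mult)
qed

text \<open>Covers at once translations, the two projections of phase space and the embedding of the
  reals into the complex numbers.\<close>

lemma Ck_compose_affine:
  fixes f :: "'a::euclidean_space \<Rightarrow> 'b::real_normed_vector" and A :: "'c::euclidean_space \<Rightarrow> 'a"
    and L :: "'b \<Rightarrow> 'd::real_normed_vector"
  assumes A: "bounded_linear A" and L: "bounded_linear L"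
  shows "Ck k f \<Longrightarrow> Ck k (\<lambda>z. L (f (A z + c)))"
proof (induction k arbitrary: f)
  case 0
  have 1: "continuous_on UNIV (\<lambda>z. A z + c)"
    using A by (intro continuous_intros linear_continuous_on)
  have "continuous_on UNIV (\<lambda>z. f (A z + c))"
    by (rule continuous_on_compose2[OF _ 1]) (use 0 in auto)
  then show ?case using bounded_linear.continuous_on[OF L] by auto
next
  case (Suc k)
  have der: "((\<lambda>z. L (f (A z + c))) has_derivative
      (\<lambda>v. L (frechet_derivative f (at (A x + c)) (A v)))) (at x)" for x
  proof -
    have "((\<lambda>z. A z + c) has_derivative A) (at x)"
      using has_derivative_add[OF bounded_linear_imp_has_derivative[OF A] has_derivative_const] by simp
    moreover have "(f has_derivative frechet_derivative f (at (A x + c))) (at (A x + c))"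
      using Suc.prems by (simp add: frechet_derivative_works[symmetric])
    ultimately have "((\<lambda>z. f (A z + c)) has_derivative (\<lambda>v. frechet_derivative f (at (A x + c)) (A v))) (at x)"
      by (rule has_derivative_compose)
    from bounded_linear.has_derivative[OF L this] show ?thesis .
  qed
  have fr: "frechet_derivative (\<lambda>z. L (f (A z + c))) (at x) v = L (frechet_derivative f (at (A x + c)) (A v))" for x v
    using frechet_derivative_at[OF der] by metis
  have "(\<lambda>z. L (f (A z + c))) differentiable (at x)" for x
    using der unfolding differentiable_def by blast
  moreover have "Ck k (\<lambda>z. L ((\<lambda>y. frechet_derivative f (at y) (A v)) (A z + c)))" for v
    using Suc.prems by (intro Suc.IH) simp
  ultimately show ?case by (simp add: fr)
qed

lemma cis_inner_has_derivative:
  "((\<lambda>z. cis (b \<bullet> z)) has_derivative (\<lambda>v. (\<i> * of_real (b \<bullet> v)) * cis (b \<bullet> x))) (at x)"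
proof -
  have "((\<lambda>z. exp (\<i> * of_real (b \<bullet> z))) has_derivative
      (\<lambda>v. exp (\<i> * of_real (b \<bullet> x)) * (\<i> * of_real (b \<bullet> v)))) (at x)"
    by (rule has_derivative_compose[OF has_derivative_mult_right[OF has_derivative_of_real[OF
        has_derivative_inner_right[OF has_derivative_ident]]]
        DERIV_exp[unfolded has_field_derivative_def]])
  then show ?thesis by (simp add: cis_conv_exp mult_ac)
qed

lemma frechet_derivative_cis_inner:
  "frechet_derivative (\<lambda>z. cis (b \<bullet> z)) (at x) v = (\<i> * of_real (b \<bullet> v)) * cis (b \<bullet> x)"
  using frechet_derivative_at[OF cis_inner_has_derivative] by metis

lemma Ck_cis: "Ck k (\<lambda>z. cis (b \<bullet> z))"
proof (induction k)
  case 0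
  show ?case by (auto intro!: continuous_intros continuous_on_cis)
next
  case (Suc k)
  have "(\<lambda>z. cis (b \<bullet> z)) differentiable (at x)" for x
    using cis_inner_has_derivative unfolding differentiable_def by blast
  moreover have "Ck k (\<lambda>x. (\<i> * of_real (b \<bullet> v)) * cis (b \<bullet> x))" for v
    by (intro Ck_mult Ck_const Suc)
  ultimately show ?case by (simp add: frechet_derivative_cis_inner)
qed

lemma compact_supportI:
  fixes f :: "'a::euclidean_space \<Rightarrow> 'b::zero"
  assumes "\<And>x. f x \<noteq> 0 \<Longrightarrow> x \<in> K" "compact K"
  shows "compact (closure {x. f x \<noteq> 0})"
proof -
  have "{x. f x \<noteq> 0} \<subseteq> K" using assms by auto
  then have "bounded {x. f x \<noteq> 0}"
    using assms(2) bounded_subset compact_imp_bounded by blast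
  then show ?thesis by (simp add: compact_closure)
qed

lemma Cc_infinityI:
  assumes "\<And>k. Ck k f" "\<And>x. f x \<noteq> 0 \<Longrightarrow> x \<in> K" "compact K"
  shows "f \<in> Cc_infinity"
  using assms compact_supportI[OF assms(2,3)] by (auto simp: Cc_infinity_def)

lemma Cc_infinityD:
  assumes "f \<in> Cc_infinity"
  shows "Ck k f" and "continuous_on UNIV f" and "f differentiable (at x)"
    and "(f has_derivative frechet_derivative f (at x)) (at x)"
    and "compact (closure {x. f x \<noteq> 0})" and "f x \<noteq> 0 \<Longrightarrow> x \<in> closure {x. f x \<noteq> 0}"
proof -
  show k: "Ck k f" for k using assms by (auto simp: Cc_infinity_def)
  show "continuous_on UNIV f" using Ck_continuous[OF k[of 0]] .
  show d: "f differentiable (at x)" using k[of "Suc 0"] by simp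
  show "(f has_derivative frechet_derivative f (at x)) (at x)" using d by (simp add: frechet_derivative_works)
  show "compact (closure {x. f x \<noteq> 0})" using assms by (auto simp: Cc_infinity_def)
  show "x \<in> closure {x. f x \<noteq> 0}" if "f x \<noteq> 0" using that closure_subset by fastforce
qed

lemma Cc_infinity_mult:
  fixes f g :: "'a::euclidean_space \<Rightarrow> complex"
  assumes "f \<in> Cc_infinity" "\<And>k. Ck k g"
  shows "(\<lambda>x. f x * g x) \<in> Cc_infinity"
  by (rule Cc_infinityI[where K="closure {x. f x \<noteq> 0}"])
    (use Cc_infinityD(1,5,6)[OF assms(1)] assms(2) in \<open>auto intro: Ck_mult\<close>)

lemma Cc_infinity_of_real_translate:
  fixes f :: "'a::euclidean_space \<Rightarrow> real"
  assumes "f \<in> Cc_infinity"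
  shows "(\<lambda>x. complex_of_real (f (x - a))) \<in> Cc_infinity"
proof (rule Cc_infinityI)
  show "Ck k (\<lambda>x. complex_of_real (f (x - a)))" for k
    using Ck_compose_affine[OF bounded_linear_ident bounded_linear_of_real Cc_infinityD(1)[OF assms], where c="-a"]
    by simp
  show "compact ((+) a ` closure {x. f x \<noteq> 0})"
    using Cc_infinityD(5)[OF assms] by (rule compact_translation)
  show "x \<in> (+) a ` closure {x. f x \<noteq> 0}" if "complex_of_real (f (x - a)) \<noteq> 0" for x
  proof
    show "x = a + (x - a)" by simp
    show "x - a \<in> closure {x. f x \<noteq> 0}" using that Cc_infinityD(6)[OF assms] by simp
  qed
qed

lemma Cc_infinity_tensor:
  fixes u :: "'a::euclidean_space \<Rightarrow> complex" and v :: "'b::euclidean_space \<Rightarrow> complex"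
  assumes u: "u \<in> Cc_infinity" and v: "v \<in> Cc_infinity"
  shows "(\<lambda>z. u (fst z) * v (snd z)) \<in> Cc_infinity"
proof (rule Cc_infinityI)
  have "Ck k (\<lambda>z::'a\<times>'b. u (fst z))" "Ck k (\<lambda>z::'a\<times>'b. v (snd z))" for k
    using Ck_compose_affine[OF bounded_linear_fst bounded_linear_ident Cc_infinityD(1)[OF u], where c=0]
      Ck_compose_affine[OF bounded_linear_snd bounded_linear_ident Cc_infinityD(1)[OF v], where c=0]
    by simp_all
  then show "Ck k (\<lambda>z. u (fst z) * v (snd z))" for k by (intro Ck_mult)
  show "compact (closure {x. u x \<noteq> 0} \<times> closure {x. v x \<noteq> 0})"
    by (intro compact_Times Cc_infinityD(5)[OF u] Cc_infinityD(5)[OF v])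
  show "z \<in> closure {x. u x \<noteq> 0} \<times> closure {x. v x \<noteq> 0}" if "u (fst z) * v (snd z) \<noteq> 0" for z
    using that Cc_infinityD(6)[OF u, of "fst z"] Cc_infinityD(6)[OF v, of "snd z"] by (cases z) auto
qed

text \<open>Off the closed support \<open>u\<close> vanishes on an open set, and so does its
  derivative; the support does not grow.\<close>

lemma Cc_infinity_frechet:
  fixes u :: "'a::euclidean_space \<Rightarrow> 'b::real_normed_vector"
  assumes u: "u \<in> Cc_infinity"
  shows "(\<lambda>x. frechet_derivative u (at x) w) \<in> Cc_infinity"
proof (rule Cc_infinityI)
  show "Ck k (\<lambda>x. frechet_derivative u (at x) w)" for k
    using Cc_infinityD(1)[OF u, of "Suc k"] by simp
  show "compact (closure {x. u x \<noteq> 0})" by (rule Cc_infinityD(5)[OF u])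
  show "x \<in> closure {x. u x \<noteq> 0}" if nz: "frechet_derivative u (at x) w \<noteq> 0" for x
  proof (rule ccontr)
    assume x: "x \<notin> closure {x. u x \<noteq> 0}"
    let ?S = "- closure {x. u x \<noteq> 0}"
    have "((\<lambda>x. 0) has_derivative (\<lambda>w. 0)) (at x)" by simp
    then have "(u has_derivative (\<lambda>w. 0)) (at x)"
    proof (rule has_derivative_transform_within_open)
      show "open ?S" "x \<in> ?S" using x by auto
      show "0 = u y" if "y \<in> ?S" for y
        using that Cc_infinityD(6)[OF u, of y] by auto
    qed
    from frechet_derivative_at[OF this] nz show False by metis
  qed
qed

text \<open>Asks for continuity alone, so that a test function multiplied by a coordinate of
  \<open>\<xi>\<close> is covered directly.\<close>

lemma continuous_compact_support:
  fixes f :: "'a::euclidean_space \<Rightarrow> complex"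
  assumes c: "continuous_on UNIV f" and K: "compact K" "\<And>x. f x \<noteq> 0 \<Longrightarrow> x \<in> K"
  shows "integrable lborel f" and "f \<in> L2" and "\<exists>B. \<forall>x. cmod (f x) \<le> B"
proof -
  have m[measurable]: "f \<in> borel_measurable borel" using c by (rule borel_measurable_continuous_onI)
  have int: "integrable lborel g" if g: "continuous_on UNIV g" "\<And>x. x \<notin> K \<Longrightarrow> g x = 0" for g :: "'a \<Rightarrow> complex"
  proof -
    have "set_integrable lborel K g"
      using K(1) continuous_on_subset[OF g(1)] by (intro borel_integrable_compact[unfolded set_integrable_def[symmetric]]) auto
    moreover have "(\<lambda>x. indicat_real K x *\<^sub>R g x) = g"
      using g(2) by (auto simp: fun_eq_iff split: split_indicator)
    ultimately show ?thesis by (simp add: set_integrable_def)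
  qed
  show "integrable lborel f" using K(2) by (intro int c) auto
  have "integrable lborel (\<lambda>x. f x * cnj (f x))"
    using K(2) by (intro int continuous_intros c) auto
  then have "integrable lborel (\<lambda>x. complex_of_real ((cmod (f x))\<^sup>2))"
    by (simp only: complex_norm_square)
  then have "integrable lborel (\<lambda>x. (cmod (f x))\<^sup>2)"
    unfolding complex_of_real_integrable_eq .
  then show "f \<in> L2" using m by (simp add: L2_def)
  have "bounded (f ` K)"
    using K(1) continuous_on_subset[OF c] by (intro compact_imp_bounded compact_continuous_image) auto
  then obtain B where B: "\<And>x. x \<in> K \<Longrightarrow> cmod (f x) \<le> B" unfolding bounded_iff by auto
  have "cmod (f x) \<le> max B 0" for x
    using B[of x] K(2)[of x] by (cases "f x = 0") auto
  then show "\<exists>B. \<forall>x. cmod (f x) \<le> B" by blast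
qed

lemma Cc_infinity_regular:
  fixes u :: "'a::euclidean_space \<Rightarrow> complex"
  assumes u: "u \<in> Cc_infinity"
  shows "integrable lborel u" and "u \<in> L2" and "\<exists>B. \<forall>x. cmod (u x) \<le> B"
  using continuous_compact_support[OF Cc_infinityD(2,5,6)[OF u]] by auto

section \<open>Translation invariance and transforms of derivatives\<close>

lemma integral_translate:
  fixes f :: "'a::euclidean_space \<Rightarrow> 'b::{banach,second_countable_topology}"
  assumes "f \<in> borel_measurable borel"
  shows "(LINT x|lborel. f (x + t)) = (LINT x|lborel. f x)"
  using integral_lborel_affine[OF _ assms, of 1 t] by (simp add: add.commute)

lemma integrable_translate:
  fixes f :: "'a::euclidean_space \<Rightarrow> 'b::{banach,second_countable_topology}"
  assumes "integrable lborel f"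
  shows "integrable lborel (\<lambda>x. f (x + t))"
  using integrable_lborel_affine[OF _ assms, of 1 t] by (simp add: add.commute)

text \<open>Integrate \<open>u (x + w) - u x = \<integral>\<^sub>0\<^sup>1 D\<^sub>w u (x + s w) ds\<close> over \<open>x\<close>: by translation
  invariance the left side gives 0 and the right side the integral of \<open>D\<^sub>w u\<close>.\<close>

lemma integral_frechet_derivative_eq_0:
  fixes u :: "'a::euclidean_space \<Rightarrow> complex"
  assumes u: "u \<in> Cc_infinity"
  shows "(LINT x|lborel. frechet_derivative u (at x) w) = 0"
proof -
  define D where "D x = frechet_derivative u (at x) w" for x
  have Dc: "D \<in> Cc_infinity" unfolding D_def by (rule Cc_infinity_frechet[OF u])
  have D: "integrable lborel D" "continuous_on UNIV D"
    using Cc_infinity_regular[OF Dc] Cc_infinityD(2)[OF Dc] by auto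
  have [measurable]: "D \<in> borel_measurable borel" using D(1) by auto
  have ui: "integrable lborel u" using Cc_infinity_regular[OF u] by auto
  have [measurable]: "u \<in> borel_measurable borel" using ui by auto
  have ftc: "(LINT s|lborel. indicat_real {0..1} s *\<^sub>R D (x + s *\<^sub>R w)) = u (x + w) - u x" for x
  proof -
    have "has_bochner_integral lborel (\<lambda>s. indicat_real {0..1} s *\<^sub>R D (x + s *\<^sub>R w))
       (u (x + 1 *\<^sub>R w) - u (x + 0 *\<^sub>R w))"
    proof (rule has_bochner_integral_FTC_Icc)
      show "continuous_on {0..1} (\<lambda>s. D (x + s *\<^sub>R w))"
        by (rule continuous_on_compose2[OF D(2)]) (auto intro!: continuous_intros)
      show "((\<lambda>s. u (x + s *\<^sub>R w)) has_vector_derivative D (x + s *\<^sub>R w)) (at s within {0..1})" for s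
      proof -
        have line: "((\<lambda>s. x + s *\<^sub>R w) has_derivative (\<lambda>h. h *\<^sub>R w)) (at s)"
          by (auto intro!: derivative_eq_intros)
        have "((\<lambda>s. u (x + s *\<^sub>R w)) has_derivative
            (\<lambda>h. frechet_derivative u (at (x + s *\<^sub>R w)) (h *\<^sub>R w))) (at s)"
          by (rule has_derivative_compose[OF line Cc_infinityD(4)[OF u]])
        moreover have "frechet_derivative u (at (x + s *\<^sub>R w)) (h *\<^sub>R w) = h *\<^sub>R D (x + s *\<^sub>R w)" for h
          unfolding D_def
          by (rule linear_cmul[OF has_derivative_linear[OF Cc_infinityD(4)[OF u]]])
        ultimately have "((\<lambda>s. u (x + s *\<^sub>R w)) has_vector_derivative D (x + s *\<^sub>R w)) (at s)"
          by (simp add: has_vector_derivative_def)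
        then show ?thesis by (rule has_vector_derivative_at_within)
      qed
    qed simp
    then show ?thesis by (simp add: has_bochner_integral_integral_eq)
  qed
  define c where "c = (LINT x|lborel. cmod (D x))"
  \<comment> \<open>By translation invariance the integral of the modulus over \<open>x\<close> is
    the same for every \<open>s\<close> in the unit interval, so the double integral is
    finite.\<close>
  have "integrable (lborel \<Otimes>\<^sub>M lborel) (\<lambda>(s, x). indicat_real {0..1} s *\<^sub>R D (x + s *\<^sub>R w))"
  proof (rule lborel_pair.Fubini_integrable)
    show "(\<lambda>(s, x). indicat_real {0..1} s *\<^sub>R D (x + s *\<^sub>R w)) \<in> borel_measurable (lborel \<Otimes>\<^sub>M lborel)"
      by measurable
    have eq: "(LINT x|lborel. norm (indicat_real {0..1} s *\<^sub>R D (x + s *\<^sub>R w))) = indicat_real {0..1} s * c" for s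
      using integral_translate[of "\<lambda>x. cmod (D x)" "s *\<^sub>R w"] by (simp add: c_def)
    show "integrable lborel (\<lambda>s. LINT x|lborel. norm (case (s, x) of (s, x) \<Rightarrow> indicat_real {0..1} s *\<^sub>R D (x + s *\<^sub>R w)))"
      unfolding prod.case eq by simp
    show "AE s in lborel. integrable lborel (\<lambda>x. case (s, x) of (s, x) \<Rightarrow> indicat_real {0..1} s *\<^sub>R D (x + s *\<^sub>R w))"
      using integrable_translate[OF D(1)] by simp
  qed
  from lborel_pair.Fubini_integral[OF this]
  have "(LINT x|lborel. LINT s|lborel. indicat_real {0..1} s *\<^sub>R D (x + s *\<^sub>R w))
     = (LINT s|lborel. LINT x|lborel. indicat_real {0..1} s *\<^sub>R D (x + s *\<^sub>R w))" .
  also have "\<dots> = (LINT x|lborel. D x)"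
    by (simp add: integral_translate)
  finally have "(LINT x|lborel. D x) = (LINT x|lborel. u (x + w) - u x)"
    unfolding ftc ..
  also have "\<dots> = 0"
    using integral_translate[of u w] integrable_translate[OF ui, of w] ui by simp
  finally show ?thesis unfolding D_def .
qed

text \<open>The integral of the directional derivative of \<open>u x * cis (- k \<bullet> x)\<close>
  vanishes, and the product rule splits it into the two transforms. Evaluation at \<open>- k\<close>
  fixes the sign of the factor.\<close>

lemma FT_frechet_derivative:
  fixes u :: "'a::euclidean_space \<Rightarrow> complex"
  assumes u: "u \<in> Cc_infinity"
  shows "FT (\<lambda>x. frechet_derivative u (at x) w) (- k) = \<i> * of_real (k \<bullet> w) * FT u (- k)"
proof -
  let ?D = "\<lambda>x. frechet_derivative u (at x) w"
  have int: "integrable lborel (\<lambda>x. u x * cis (- k \<bullet> x))" "integrable lborel (\<lambda>x. ?D x * cis (- k \<bullet> x))"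
    using Cc_infinity_regular(1)[OF u] Cc_infinity_regular(1)[OF Cc_infinity_frechet[OF u]]
    by (auto intro!: integrable_mult_cis simp del: inner_minus_left)
  have der: "frechet_derivative (\<lambda>x. u x * cis (- k \<bullet> x)) (at x) w
      = - (\<i> * of_real (k \<bullet> w)) * (u x * cis (- k \<bullet> x)) + ?D x * cis (- k \<bullet> x)" for x
  proof -
    have "((\<lambda>x. u x * cis (- k \<bullet> x)) has_derivative (\<lambda>h. u x * ((\<i> * of_real (- k \<bullet> h)) * cis (- k \<bullet> x))
        + frechet_derivative u (at x) h * cis (- k \<bullet> x))) (at x)"
      by (rule has_derivative_mult[OF Cc_infinityD(4)[OF u] cis_inner_has_derivative])
    from frechet_derivative_at[OF this, symmetric] show ?thesis by simp
  qed
  have "(\<lambda>x. u x * cis (- k \<bullet> x)) \<in> Cc_infinity"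
    by (rule Cc_infinity_mult[OF u Ck_cis])
  from integral_frechet_derivative_eq_0[OF this, of w]
  have "0 = (LINT x|lborel. - (\<i> * of_real (k \<bullet> w)) * (u x * cis (- k \<bullet> x)) + ?D x * cis (- k \<bullet> x))"
    unfolding der by simp
  also have "\<dots> = - (\<i> * of_real (k \<bullet> w)) * FT u (- k) + FT ?D (- k)"
    unfolding FT_def
    by (subst Bochner_Integration.integral_add)
      (use int in \<open>auto simp del: inner_minus_left\<close>)
  finally show ?thesis by simp
qed

text \<open>Each \<open>of_real (k \<bullet> b) * FT u (- k)\<close> is, up to a unit factor, the
  transform of a derivative of \<open>u\<close>; summing squares over the basis produces the weight
  \<open>norm k\<close>.\<close>

lemma FT_reflect_weighted_L2:
  fixes u :: "'a::euclidean_space \<Rightarrow> complex"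
  assumes u: "u \<in> Cc_infinity"
  shows "(\<lambda>k. FT u (- k)) \<in> L2"
    and "(\<lambda>k. of_real (norm k) * FT u (- k)) \<in> L2"
proof -
  have 1: "(\<lambda>k. FT u (- k)) \<in> L2" if "u \<in> Cc_infinity" for u :: "'a \<Rightarrow> complex"
    using Cc_infinity_regular[OF that] by (intro FT_reflect_L2)
  have 2: "(\<lambda>k. of_real (k \<bullet> w) * FT u (- k)) \<in> L2" for w
  proof -
    have "(\<lambda>k. - \<i> * FT (\<lambda>x. frechet_derivative u (at x) w) (- k)) \<in> L2"
      by (intro L2_scale 1 Cc_infinity_frechet u)
    then show ?thesis unfolding FT_frechet_derivative[OF u] by (simp add: mult.assoc[symmetric])
  qed
  have um[measurable]: "u \<in> borel_measurable borel" using Cc_infinity_regular[OF u] by auto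
  have "(\<lambda>k. (cmod (of_real (norm k) * FT u (- k)))\<^sup>2)
      = (\<lambda>k. \<Sum>b\<in>Basis. (cmod (of_real (k \<bullet> b) * FT u (- k)))\<^sup>2)"
    by (simp add: fun_eq_iff norm_mult power_mult_distrib norm_sq_Basis sum_distrib_right)
  moreover have "integrable lborel (\<lambda>k. \<Sum>b\<in>Basis. (cmod (of_real (k \<bullet> b) * FT u (- k)))\<^sup>2)"
    using 2 by (intro Bochner_Integration.integrable_sum) (auto simp: L2_def)
  ultimately show "(\<lambda>k. of_real (norm k) * FT u (- k)) \<in> L2"
    unfolding L2_def by simp
  show "(\<lambda>k. FT u (- k)) \<in> L2" by (rule 1[OF u])
qed

section \<open>The equation on the Fourier side\<close>

text \<open>\<open>v\<close> is only square-integrable here, so that a test function multiplied by a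
  coordinate of \<open>\<xi>\<close> may take its place.\<close>

lemma distr_of_tensor:
  fixes F :: "'n::finite phase \<Rightarrow> complex"
  assumes F: "F \<in> L2" and u: "u \<in> Cc_infinity" and v: "v \<in> L2"
  shows "(LINT z|lborel. fourier_x F z * (FT u (- fst z) * v (snd z)))
    = of_real ((2 * pi) ^ CARD('n)) * distr_of F (\<lambda>z. u (fst z) * v (snd z))"
proof -
  obtain B where "\<And>x. cmod (u x) \<le> B" using Cc_infinity_regular(3)[OF u] by blast
  from Parseval_tensor[OF F v Cc_infinity_regular(1,2)[OF u] Cc_infinityD(2)[OF u] this]
  show ?thesis by (simp add: distr_of_def)
qed

lemma inv_fourier_x_tensor:
  fixes u v :: "real ^ 'n::finite \<Rightarrow> complex"
  shows "inv_fourier_x (\<lambda>z. u (fst z) * v (snd z)) z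
    = FT u (- fst z) * v (snd z) / of_real ((2 * pi) ^ CARD('n))"
proof -
  obtain k \<xi> where z: "z = (k, \<xi>)" by (cases z)
  have "(LINT x|lborel. u x * v \<xi> * cis (- (k \<bullet> x))) = (LINT x|lborel. u x * cis (- k \<bullet> x) * v \<xi>)"
    by (simp add: mult_ac)
  also have "\<dots> = FT u (- k) * v \<xi>"
    unfolding FT_def by (rule integral_mult_left_zero)
  finally show ?thesis unfolding inv_fourier_x_def z by simp
qed

text \<open>The direction \<open>(snd z, 0)\<close> differentiates \<open>u\<close> alone; expanding
  \<open>snd z\<close> in the basis gives a sum of product functions, the form to which Parseval's
  identity applies.\<close>

lemma frechet_tensor:
  fixes u v :: "real ^ 'n::finite \<Rightarrow> complex"
  assumes u: "u \<in> Cc_infinity" and v: "v \<in> Cc_infinity"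
  shows "frechet_derivative (\<lambda>z. u (fst z) * v (snd z)) (at z) (snd z, 0)
    = (\<Sum>b\<in>Basis. frechet_derivative u (at (fst z)) b * (of_real (snd z \<bullet> b) * v (snd z)))"
proof -
  have du: "((\<lambda>z::'n phase. u (fst z)) has_derivative (\<lambda>h. frechet_derivative u (at (fst z)) (fst h))) (at z)"
    by (rule has_derivative_compose[OF has_derivative_fst[OF has_derivative_ident] Cc_infinityD(4)[OF u]])
  have dv: "((\<lambda>z::'n phase. v (snd z)) has_derivative (\<lambda>h. frechet_derivative v (at (snd z)) (snd h))) (at z)"
    by (rule has_derivative_compose[OF has_derivative_snd[OF has_derivative_ident] Cc_infinityD(4)[OF v]])
  have lin: "linear (frechet_derivative u (at (fst z)))" "linear (frechet_derivative v (at (snd z)))"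
    using has_derivative_linear Cc_infinityD(4) u v by blast+
  have "frechet_derivative (\<lambda>z. u (fst z) * v (snd z)) (at z) (snd z, 0)
      = u (fst z) * frechet_derivative v (at (snd z)) 0 + frechet_derivative u (at (fst z)) (snd z) * v (snd z)"
    using frechet_derivative_at[OF has_derivative_mult[OF du dv], symmetric] by simp
  also have "\<dots> = frechet_derivative u (at (fst z)) (snd z) * v (snd z)"
    using linear_0[OF lin(2)] by simp
  also have "frechet_derivative u (at (fst z)) (snd z)
      = frechet_derivative u (at (fst z)) (\<Sum>b\<in>Basis. (snd z \<bullet> b) *\<^sub>R b)"
    by (simp only: euclidean_representation)
  also have "\<dots> = (\<Sum>b\<in>Basis. (snd z \<bullet> b) *\<^sub>R frechet_derivative u (at (fst z)) b)"
    by (simp only: linear_sum[OF lin(1)] linear_cmul[OF lin(1)])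
  finally show ?thesis
    by (simp add: sum_distrib_right sum_distrib_left scaleR_conv_of_real mult_ac)
qed

text \<open>Parseval's identity for each summand of \<open>frechet_tensor\<close> replaces a
  derivative of \<open>u\<close> by the factor \<open>\<i> * of_real (k \<bullet> b)\<close>, and
  the sum over the basis reassembles \<open>k \<bullet> \<xi>\<close>. With the minus sign in
  \<open>transport\<close>, the symbol of the transport operator is
  \<open>- \<i> * of_real (k \<bullet> \<xi>)\<close>.\<close>

lemma transport_tensor:
  fixes F :: "'n::finite phase \<Rightarrow> complex"
  assumes F: "F \<in> L2" and u: "u \<in> Cc_infinity" and v: "v \<in> Cc_infinity"
  defines "\<phi> \<equiv> \<lambda>z. u (fst z) * v (snd z)"
  shows "integrable lborel (\<lambda>z. F z * frechet_derivative \<phi> (at z) (snd z, 0))"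
    and "transport F \<phi> = - (LINT z|lborel. F z * frechet_derivative \<phi> (at z) (snd z, 0))"
    and "integrable lborel (\<lambda>z. fourier_x F z * (of_real (fst z \<bullet> snd z) * (FT u (- fst z) * v (snd z))))"
    and "(LINT z|lborel. fourier_x F z * (of_real (fst z \<bullet> snd z) * (FT u (- fst z) * v (snd z))))
      = of_real ((2 * pi) ^ CARD('n)) * (\<i> * transport F \<phi>)"
proof -
  define D where "D b x = frechet_derivative u (at x) b" for b x
  define vb where "vb b \<xi> = of_real (\<xi> \<bullet> b) * v \<xi>" for b \<xi>
  have D: "D b \<in> Cc_infinity" for b unfolding D_def by (rule Cc_infinity_frechet[OF u])
  have vb: "vb b \<in> L2" for b
  proof (rule continuous_compact_support(2))
    show "continuous_on UNIV (vb b)"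
      unfolding vb_def by (intro continuous_intros Cc_infinityD(2)[OF v])
    show "compact (closure {x. v x \<noteq> 0})" by (rule Cc_infinityD(5)[OF v])
    show "x \<in> closure {x. v x \<noteq> 0}" if "vb b x \<noteq> 0" for x
      using that Cc_infinityD(6)[OF v, of x] by (auto simp: vb_def)
  qed
  have fr: "F z * frechet_derivative \<phi> (at z) (snd z, 0) = (\<Sum>b\<in>Basis. F z * (D b (fst z) * vb b (snd z)))" for z
    unfolding \<phi>_def frechet_tensor[OF u v] D_def vb_def by (rule sum_distrib_left)
  have int1: "integrable lborel (\<lambda>z. F z * (D b (fst z) * vb b (snd z)))" for b
    by (rule integral_tensor(1)[OF F Cc_infinity_regular(2)[OF D] vb])
  show "integrable lborel (\<lambda>z. F z * frechet_derivative \<phi> (at z) (snd z, 0))"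
    unfolding fr by (intro Bochner_Integration.integrable_sum int1)
  show tr: "transport F \<phi> = - (LINT z|lborel. F z * frechet_derivative \<phi> (at z) (snd z, 0))"
    unfolding transport_def by (simp add: case_prod_unfold)
  have FTD: "FT (D b) (- k) = \<i> * of_real (k \<bullet> b) * FT u (- k)" for b k
    unfolding D_def by (rule FT_frechet_derivative[OF u])
  have int2: "integrable lborel (\<lambda>z. fourier_x F z * (FT (D b) (- fst z) * vb b (snd z)))" for b
    by (rule integral_tensor(1)[OF fourier_x(1)[OF F] FT_reflect_weighted_L2(1)[OF D] vb])
  have sum: "fourier_x F z * (of_real (fst z \<bullet> snd z) * (FT u (- fst z) * v (snd z)))
      = - \<i> * (\<Sum>b\<in>Basis. fourier_x F z * (FT (D b) (- fst z) * vb b (snd z)))" for z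
  proof -
    have "of_real (fst z \<bullet> snd z) = (\<Sum>b\<in>Basis. complex_of_real (fst z \<bullet> b) * of_real (snd z \<bullet> b))"
      by (subst euclidean_inner) simp
    then show ?thesis
      unfolding FTD vb_def by (simp add: sum_distrib_left sum_distrib_right mult_ac)
  qed
  show "integrable lborel (\<lambda>z. fourier_x F z * (of_real (fst z \<bullet> snd z) * (FT u (- fst z) * v (snd z))))"
    unfolding sum by (intro integrable_mult_right Bochner_Integration.integrable_sum int2)
  have "(LINT z|lborel. fourier_x F z * (of_real (fst z \<bullet> snd z) * (FT u (- fst z) * v (snd z))))
      = - \<i> * (\<Sum>b\<in>Basis. LINT z|lborel. fourier_x F z * (FT (D b) (- fst z) * vb b (snd z)))"
    unfolding sum integral_mult_right_zero by (subst Bochner_Integration.integral_sum) (auto intro: int2)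
  also have "\<dots> = - \<i> * (\<Sum>b\<in>Basis. of_real ((2 * pi) ^ CARD('n)) * (LINT z|lborel. F z * (D b (fst z) * vb b (snd z))))"
    unfolding distr_of_tensor[OF F D vb] distr_of_def ..
  also have "\<dots> = of_real ((2 * pi) ^ CARD('n)) * (\<i> * - (\<Sum>b\<in>Basis. (LINT z|lborel. F z * (D b (fst z) * vb b (snd z)))))"
    by (simp add: sum_distrib_left sum_negf mult_ac)
  also have "(\<Sum>b\<in>Basis. (LINT z|lborel. F z * (D b (fst z) * vb b (snd z))))
      = (LINT z|lborel. F z * frechet_derivative \<phi> (at z) (snd z, 0))"
    unfolding fr by (subst Bochner_Integration.integral_sum) (auto intro: int1)
  finally show "(LINT z|lborel. fourier_x F z * (of_real (fst z \<bullet> snd z) * (FT u (- fst z) * v (snd z))))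
      = of_real ((2 * pi) ^ CARD('n)) * (\<i> * transport F \<phi>)"
    unfolding tr .
qed

text \<open>The base runs along the imaginary axis, away from the branch cut, so each half-axis
  contributes one fixed phase. In this form measurability and modulus can be read off.\<close>

lemma powr_minus_ii:
  fixes a t :: real
  shows "(- \<i> * of_real t) powr of_real a =
    (if t > 0 then of_real (t powr a) * exp (of_real a * Ln (- \<i>))
     else if t < 0 then of_real ((- t) powr a) * exp (of_real a * Ln \<i>) else 0)"
proof -
  have pos: "exp (of_real a * Ln (of_real s * w)) = of_real (s powr a) * exp (of_real a * Ln w)"
    if "s > 0" "w \<noteq> 0" for s :: real and w
    using that by (simp add: Ln_times_of_real Ln_of_real distrib_left exp_add powr_def exp_of_real[symmetric])
  consider "t > 0" | "t < 0" | "t = 0" by linarith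
  then show ?thesis
  proof cases
    case 1
    have "- \<i> * of_real t = of_real t * - \<i>" by simp
    then show ?thesis using 1 pos[of t "- \<i>"] by (simp add: powr_def mult.commute)
  next
    case 2
    have "- \<i> * of_real t = of_real (- t) * \<i>" by simp
    then show ?thesis using 2 pos[of "- t" "\<i>"] by (simp add: powr_def mult.commute)
  qed simp
qed

lemma norm_powr_minus_ii:
  fixes a t :: real
  shows "cmod ((- \<i> * of_real t) powr of_real a) = \<bar>t\<bar> powr a"
  unfolding powr_minus_ii by (simp add: norm_mult)

lemma deriv_symbol_measurable[measurable]:
  fixes \<alpha> :: "real ^ 'n::finite"
  shows "deriv_symbol \<alpha> \<in> borel_measurable borel"
proof -
  have 1: "(\<lambda>k::real^'n. (- \<i> * of_real (k $ j)) powr of_real (\<alpha> $ j)) \<in> borel_measurable borel" for j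
  proof -
    have [measurable]: "(\<lambda>k::real^'n. k $ j) \<in> borel_measurable borel"
      by (intro borel_measurable_continuous_onI continuous_intros)
    show ?thesis unfolding powr_minus_ii by measurable
  qed
  show ?thesis
    unfolding deriv_symbol_def[abs_def]
  proof (rule borel_measurable_prod)
    show "(\<lambda>k. if \<alpha> $ j = 0 then 1 else (- \<i> * complex_of_real (k $ j)) powr complex_of_real (\<alpha> $ j))
      \<in> borel_measurable borel" for j
      using 1[of j] by (cases "\<alpha> $ j = 0") simp_all
  qed
qed

lemma order_of_nonneg: "(\<And>j. \<alpha> $ j \<ge> 0) \<Longrightarrow> 0 \<le> order_of \<alpha>"
  by (simp add: order_of_def sum_nonneg)

text \<open>Each coordinate is at most \<open>norm k\<close> in modulus. The point
  \<open>k = 0\<close> is excluded because \<open>0 powr 0 = 0\<close> would break the bound when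
  \<open>\<alpha>\<close> is zero.\<close>

lemma cmod_deriv_symbol_le:
  fixes \<alpha> :: "real ^ 'n::finite"
  assumes nonneg: "\<And>j. \<alpha> $ j \<ge> 0" and k: "k \<noteq> 0"
  shows "cmod (deriv_symbol \<alpha> k) \<le> norm k powr order_of \<alpha>"
proof -
  have "cmod (deriv_symbol \<alpha> k) \<le> (\<Prod>j\<in>UNIV. norm k powr (\<alpha> $ j))"
    unfolding deriv_symbol_def prod_norm[symmetric]
  proof (intro prod_mono conjI)
    fix j
    have "cmod ((- \<i> * of_real (k $ j)) powr of_real (\<alpha> $ j)) \<le> norm k powr (\<alpha> $ j)"
      unfolding norm_powr_minus_ii
      using nonneg[of j] component_le_norm_cart[of k j] by (intro powr_mono2) auto
    then show "cmod (if \<alpha> $ j = 0 then 1 else (- \<i> * of_real (k $ j)) powr of_real (\<alpha> $ j))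
        \<le> norm k powr (\<alpha> $ j)"
      using k by (auto simp del: norm_mult)
  qed simp
  also have "\<dots> = norm k powr order_of \<alpha>"
    using k by (simp add: order_of_def powr_sum)
  finally show ?thesis .
qed

text \<open>A bound without exceptional point and of degree one: the symbol is absorbed by the
  weight \<open>norm k\<close>, under which transforms of test functions stay
  square-integrable.\<close>

lemma cmod_deriv_symbol_le_1:
  fixes \<alpha> :: "real ^ 'n::finite"
  assumes nonneg: "\<And>j. \<alpha> $ j \<ge> 0" and ord: "order_of \<alpha> \<le> 1"
  shows "cmod (deriv_symbol \<alpha> k) \<le> 1 + norm k"
proof (cases "k = 0")
  case True
  have "cmod (deriv_symbol \<alpha> 0) \<le> (\<Prod>j\<in>(UNIV::'n set). 1)"
    unfolding deriv_symbol_def prod_norm[symmetric] by (intro prod_mono) auto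
  then show ?thesis using True by simp
next
  case False
  have "norm k powr order_of \<alpha> \<le> 1 + norm k"
  proof (cases "norm k \<le> 1")
    case True
    then have "norm k powr order_of \<alpha> \<le> 1"
      using order_of_nonneg[of \<alpha>] nonneg by (intro powr_le1) auto
    then show ?thesis using norm_ge_zero[of k] by linarith
  next
    case False
    then have "norm k powr order_of \<alpha> \<le> norm k powr 1" using ord by (intro powr_mono) auto
    then show ?thesis using False by simp
  qed
  with cmod_deriv_symbol_le[OF nonneg False] show ?thesis by linarith
qed

lemma deriv_symbol_FT_L2:
  fixes \<alpha> :: "real ^ 'n::finite"
  assumes nonneg: "\<And>j. \<alpha> $ j \<ge> 0" and ord: "order_of \<alpha> \<le> 1" and u: "u \<in> Cc_infinity"
  shows "(\<lambda>k. deriv_symbol \<alpha> k * FT u (- k)) \<in> L2"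
proof -
  have [measurable]: "u \<in> borel_measurable borel" using Cc_infinity_regular(1)[OF u] by auto
  have m: "(\<lambda>k. deriv_symbol \<alpha> k * FT u (- k)) \<in> borel_measurable borel" by measurable
  have sum: "(\<lambda>k. of_real (norm k) * FT u (- k) + FT u (- k)) \<in> L2"
    by (rule L2_add[OF FT_reflect_weighted_L2(2)[OF u] FT_reflect_weighted_L2(1)[OF u]])
  have "L2sq (\<lambda>k. deriv_symbol \<alpha> k * FT u (- k)) \<le> L2sq (\<lambda>k. of_real (norm k) * FT u (- k) + FT u (- k))"
  proof (rule L2sq_mono)
    fix k
    have "of_real (norm k) * FT u (- k) + FT u (- k) = of_real (1 + norm k) * FT u (- k)"
      by (simp add: distrib_right)
    then have "cmod (of_real (norm k) * FT u (- k) + FT u (- k)) = (1 + norm k) * cmod (FT u (- k))"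
      by (simp only: norm_mult norm_of_real) simp
    moreover have "cmod (deriv_symbol \<alpha> k * FT u (- k)) \<le> (1 + norm k) * cmod (FT u (- k))"
      unfolding norm_mult by (intro mult_right_mono cmod_deriv_symbol_le_1 nonneg ord norm_ge_zero)
    ultimately show "cmod (deriv_symbol \<alpha> k * FT u (- k)) \<le> cmod (of_real (norm k) * FT u (- k) + FT u (- k))"
      by simp
  qed
  also have "\<dots> < \<infinity>" using sum by (simp add: L2_iff)
  finally show ?thesis using m by (simp add: L2_iff)
qed

text \<open>The fractional derivative is defined on the frequency side, so the identity only moves
  the normalising constant of \<open>inv_fourier_x\<close>; integrability comes from attaching the
  symbol to the test function.\<close>

lemma frac_deriv_tensor:
  fixes F :: "'n::finite phase \<Rightarrow> complex"
  assumes nonneg: "\<And>j. \<alpha> $ j \<ge> 0" and ord: "order_of \<alpha> \<le> 1"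
    and F: "F \<in> L2" and u: "u \<in> Cc_infinity" and v: "v \<in> L2"
  shows "integrable lborel (\<lambda>z. fourier_x F z * (deriv_symbol \<alpha> (fst z) * (FT u (- fst z) * v (snd z))))"
    and "(LINT z|lborel. fourier_x F z * (deriv_symbol \<alpha> (fst z) * (FT u (- fst z) * v (snd z))))
    = of_real ((2 * pi) ^ CARD('n)) * frac_deriv \<alpha> F (\<lambda>z. u (fst z) * v (snd z))"
proof -
  have "integrable lborel (\<lambda>z. fourier_x F z * (deriv_symbol \<alpha> (fst z) * FT u (- fst z) * v (snd z)))"
    by (rule integral_tensor(1)[OF fourier_x(1)[OF F] deriv_symbol_FT_L2[OF nonneg ord u] v])
  then show "integrable lborel (\<lambda>z. fourier_x F z * (deriv_symbol \<alpha> (fst z) * (FT u (- fst z) * v (snd z))))"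
    by (simp only: mult.assoc)
  let ?c = "complex_of_real ((2 * pi) ^ CARD('n))"
  have c: "?c \<noteq> 0" by simp
  have "?c * frac_deriv \<alpha> F (\<lambda>z. u (fst z) * v (snd z))
     = (LINT z|lborel. ?c * (deriv_symbol \<alpha> (fst z) * fourier_x F z * (FT u (- fst z) * v (snd z) / ?c)))"
    unfolding frac_deriv_def case_prod_unfold prod.collapse inv_fourier_x_tensor integral_mult_right_zero ..
  also have "\<dots> = (LINT z|lborel. fourier_x F z * (deriv_symbol \<alpha> (fst z) * (FT u (- fst z) * v (snd z))))"
    using c by (intro Bochner_Integration.integral_cong refl) (simp del: of_real_power)
  finally show "(LINT z|lborel. fourier_x F z * (deriv_symbol \<alpha> (fst z) * (FT u (- fst z) * v (snd z))))
    = ?c * frac_deriv \<alpha> F (\<lambda>z. u (fst z) * v (snd z))" by simp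
qed

section \<open>From the weak equation to a pointwise relation between transforms\<close>

lemma FT_continuous:
  fixes h :: "'a::euclidean_space \<Rightarrow> complex"
  assumes h: "integrable lborel h"
  shows "isCont (FT h) k"
  unfolding continuous_at_sequentially o_def
proof (intro allI impI)
  fix s :: "nat \<Rightarrow> 'a" assume s: "s \<longlonglongrightarrow> k"
  have [measurable]: "h \<in> borel_measurable borel" using h by auto
  show "(\<lambda>n. FT h (s n)) \<longlonglongrightarrow> FT h k"
    unfolding FT_def
  proof (rule integral_dominated_convergence)
    show "integrable lborel (\<lambda>x. cmod (h x))" using h by simp
    show "AE x in lborel. (\<lambda>n. h x * cis (s n \<bullet> x)) \<longlonglongrightarrow> h x * cis (k \<bullet> x)"
    proof (rule AE_I2)
      fix x :: 'a
      have "isCont cis (k \<bullet> x)" 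
        using continuous_on_cis[OF continuous_on_id, of UNIV] by (simp add: continuous_on_eq_continuous_at)
      then have "(\<lambda>n. cis (s n \<bullet> x)) \<longlonglongrightarrow> cis (k \<bullet> x)"
        by (rule isCont_tendsto_compose) (intro tendsto_inner s tendsto_const)
      then show "(\<lambda>n. h x * cis (s n \<bullet> x)) \<longlonglongrightarrow> h x * cis (k \<bullet> x)"
        by (rule tendsto_mult[OF tendsto_const])
    qed
  qed (auto simp: norm_mult)
qed

text \<open>By the uniqueness theorem a vanishing transform would make \<open>\<psi>\<close> zero
  almost everywhere, hence everywhere by continuity.\<close>

lemma FT_of_real_nonzero:
  fixes \<psi> :: "'a::euclidean_space \<Rightarrow> real"
  assumes psi: "\<psi> \<in> Cc_infinity" and nz: "\<psi> x0 \<noteq> 0"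
  obtains \<eta> where "FT (\<lambda>x. complex_of_real (\<psi> x)) \<eta> \<noteq> 0"
proof -
  have c: "(\<lambda>x. complex_of_real (\<psi> x)) \<in> Cc_infinity"
    using Cc_infinity_of_real_translate[OF psi, of 0] by simp
  have "\<exists>\<eta>. FT (\<lambda>x. complex_of_real (\<psi> x)) \<eta> \<noteq> 0"
  proof (rule ccontr)
    assume "\<not> ?thesis"
    then have "AE x in lborel. complex_of_real (\<psi> x) = 0"
      by (intro FT_eq_0_imp_AE_0 Cc_infinity_regular(1)[OF c]) auto
    then have "AE x in lebesgue. x \<in> {x. \<psi> x = 0}"
      by (intro AE_completion) auto
    moreover have "closed {x. \<psi> x = 0}"
      by (intro closed_Collect_eq continuous_on_const Cc_infinityD(2)[OF psi])
    ultimately have "x0 \<in> {x. \<psi> x = 0}" by (intro mem_closed_if_AE_lebesgue)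
    then show False using nz by simp
  qed
  then show ?thesis using that by blast
qed

lemma FT_translate_modulate:
  fixes h :: "'a::euclidean_space \<Rightarrow> complex"
  assumes [measurable]: "h \<in> borel_measurable borel"
  shows "FT (\<lambda>x. h (x - a) * cis (c \<bullet> x)) (- k) = FT h (c - k) * cis ((c - k) \<bullet> a)"
proof -
  have "FT (\<lambda>x. h (x - a) * cis (c \<bullet> x)) (- k) = (LINT x|lborel. h (x - a) * cis ((c - k) \<bullet> x))"
    unfolding FT_def by (simp add: mult.assoc cis_mult inner_diff_left)
  also have "\<dots> = (LINT x|lborel. h x * cis ((c - k) \<bullet> (x + a)))"
    using integral_translate[of "\<lambda>x. h (x - a) * cis ((c - k) \<bullet> x)" a] by simp
  also have "\<dots> = (LINT x|lborel. h x * cis ((c - k) \<bullet> x) * cis ((c - k) \<bullet> a))"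
    by (simp add: inner_add_right cis_mult[symmetric] mult.assoc)
  also have "\<dots> = FT h (c - k) * cis ((c - k) \<bullet> a)"
    unfolding FT_def by (rule integral_mult_left_zero)
  finally show ?thesis .
qed

text \<open>The test functions are translates and modulates of \<open>\<psi> \<otimes> \<psi>\<close>: letting the translation
  in \<open>x\<close> and the modulation in \<open>\<xi>\<close> vary turns the weak equation into the vanishing of the
  Fourier transform of an integrable function on phase space. The modulation \<open>c\<close> in \<open>x\<close> moves a
  neighbourhood on which the transform of \<open>\<psi>\<close> does not vanish to any given frequency.\<close>

lemma fourier_transport_relation:
  fixes \<psi> :: "real ^ 'n::finite \<Rightarrow> real" and g E Q :: "'n phase \<Rightarrow> complex"
  assumes psi: "\<psi> \<in> Cc_infinity" and nonneg: "\<And>j. \<alpha> $ j \<ge> 0" and ord: "order_of \<alpha> \<le> 1"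
    and g: "g \<in> L2" and E: "E \<in> L2" and Q: "Q \<in> L2"
    and eq: "\<And>u v. u \<in> Cc_infinity \<Longrightarrow> v \<in> Cc_infinity \<Longrightarrow>
      transport g (\<lambda>z. u (fst z) * v (snd z)) + of_real lam * distr_of g (\<lambda>z. u (fst z) * v (snd z))
      = of_real lam * frac_deriv \<alpha> E (\<lambda>z. u (fst z) * v (snd z)) - distr_of Q (\<lambda>z. u (fst z) * v (snd z))"
  shows "AE z in lborel. \<psi> (snd z) \<noteq> 0 \<longrightarrow>
    (of_real lam - \<i> * of_real (fst z \<bullet> snd z)) * fourier_x g z
      = of_real lam * deriv_symbol \<alpha> (fst z) * fourier_x E z - fourier_x Q z"
proof (cases "\<exists>x0. \<psi> x0 \<noteq> 0")
  case False
  then show ?thesis by simp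
next
  case True
  then obtain x0 where x0: "\<psi> x0 \<noteq> 0" by blast
  \<comment> \<open>The defect of the claimed relation. It contains the unbounded factors
    \<open>fst z \<bullet> snd z\<close> and \<open>deriv_symbol \<alpha> (fst z)\<close>, so
    integrability is obtained for its products with transformed test functions.\<close>
  define H where "H z = (of_real lam - \<i> * of_real (fst z \<bullet> snd z)) * fourier_x g z
      - (of_real lam * deriv_symbol \<alpha> (fst z) * fourier_x E z - fourier_x Q z)" for z
  have weak: "integrable lborel (\<lambda>z. H z * (FT u (- fst z) * v (snd z)))"
    "(LINT z|lborel. H z * (FT u (- fst z) * v (snd z))) = 0"
    if u: "u \<in> Cc_infinity" and v: "v \<in> Cc_infinity" for u v
  proof -
    let ?w = "\<lambda>z. FT u (- fst z) * v (snd z)" and ?C = "complex_of_real ((2 * pi) ^ CARD('n))"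
    let ?\<phi> = "\<lambda>z::'n phase. u (fst z) * v (snd z)"
    have v2: "v \<in> L2" by (rule Cc_infinity_regular(2)[OF v])
    note w2 = FT_reflect_weighted_L2(1)[OF u]
    note i1 = integral_tensor(1)[OF fourier_x(1)[OF g] w2 v2]
    note i2 = transport_tensor(3)[OF g u v]
    note i3 = frac_deriv_tensor(1)[OF nonneg ord E u v2]
    note i4 = integral_tensor(1)[OF fourier_x(1)[OF Q] w2 v2]
    have split: "H z * ?w z = of_real lam * (fourier_x g z * ?w z)
        - \<i> * (fourier_x g z * (of_real (fst z \<bullet> snd z) * ?w z))
        - of_real lam * (fourier_x E z * (deriv_symbol \<alpha> (fst z) * ?w z))
        + fourier_x Q z * ?w z" for z
      unfolding H_def by (simp add: algebra_simps)
    show "integrable lborel (\<lambda>z. H z * ?w z)"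
      unfolding split
      by (intro Bochner_Integration.integrable_add Bochner_Integration.integrable_diff integrable_mult_right i1 i2 i3 i4)
    have "(LINT z|lborel. H z * ?w z) = of_real lam * (LINT z|lborel. fourier_x g z * ?w z)
        - \<i> * (LINT z|lborel. fourier_x g z * (of_real (fst z \<bullet> snd z) * ?w z))
        - of_real lam * (LINT z|lborel. fourier_x E z * (deriv_symbol \<alpha> (fst z) * ?w z))
        + (LINT z|lborel. fourier_x Q z * ?w z)"
      unfolding split integral_mult_right_zero[symmetric]
      by (simp only: Bochner_Integration.integral_add Bochner_Integration.integral_diff
          Bochner_Integration.integrable_diff integrable_mult_right i1 i2 i3 i4)
    also have "\<dots> = ?C * (transport g ?\<phi> + of_real lam * distr_of g ?\<phi>
        - (of_real lam * frac_deriv \<alpha> E ?\<phi> - distr_of Q ?\<phi>))"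
      unfolding distr_of_tensor[OF g u v2] distr_of_tensor[OF Q u v2] transport_tensor(4)[OF g u v]
        frac_deriv_tensor(2)[OF nonneg ord E u v2]
      by (simp add: algebra_simps del: of_real_power)
    also have "\<dots> = 0" unfolding eq[OF u v] by simp
    finally show "(LINT z|lborel. H z * ?w z) = 0" .
  qed
  define h where "h x = complex_of_real (\<psi> x)" for x
  have h: "h \<in> Cc_infinity"
    unfolding h_def using Cc_infinity_of_real_translate[OF psi, of 0] by simp
  have hi: "integrable lborel h" by (rule Cc_infinity_regular(1)[OF h])
  then have hm[measurable]: "h \<in> borel_measurable borel" by auto
  have van: "AE z in lborel. H z * (FT h (c - fst z) * h (snd z)) = 0" for c
  proof -
    \<comment> \<open>The translation \<open>a\<close> and the modulation \<open>b\<close> enter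
      only as phases, so the weak equation makes the transform of this one integrable function
      vanish at every \<open>(- a, b)\<close>.\<close>
    define P where "P z = H z * (FT h (c - fst z) * h (snd z))" for z
    have u: "(\<lambda>x. h (x - a) * cis (c \<bullet> x)) \<in> Cc_infinity" for a
      unfolding h_def by (intro Cc_infinity_mult Ck_cis Cc_infinity_of_real_translate psi)
    have v: "(\<lambda>\<xi>. h \<xi> * cis (b \<bullet> \<xi>)) \<in> Cc_infinity" for b
      by (intro Cc_infinity_mult Ck_cis h)
    have P: "H z * (FT (\<lambda>x. h (x - a) * cis (c \<bullet> x)) (- fst z) * (h (snd z) * cis (b \<bullet> snd z)))
        = cis (c \<bullet> a) * (P z * cis ((- a, b) \<bullet> z))" for a b z
    proof -
      have "cis ((c - fst z) \<bullet> a) * cis (b \<bullet> snd z) = cis (c \<bullet> a) * cis ((- a, b) \<bullet> z)"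
        by (simp add: cis_mult inner_prod_def inner_commute inner_diff_right algebra_simps)
      then show ?thesis
        unfolding FT_translate_modulate[OF hm] P_def by (simp add: mult_ac)
    qed
    have "integrable lborel P"
      using weak(1)[OF u[of 0] v[of 0]] unfolding P by (simp add: zero_prod_def[symmetric])
    moreover have "FT P k = 0" for k
    proof -
      obtain a b where k: "k = (- a, b)" by (metis minus_minus surj_pair)
      have "(LINT z|lborel. cis (c \<bullet> a) * (P z * cis ((- a, b) \<bullet> z))) = 0"
        using weak(2)[OF u[of a] v[of b]] unfolding P .
      then have "cis (c \<bullet> a) * FT P k = 0"
        unfolding FT_def k integral_mult_right_zero .
      then show ?thesis by (simp add: cis_neq_zero)
    qed
    ultimately have "AE z in lborel. P z = 0" by (rule FT_eq_0_imp_AE_0)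
    then show ?thesis unfolding P_def .
  qed
  \<comment> \<open>The exceptional null set depends on \<open>c\<close>; a countable dense set of
    modulations leaves a single null set.\<close>
  obtain S :: "(real ^ 'n) set" where S: "countable S" "\<And>X. open X \<Longrightarrow> X \<noteq> {} \<Longrightarrow> \<exists>c\<in>S. c \<in> X"
    using countable_dense_setE by blast
  obtain \<eta> where eta: "FT h \<eta> \<noteq> 0"
    using FT_of_real_nonzero[OF psi x0] unfolding h_def by blast
  have "AE z in lborel. \<forall>c\<in>S. H z * (FT h (c - fst z) * h (snd z)) = 0"
    unfolding AE_ball_countable[OF S(1)] using van by blast
  then show ?thesis
  proof eventually_elim
    case (elim z)
    show ?case
    proof
      assume z: "\<psi> (snd z) \<noteq> 0"
      obtain e where e: "e > 0" "\<And>k. dist \<eta> k < e \<Longrightarrow> FT h k \<noteq> 0"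
        using continuous_at_avoid[OF FT_continuous[OF hi] eta] by blast
      define X where "X = ball \<eta> e"
      have X: "open X" "\<eta> \<in> X" "\<And>k. k \<in> X \<Longrightarrow> FT h k \<noteq> 0"
        using e by (auto simp: X_def)
      \<comment> \<open>The neighbourhood of \<open>\<eta>\<close>, shifted by the given frequency,
        meets \<open>S\<close> and so provides a \<open>c\<close> with
        \<open>FT h (c - fst z)\<close> nonzero.\<close>
      have "open ((+) (fst z) ` X)" "(+) (fst z) ` X \<noteq> {}"
        using X(1,2) by (auto intro: open_translation)
      from S(2)[OF this] obtain c y where "c \<in> S" "c = fst z + y" "y \<in> X" by auto
      then have "FT h (c - fst z) \<noteq> 0" using X(3) by simp
      then have "H z = 0" using elim \<open>c \<in> S\<close> z by (auto simp: h_def)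
      then show "(of_real lam - \<i> * of_real (fst z \<bullet> snd z)) * fourier_x g z
          = of_real lam * deriv_symbol \<alpha> (fst z) * fourier_x E z - fourier_x Q z"
        unfolding H_def by simp
    qed
  qed
qed

section \<open>Velocity averaging\<close>

text \<open>The resolvent as a Laplace transform: the fundamental theorem on
  \<open>{0..real n}\<close>, then dominated convergence. The open half-line and the closed
  intervals disagree at the null point 0, hence the almost everywhere statements.\<close>

lemma laplace_cis:
  fixes lam s :: real
  assumes lam: "lam > 0"
  shows "integrable lborel (\<lambda>t. indicat_real {0<..} t *\<^sub>R complex_of_real (exp (- lam * t)))"
    and "(LINT t|lborel. indicat_real {0<..} t *\<^sub>R (complex_of_real (exp (- lam * t)) * cis (t * s)))
      = 1 / (of_real lam - \<i> * of_real s)"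
proof -
  have "integrable lborel (\<lambda>t. indicat_real {0<..} t * exp (- lam * t))"
    using integrable_I0i_exp_mscale[OF lam] unfolding set_integrable_def
    by (simp add: mult.commute[of lam])
  then have "integrable lborel (\<lambda>t. complex_of_real (indicat_real {0<..} t * exp (- lam * t)))"
    by (rule integrable_of_real)
  then show int: "integrable lborel (\<lambda>t. indicat_real {0<..} t *\<^sub>R complex_of_real (exp (- lam * t)))"
    by (simp add: scaleR_conv_of_real)
  define w where "w = complex_of_real lam - \<i> * of_real s"
  have w: "w \<noteq> 0" using lam by (auto simp: w_def complex_eq_iff)
  have f: "complex_of_real (exp (- lam * t)) * cis (t * s) = exp (- w * of_real t)" for t
    by (simp add: w_def cis_conv_exp exp_of_real[symmetric] exp_add[symmetric] algebra_simps)
  define F where "F t = - exp (- w * of_real t) / w" for t :: real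
  have nrm: "cmod (exp (- w * of_real t)) = exp (- lam * t)" for t
    by (simp add: w_def norm_exp_eq_Re)
  have fin: "(LINT t|lborel. indicat_real {0..real n} t *\<^sub>R exp (- w * of_real t)) = F (real n) - F 0" for n
  proof (rule integral_FTC_Icc)
    show "(F has_vector_derivative exp (- w * of_real t)) (at t within {0..real n})" for t
    proof -
      have "((\<lambda>t. - exp (- w * t) / w) has_field_derivative exp (- w * of_real t)) (at (of_real t))"
        using w by (auto intro!: derivative_eq_intros)
      from has_vector_derivative_real_field[OF this] show ?thesis
        unfolding F_def by (rule has_vector_derivative_at_within)
    qed
    show "continuous_on {0..real n} (\<lambda>t. exp (- w * of_real t))" by (intro continuous_intros)
  qed simp
  have "(\<lambda>n. LINT t|lborel. indicat_real {0..real n} t *\<^sub>R exp (- w * of_real t))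
      \<longlonglongrightarrow> (LINT t|lborel. indicat_real {0<..} t *\<^sub>R exp (- w * of_real t))"
  proof (rule integral_dominated_convergence)
    show "integrable lborel (\<lambda>t. cmod (indicat_real {0<..} t *\<^sub>R complex_of_real (exp (- lam * t))))"
      using int by (rule integrable_norm)
    show "AE t in lborel. (\<lambda>n. indicat_real {0..real n} t *\<^sub>R exp (- w * of_real t))
        \<longlonglongrightarrow> indicat_real {0<..} t *\<^sub>R exp (- w * of_real t)"
      using AE_lborel_singleton[of "0::real"]
    proof eventually_elim
      case (elim t)
      obtain N :: nat where "t \<le> real N" using real_arch_simple by blast
      then have "indicat_real {0..real n} t = indicat_real {0<..} t" if "n \<ge> N" for n
        using that elim by (auto split: split_indicator)
      then show ?case
        by (intro tendsto_eventually eventually_sequentiallyI[of N]) simp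
    qed
    show "AE t in lborel. norm (indicat_real {0..real n} t *\<^sub>R exp (- w * of_real t))
        \<le> cmod (indicat_real {0<..} t *\<^sub>R complex_of_real (exp (- lam * t)))" for n
      using AE_lborel_singleton[of "0::real"]
      by eventually_elim (auto simp: nrm w_def split: split_indicator)
  qed measurable
  moreover have "(\<lambda>n. F (real n) - F 0) \<longlonglongrightarrow> 1 / w"
  proof -
    have "(\<lambda>n. exp (- lam) ^ n) \<longlonglongrightarrow> 0"
      using lam by (intro LIMSEQ_power_zero) simp
    then have "(\<lambda>n. exp (- lam * real n)) \<longlonglongrightarrow> 0"
      by (simp add: exp_of_nat_mult[symmetric] mult.commute)
    then have "(\<lambda>n. exp (- w * of_real (real n))) \<longlonglongrightarrow> 0"
      unfolding nrm[symmetric] by (rule tendsto_norm_zero_cancel)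
    then have "(\<lambda>n. - exp (- w * of_real (real n)) / w - F 0) \<longlonglongrightarrow> - 0 / w - F 0"
      by (intro tendsto_intros w)
    then show ?thesis by (simp add: F_def)
  qed
  ultimately have "(LINT t|lborel. indicat_real {0<..} t *\<^sub>R exp (- w * of_real t)) = 1 / w"
    unfolding fin by (rule LIMSEQ_unique)
  then show "(LINT t|lborel. indicat_real {0<..} t *\<^sub>R (complex_of_real (exp (- lam * t)) * cis (t * s)))
      = 1 / (of_real lam - \<i> * of_real s)"
    unfolding f w_def .
qed

lemma Re_complex_of_real_mult: "Re (complex_of_real x * z) = x * Re z"
  by simp

lemma Re_inverse_diff_ii: "Re (1 / (of_real lam - \<i> * of_real s)) = lam / (lam\<^sup>2 + s\<^sup>2)"
  by (simp add: Re_divide power2_eq_square)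

text \<open>Averaging over \<open>\<xi>\<close> gains a factor \<open>1 / norm k\<close>: writing the resolvent as a Laplace
  integral, the Gaussian average becomes a Gaussian in \<open>t * norm k\<close>.\<close>

lemma gauss_average_resolvent:
  fixes k :: "'a::euclidean_space"
  assumes lam: "lam > 0" and k: "k \<noteq> 0"
  shows "integrable lborel (\<lambda>\<xi>. gauss \<xi> / (lam\<^sup>2 + (k \<bullet> \<xi>)\<^sup>2))"
    and "(LINT \<xi>|lborel. gauss \<xi> / (lam\<^sup>2 + (k \<bullet> \<xi>)\<^sup>2)) \<le> sqrt (2 * pi) ^ DIM('a) * sqrt (2 * pi) / (lam * norm k)"
    and "(LINT \<xi>|lborel. gauss \<xi> / (lam\<^sup>2 + (k \<bullet> \<xi>)\<^sup>2)) \<le> sqrt (2 * pi) ^ DIM('a) / lam\<^sup>2"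
proof -
  define c where "c = sqrt (2 * pi) ^ DIM('a)"
  have c: "c > 0" by (simp add: c_def)
  have pos: "lam\<^sup>2 + (k \<bullet> \<xi>)\<^sup>2 > 0" for \<xi> using lam by (simp add: add_pos_nonneg)
  have le: "gauss \<xi> / (lam\<^sup>2 + (k \<bullet> \<xi>)\<^sup>2) \<le> gauss \<xi> / lam\<^sup>2" for \<xi>
    using lam by (intro divide_left_mono mult_pos_pos pos) auto
  show int: "integrable lborel (\<lambda>\<xi>. gauss \<xi> / (lam\<^sup>2 + (k \<bullet> \<xi>)\<^sup>2))"
  proof (rule Bochner_Integration.integrable_bound)
    show "integrable lborel (\<lambda>\<xi>::'a. gauss \<xi> / lam\<^sup>2)" by simp
    show "AE \<xi> in lborel. norm (gauss \<xi> / (lam\<^sup>2 + (k \<bullet> \<xi>)\<^sup>2)) \<le> norm (gauss \<xi> / lam\<^sup>2)"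
      using le pos by (intro AE_I2) (simp add: less_imp_le)
  qed measurable
  have "(LINT \<xi>|lborel. gauss \<xi> / (lam\<^sup>2 + (k \<bullet> \<xi>)\<^sup>2)) \<le> (LINT \<xi>|lborel. gauss (\<xi>::'a) / lam\<^sup>2)"
    by (rule integral_mono[OF int _ le]) simp
  then show "(LINT \<xi>|lborel. gauss \<xi> / (lam\<^sup>2 + (k \<bullet> \<xi>)\<^sup>2)) \<le> sqrt (2 * pi) ^ DIM('a) / lam\<^sup>2"
    by (simp add: integral_gauss)
  define e where "e t = indicat_real {0<..} t *\<^sub>R complex_of_real (exp (- lam * t))" for t
  have e: "integrable lborel e" unfolding e_def by (rule laplace_cis(1)[OF lam])
  have [measurable]: "e \<in> borel_measurable borel" using e by auto
  have gi: "integrable lborel (\<lambda>\<xi>::'a. complex_of_real (gauss \<xi>))" by simp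
  have "integrable (lborel \<Otimes>\<^sub>M lborel) (\<lambda>z. cis (fst z * (k \<bullet> snd z)) * (\<lambda>(t, \<xi>). e t * complex_of_real (gauss \<xi>)) z)"
    by (rule integrable_bounded_mult[OF integrable_pair_mult[OF e gi], where B=1]) auto
  then have pint: "integrable (lborel \<Otimes>\<^sub>M lborel) (\<lambda>(t, \<xi>). e t * (complex_of_real (gauss \<xi>) * cis (\<xi> \<bullet> (t *\<^sub>R k))))"
    by (simp add: case_prod_unfold mult_ac inner_commute)
  have "(LINT \<xi>|lborel. complex_of_real (gauss \<xi>) * (1 / (of_real lam - \<i> * of_real (k \<bullet> \<xi>))))
      = (LINT \<xi>|lborel. LINT t|lborel. e t * (complex_of_real (gauss \<xi>) * cis (\<xi> \<bullet> (t *\<^sub>R k))))"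
  proof (rule Bochner_Integration.integral_cong[OF refl])
    fix \<xi> :: 'a
    show "complex_of_real (gauss \<xi>) * (1 / (of_real lam - \<i> * of_real (k \<bullet> \<xi>)))
      = (LINT t|lborel. e t * (complex_of_real (gauss \<xi>) * cis (\<xi> \<bullet> (t *\<^sub>R k))))"
      unfolding laplace_cis(2)[OF lam, symmetric] integral_mult_right_zero[symmetric] e_def
      by (intro Bochner_Integration.integral_cong refl) (simp add: mult_ac inner_commute)
  qed
  also have "\<dots> = (LINT t|lborel. LINT \<xi>|lborel. e t * (complex_of_real (gauss \<xi>) * cis (\<xi> \<bullet> (t *\<^sub>R k))))"
    by (rule lborel_pair.Fubini_integral[OF pint])
  also have "\<dots> = (LINT t|lborel. e t * of_real (c * gauss (t *\<^sub>R k)))"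
    unfolding integral_mult_right_zero gauss_cis(2) c_def ..
  finally have eq: "(LINT \<xi>|lborel. complex_of_real (gauss \<xi>) * (1 / (of_real lam - \<i> * of_real (k \<bullet> \<xi>))))
      = (LINT t|lborel. e t * of_real (c * gauss (t *\<^sub>R k)))" .
  have ci: "integrable lborel (\<lambda>\<xi>. complex_of_real (gauss \<xi>) * (1 / (of_real lam - \<i> * of_real (k \<bullet> \<xi>))))"
  proof (rule Bochner_Integration.integrable_bound)
    show "integrable lborel (\<lambda>\<xi>::'a. gauss \<xi> * (1 / lam))" by simp
    show "AE \<xi> in lborel. norm (complex_of_real (gauss \<xi>) * (1 / (of_real lam - \<i> * of_real (k \<bullet> \<xi>)))) \<le> norm (gauss \<xi> * (1 / lam))"
    proof (rule AE_I2)
      fix \<xi> :: 'a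
      have "lam \<le> cmod (of_real lam - \<i> * of_real (k \<bullet> \<xi>))"
        using complex_Re_le_cmod[of "of_real lam - \<i> * of_real (k \<bullet> \<xi>)"] by simp
      then have "1 / cmod (of_real lam - \<i> * of_real (k \<bullet> \<xi>)) \<le> 1 / lam"
        using lam by (intro divide_left_mono mult_pos_pos) auto
      from mult_left_mono[OF this gauss_nonneg[of \<xi>]]
      show "norm (complex_of_real (gauss \<xi>) * (1 / (of_real lam - \<i> * of_real (k \<bullet> \<xi>)))) \<le> norm (gauss \<xi> * (1 / lam))"
        using lam by (simp add: norm_mult norm_divide)
    qed
  qed measurable
  have g1: "integrable lborel (\<lambda>t::real. gauss (t * norm k))"
    using integrable_lborel_affine[of "norm k" "gauss :: real \<Rightarrow> real" 0] k by (simp add: mult.commute)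
  have g2: "(LINT t|lborel. gauss (t * norm k)) = sqrt (2 * pi) / norm k"
    using integral_lborel_affine[of "norm k" "gauss :: real \<Rightarrow> real" 0] k integral_gauss[where ?'a = real]
    by (simp add: mult.commute field_simps)
  have gk: "gauss (t *\<^sub>R k) = gauss (t * norm k)" for t
    by (simp add: gauss_def power_mult_distrib)
  \<comment> \<open>The integrand is the real part of the Gaussian times the resolvent, whose
    integral the Laplace representation has just evaluated.\<close>
  have "lam * (LINT \<xi>|lborel. gauss \<xi> / (lam\<^sup>2 + (k \<bullet> \<xi>)\<^sup>2))
      = (LINT \<xi>|lborel. Re (complex_of_real (gauss \<xi>) * (1 / (of_real lam - \<i> * of_real (k \<bullet> \<xi>)))))"
  proof -
    have "lam * (gauss \<xi> / (lam\<^sup>2 + (k \<bullet> \<xi>)\<^sup>2)) = Re (complex_of_real (gauss \<xi>) * (1 / (of_real lam - \<i> * of_real (k \<bullet> \<xi>))))" for \<xi>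
      unfolding Re_complex_of_real_mult Re_inverse_diff_ii by simp
    then show ?thesis unfolding integral_mult_right_zero[symmetric] by simp
  qed
  also have "\<dots> = Re (LINT t|lborel. e t * of_real (c * gauss (t *\<^sub>R k)))"
    unfolding eq[symmetric] by (rule integral_Re[OF ci])
  also have "\<dots> \<le> cmod (LINT t|lborel. e t * of_real (c * gauss (t *\<^sub>R k)))"
    by (rule complex_Re_le_cmod)
  also have "\<dots> \<le> (LINT t|lborel. cmod (e t * of_real (c * gauss (t *\<^sub>R k))))"
    by (rule integral_norm_bound)
  also have "\<dots> \<le> (LINT t|lborel. c * gauss (t * norm k))"
  proof (rule integral_mono')
    show "integrable lborel (\<lambda>t. c * gauss (t * norm k))" using g1 by simp
    show "cmod (e t * of_real (c * gauss (t *\<^sub>R k))) \<le> c * gauss (t * norm k)" for t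
    proof -
      \<comment> \<open>Dropping the exponential and the restriction to positive \<open>t\<close>
        leaves a full Gaussian integral in \<open>t * norm k\<close>, the source of the factor
        \<open>1 / norm k\<close>.\<close>
      have "cmod (e t) \<le> 1" using lam by (auto simp: e_def split: split_indicator)
      then have "cmod (e t) * (c * gauss (t *\<^sub>R k)) \<le> 1 * (c * gauss (t *\<^sub>R k))"
        using c by (intro mult_right_mono) auto
      then show ?thesis using c by (simp add: norm_mult gk)
    qed
    show "0 \<le> c * gauss (t * norm k)" for t using c by simp
  qed
  also have "\<dots> = c * sqrt (2 * pi) / norm k" by (simp add: g2)
  finally show "(LINT \<xi>|lborel. gauss \<xi> / (lam\<^sup>2 + (k \<bullet> \<xi>)\<^sup>2)) \<le> sqrt (2 * pi) ^ DIM('a) * sqrt (2 * pi) / (lam * norm k)"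
    using lam k unfolding c_def[symmetric] by (simp add: field_simps)
qed

section \<open>The weighted estimate for the transform of the moment\<close>

lemma L2norm_pos:
  assumes "f \<in> L2" "L2_nonzero f"
  shows "L2norm f > 0"
proof -
  have [measurable]: "f \<in> borel_measurable borel" using L2_measurable[OF assms(1)] .
  have "L2norm f \<noteq> 0"
  proof
    assume "L2norm f = 0"
    then have "(\<integral>\<^sup>+x. ennreal ((cmod (f x))\<^sup>2) \<partial>lborel) = 0"
      using nn_integral_L2[OF assms(1)] by simp
    then have "AE x in lborel. ennreal ((cmod (f x))\<^sup>2) = 0"
      by (subst (asm) nn_integral_0_iff_AE) auto
    then have "AE x in lborel. f x = 0" by eventually_elim (simp add: ennreal_eq_0_iff)
    then show False using assms(2) by (simp add: L2_nonzero_def)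
  qed
  moreover have "0 \<le> L2norm f" by (simp add: L2norm_def integral_nonneg_AE)
  ultimately show ?thesis by simp
qed

text \<open>\<open>\<psi>\<close> is bounded and supported in a ball of radius \<open>R\<close>,
  where the Gaussian is at least \<open>exp (- R\<^sup>2 / 2)\<close>.\<close>

lemma Cc_infinity_le_gauss:
  fixes \<psi> :: "'a::euclidean_space \<Rightarrow> real"
  assumes psi: "\<psi> \<in> Cc_infinity"
  obtains B where "B > 0" "\<And>\<xi>. (\<psi> \<xi>)\<^sup>2 \<le> B * gauss \<xi>"
proof -
  have c: "(\<lambda>x. complex_of_real (\<psi> x)) \<in> Cc_infinity"
    using Cc_infinity_of_real_translate[OF psi, of 0] by simp
  obtain M where M: "\<And>x. \<bar>\<psi> x\<bar> \<le> M"
    using Cc_infinity_regular(3)[OF c] by auto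
  have "bounded {x. \<psi> x \<noteq> 0}"
    using compact_imp_bounded[OF Cc_infinityD(5)[OF psi]] bounded_subset closure_subset by blast
  then obtain R where R: "\<And>x. \<psi> x \<noteq> 0 \<Longrightarrow> norm x \<le> R" unfolding bounded_iff by auto
  \<comment> \<open>The summand 1 keeps the constant positive even if the bound \<open>M\<close> is
    0.\<close>
  show ?thesis
  proof (rule that[of "(M\<^sup>2 + 1) * exp (R\<^sup>2 / 2)"])
    show "0 < (M\<^sup>2 + 1) * exp (R\<^sup>2 / 2)" by (simp add: add_nonneg_pos)
    fix \<xi>
    show "(\<psi> \<xi>)\<^sup>2 \<le> (M\<^sup>2 + 1) * exp (R\<^sup>2 / 2) * gauss \<xi>"
    proof (cases "\<psi> \<xi> = 0")
      case True
      then show ?thesis by simp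
    next
      case False
      then have "(norm \<xi>)\<^sup>2 \<le> R\<^sup>2" using R by (intro power_mono) auto
      then have "1 \<le> exp (R\<^sup>2 / 2) * gauss \<xi>"
        by (simp add: gauss_def exp_add[symmetric])
      moreover have "(\<psi> \<xi>)\<^sup>2 \<le> M\<^sup>2 + 1" using power_mono[OF M[of \<xi>], of 2] by simp
      ultimately have "(\<psi> \<xi>)\<^sup>2 * 1 \<le> (M\<^sup>2 + 1) * (exp (R\<^sup>2 / 2) * gauss \<xi>)"
        by (intro mult_mono) auto
      then show ?thesis by (simp add: mult.assoc)
    qed
  qed
qed

text \<open>Split at \<open>norm k = lam\<close>. Above it the average is of order
  \<open>1 / (lam * norm k)\<close> and \<open>norm k powr (p - 1)\<close> is nonincreasing, as
  \<open>p \<le> 1\<close>; below it the average is of order \<open>1 / lam\<^sup>2\<close> and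
  \<open>norm k powr p\<close> is nondecreasing. Both cases end at
  \<open>lam powr (p - 2)\<close>.\<close>

lemma resolvent_weight_le:
  fixes \<psi> :: "'a::euclidean_space \<Rightarrow> real"
  assumes B: "B > 0" "\<And>\<xi>. (\<psi> \<xi>)\<^sup>2 \<le> B * gauss \<xi>"
    and lam: "lam > 0" and k: "k \<noteq> 0" and p: "0 \<le> p" "p \<le> 1"
  shows "ennreal (norm k powr p) * L2sq (\<lambda>\<xi>. of_real (\<psi> \<xi>) / (of_real lam - \<i> * of_real (k \<bullet> \<xi>)))
    \<le> ennreal (B * (sqrt (2 * pi) ^ DIM('a) * sqrt (2 * pi)) * lam powr (p - 2))"
proof -
  define c where "c = sqrt (2 * pi) ^ DIM('a)"
  have c: "c > 0" by (simp add: c_def)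
  define I where "I = (LINT \<xi>|lborel. gauss \<xi> / (lam\<^sup>2 + (k \<bullet> \<xi>)\<^sup>2))"
  have pos: "lam\<^sup>2 + (k \<bullet> \<xi>)\<^sup>2 > 0" for \<xi> using lam by (simp add: add_pos_nonneg)
  have "L2sq (\<lambda>\<xi>. of_real (\<psi> \<xi>) / (of_real lam - \<i> * of_real (k \<bullet> \<xi>)))
      \<le> (\<integral>\<^sup>+\<xi>. ennreal (B * (gauss \<xi> / (lam\<^sup>2 + (k \<bullet> \<xi>)\<^sup>2))) \<partial>lborel)"
    unfolding L2sq_def
  proof (intro nn_integral_mono ennreal_leI)
    fix \<xi>
    have "(cmod (of_real lam - \<i> * of_real (k \<bullet> \<xi>)))\<^sup>2 = lam\<^sup>2 + (k \<bullet> \<xi>)\<^sup>2"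
      by (simp add: cmod_power2)
    then have "(cmod (of_real (\<psi> \<xi>) / (of_real lam - \<i> * of_real (k \<bullet> \<xi>))))\<^sup>2 = (\<psi> \<xi>)\<^sup>2 / (lam\<^sup>2 + (k \<bullet> \<xi>)\<^sup>2)"
      by (simp add: norm_divide power_divide)
    also have "\<dots> \<le> B * gauss \<xi> / (lam\<^sup>2 + (k \<bullet> \<xi>)\<^sup>2)"
      by (intro divide_right_mono B less_imp_le pos)
    finally show "(cmod (of_real (\<psi> \<xi>) / (of_real lam - \<i> * of_real (k \<bullet> \<xi>))))\<^sup>2
        \<le> B * (gauss \<xi> / (lam\<^sup>2 + (k \<bullet> \<xi>)\<^sup>2))" by simp
  qed
  also have "\<dots> = ennreal (LINT \<xi>|lborel. B * (gauss \<xi> / (lam\<^sup>2 + (k \<bullet> \<xi>)\<^sup>2)))"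
    using gauss_average_resolvent(1)[OF lam k] B(1) pos
    by (intro nn_integral_eq_integral integrable_mult_right) (auto simp: less_imp_le)
  also have "\<dots> = ennreal (B * I)" unfolding I_def integral_mult_right_zero ..
  finally have L: "L2sq (\<lambda>\<xi>. of_real (\<psi> \<xi>) / (of_real lam - \<i> * of_real (k \<bullet> \<xi>))) \<le> ennreal (B * I)" .
  have s1: "1 \<le> sqrt (2 * pi)" using pi_ge_two by simp
  have "norm k powr p * I \<le> c * sqrt (2 * pi) * lam powr (p - 2)"
  proof (cases "lam \<le> norm k")
    case True
    have "norm k powr p * I \<le> norm k powr p * (c * sqrt (2 * pi) / (lam * norm k))"
      unfolding I_def c_def by (intro mult_left_mono gauss_average_resolvent(2)[OF lam k]) simp
    also have "\<dots> = c * sqrt (2 * pi) / lam * norm k powr (p - 1)"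
      using k by (simp add: powr_diff)
    also have "\<dots> \<le> c * sqrt (2 * pi) / lam * lam powr (p - 1)"
      using True lam p c by (intro mult_left_mono powr_mono2') auto
    also have "\<dots> = c * sqrt (2 * pi) * lam powr (p - 2)"
      using lam by (simp add: powr_diff power2_eq_square)
    finally show ?thesis .
  next
    case False
    have "norm k powr p * I \<le> norm k powr p * (c / lam\<^sup>2)"
      unfolding I_def c_def by (intro mult_left_mono gauss_average_resolvent(3)[OF lam k]) simp
    also have "\<dots> \<le> lam powr p * (c / lam\<^sup>2)"
      using False p c by (intro mult_right_mono powr_mono2) auto
    also have "\<dots> = c * 1 * lam powr (p - 2)"
      using lam by (simp add: powr_diff)
    also have "\<dots> \<le> c * sqrt (2 * pi) * lam powr (p - 2)"
      using c s1 by (intro mult_right_mono mult_left_mono) auto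
    finally show ?thesis .
  qed
  then have "B * (norm k powr p * I) \<le> B * (c * sqrt (2 * pi) * lam powr (p - 2))"
    using B(1) by (intro mult_left_mono) auto
  then have fin: "norm k powr p * (B * I) \<le> B * (c * sqrt (2 * pi)) * lam powr (p - 2)"
    by (simp add: mult_ac)
  have "ennreal (norm k powr p) * L2sq (\<lambda>\<xi>. of_real (\<psi> \<xi>) / (of_real lam - \<i> * of_real (k \<bullet> \<xi>)))
      \<le> ennreal (norm k powr p) * ennreal (B * I)"
    by (intro mult_left_mono L) simp
  also have "\<dots> = ennreal (norm k powr p * (B * I))"
    by (rule ennreal_mult''[symmetric]) (use B(1) pos in \<open>auto simp: I_def less_imp_le intro!: mult_nonneg_nonneg integral_nonneg_AE\<close>)
  also have "\<dots> \<le> ennreal (B * (c * sqrt (2 * pi)) * lam powr (p - 2))"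
    using fin by (rule ennreal_leI)
  finally show ?thesis unfolding c_def .
qed

text \<open>\<open>resolvent_weight_le\<close> is applied with exponent
  \<open>2 * order_of \<alpha> + \<gamma>\<close> to the \<open>E\<close> part and with
  \<open>\<gamma>\<close> to the \<open>Q\<close> part, whence the two powers of \<open>lam\<close>.
  The factor 4 is 2 from splitting the numerator times 2 from the bound on
  \<open>fourier_x\<close>.\<close>

lemma averaging_bound:
  fixes \<psi> :: "real ^ 'n::finite \<Rightarrow> real" and g E Q :: "'n phase \<Rightarrow> complex"
  assumes psi: "\<psi> \<in> Cc_infinity" and nonneg: "\<And>j. \<alpha> $ j \<ge> 0"
    and gam: "0 \<le> \<gamma>" "2 * order_of \<alpha> + \<gamma> \<le> 1"
    and B: "B > 0" "\<And>\<xi>. (\<psi> \<xi>)\<^sup>2 \<le> B * gauss \<xi>"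
    and lam: "lam > 0"
    and g: "g \<in> L2" and E: "E \<in> L2" and Q: "Q \<in> L2"
    and eq: "\<And>u v. u \<in> Cc_infinity \<Longrightarrow> v \<in> Cc_infinity \<Longrightarrow>
      transport g (\<lambda>z. u (fst z) * v (snd z)) + of_real lam * distr_of g (\<lambda>z. u (fst z) * v (snd z))
      = of_real lam * frac_deriv \<alpha> E (\<lambda>z. u (fst z) * v (snd z)) - distr_of Q (\<lambda>z. u (fst z) * v (snd z))"
  defines "A \<equiv> B * (sqrt (2 * pi) ^ CARD('n) * sqrt (2 * pi))"
  shows "Hdot_seminorm_sq (\<gamma> / 2) (moment \<psi> g)
    \<le> ennreal (4 * A * (2 * pi) ^ CARD('n) *
        (lam powr (2 * order_of \<alpha> + \<gamma>) * (L2norm E)\<^sup>2 + lam powr (\<gamma> - 2) * (L2norm Q)\<^sup>2))"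
proof -
  define a where "a = order_of \<alpha>"
  have a: "0 \<le> a" "a \<le> 1" "\<gamma> \<le> 1"
    using order_of_nonneg[of \<alpha>] nonneg gam by (auto simp: a_def)
  have Apos: "A > 0" using B(1) by (simp add: A_def)
  define h where "h \<xi> = complex_of_real (\<psi> \<xi>)" for \<xi>
  have h: "h \<in> Cc_infinity"
    unfolding h_def using Cc_infinity_of_real_translate[OF psi, of 0] by simp
  have h2: "h \<in> L2" by (rule Cc_infinity_regular(2)[OF h])
  have [measurable]: "h \<in> borel_measurable borel" using L2_measurable[OF h2] .
  define G where "G = fourier_x g"
  define FE where "FE = fourier_x E"
  define FQ where "FQ = fourier_x Q"
  have GL: "G \<in> L2" "FE \<in> L2" "FQ \<in> L2"
    unfolding G_def FE_def FQ_def by (rule fourier_x(1)[OF g] fourier_x(1)[OF E] fourier_x(1)[OF Q])+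
  have [measurable]: "G \<in> borel_measurable borel" "FE \<in> borel_measurable borel" "FQ \<in> borel_measurable borel"
    using GL L2_measurable by auto
  define e where "e k = L2sq (\<lambda>\<xi>. FE (k, \<xi>))" for k
  define q where "q k = L2sq (\<lambda>\<xi>. FQ (k, \<xi>))" for k
  have [measurable]: "e \<in> borel_measurable borel" "q \<in> borel_measurable borel"
    unfolding e_def[abs_def] q_def[abs_def] by measurable
  \<comment> \<open>The weight \<open>h\<close> is grouped with the resolvent in \<open>r\<close>,
    so that Cauchy-Schwarz separates the data in \<open>N\<close> from the average over
    \<open>\<xi>\<close>.\<close>
  define N where "N k \<xi> = of_real lam * deriv_symbol \<alpha> k * FE (k, \<xi>) + (- 1) * FQ (k, \<xi>)" for k \<xi>
  define r where "r k \<xi> = h \<xi> / (of_real lam - \<i> * of_real (k \<bullet> \<xi>))" for k \<xi>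
  have nz: "of_real lam - \<i> * of_real s \<noteq> 0" for s using lam by (auto simp: complex_eq_iff)
  have mom: "moment \<psi> g = vmoment h g" by (simp add: fun_eq_iff moment_def vmoment_def h_def)
  have rel: "AE z in lborel. \<psi> (snd z) \<noteq> 0 \<longrightarrow>
    (of_real lam - \<i> * of_real (fst z \<bullet> snd z)) * G z
      = of_real lam * deriv_symbol \<alpha> (fst z) * FE z - FQ z"
    unfolding G_def FE_def FQ_def
    by (rule fourier_transport_relation[OF psi nonneg _ g E Q eq]) (use a in \<open>simp_all add: a_def\<close>)
  \<comment> \<open>Through the product measure, almost everywhere on phase space becomes almost
    every \<open>\<xi>\<close> for almost every \<open>k\<close>.\<close>
  have "AE z in lborel \<Otimes>\<^sub>M lborel. \<psi> (snd z) \<noteq> 0 \<longrightarrow>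
    (of_real lam - \<i> * of_real (fst z \<bullet> snd z)) * G z
      = of_real lam * deriv_symbol \<alpha> (fst z) * FE z - FQ z"
    unfolding lborel_prod by (rule rel)
  from lborel_pair.AE_pair[OF this]
  have relk: "AE k in lborel. AE \<xi> in lborel. G (k, \<xi>) * h \<xi> = N k \<xi> * r k \<xi>"
  proof eventually_elim
    case (elim k)
    then show ?case
    proof eventually_elim
      case (elim \<xi>)
      \<comment> \<open>Where \<open>\<psi>\<close> vanishes both sides are 0, so the relation is
        consulted only where it is known.\<close>
      show ?case
      proof (cases "\<psi> \<xi> = 0")
        case False
        then have "(of_real lam - \<i> * of_real (k \<bullet> \<xi>)) * G (k, \<xi>) = N k \<xi>"
          using elim by (simp add: N_def)
        then have "N k \<xi> * r k \<xi> = (of_real lam - \<i> * of_real (k \<bullet> \<xi>)) * G (k, \<xi>) * r k \<xi>" by simp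
        also have "\<dots> = G (k, \<xi>) * h \<xi>" using lam by (simp add: r_def)
        finally show ?thesis ..
      qed (simp add: h_def r_def)
    qed
  qed
  \<comment> \<open>The frequency 0 is discarded as a null set, since the bounds on the symbol and
    on the resolvent both assume \<open>k\<close> nonzero.\<close>
  have point: "AE k in lborel. ennreal (norm k powr \<gamma> * (cmod (fourier (moment \<psi> g) k))\<^sup>2)
      \<le> ennreal (2 * A * lam powr (2 * a + \<gamma>)) * e k + ennreal (2 * A * lam powr (\<gamma> - 2)) * q k"
    using relk fourier_vmoment[OF g h2] AE_lborel_singleton[of "0 :: real ^ 'n"]
  proof eventually_elim
    case (elim k)
    have Nm: "N k \<in> borel_measurable borel" and rm: "r k \<in> borel_measurable borel"
      unfolding N_def[abs_def] r_def[abs_def] by measurable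
    have "fourier (moment \<psi> g) k = (LINT \<xi>|lborel. G (k, \<xi>) * h \<xi>)"
      using elim(2) unfolding mom G_def vmoment_def .
    also have "\<dots> = (LINT \<xi>|lborel. N k \<xi> * r k \<xi>)"
    proof (rule integral_cong_AE)
      show "(\<lambda>\<xi>. N k \<xi> * r k \<xi>) \<in> borel_measurable lborel" using Nm rm by measurable
    qed (measurable, rule elim(1))
    finally have "ennreal ((cmod (fourier (moment \<psi> g) k))\<^sup>2) \<le> L2sq (N k) * L2sq (r k)"
      using norm_integral_mult_sq_le[OF Nm rm] by simp
    also have "\<dots> \<le> (2 * (ennreal (lam\<^sup>2 * norm k powr (2 * a)) * e k) + 2 * q k) * L2sq (r k)"
    proof (rule mult_right_mono)
      have "L2sq (N k) \<le> 2 * L2sq (\<lambda>\<xi>. of_real lam * deriv_symbol \<alpha> k * FE (k, \<xi>)) + 2 * L2sq (\<lambda>\<xi>. (- 1) * FQ (k, \<xi>))"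
        unfolding N_def[abs_def] by (rule L2sq_add_le) measurable
      also have "L2sq (\<lambda>\<xi>. of_real lam * deriv_symbol \<alpha> k * FE (k, \<xi>))
          = ennreal ((cmod (of_real lam * deriv_symbol \<alpha> k))\<^sup>2) * e k"
        unfolding e_def by (rule L2sq_scale) measurable
      also have "L2sq (\<lambda>\<xi>. (- 1) * FQ (k, \<xi>)) = q k"
        unfolding q_def by (subst L2sq_scale) simp_all
      also have "2 * (ennreal ((cmod (of_real lam * deriv_symbol \<alpha> k))\<^sup>2) * e k) + 2 * q k
          \<le> 2 * (ennreal (lam\<^sup>2 * norm k powr (2 * a)) * e k) + 2 * q k"
      proof (intro add_mono mult_left_mono mult_right_mono ennreal_leI order_refl)
        have "(cmod (deriv_symbol \<alpha> k))\<^sup>2 \<le> (norm k powr a)\<^sup>2"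
          unfolding a_def by (intro power_mono cmod_deriv_symbol_le nonneg elim(3)) simp
        also have "\<dots> = norm k powr (2 * a)"
          by (simp add: power2_eq_square powr_add[symmetric])
        finally show "(cmod (of_real lam * deriv_symbol \<alpha> k))\<^sup>2 \<le> lam\<^sup>2 * norm k powr (2 * a)"
          by (simp add: norm_mult power_mult_distrib mult_left_mono)
      qed simp_all
      finally show "L2sq (N k) \<le> 2 * (ennreal (lam\<^sup>2 * norm k powr (2 * a)) * e k) + 2 * q k" .
    qed simp
    finally have R: "ennreal ((cmod (fourier (moment \<psi> g) k))\<^sup>2)
      \<le> (2 * (ennreal (lam\<^sup>2 * norm k powr (2 * a)) * e k) + 2 * q k) * L2sq (r k)" .
    have W: "ennreal (norm k powr p) * L2sq (r k) \<le> ennreal (A * lam powr (p - 2))" if "0 \<le> p" "p \<le> 1" for p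
      using resolvent_weight_le[OF B lam elim(3) that] unfolding r_def[abs_def] h_def A_def by simp
    have "ennreal (norm k powr \<gamma> * (cmod (fourier (moment \<psi> g) k))\<^sup>2)
        = ennreal (norm k powr \<gamma>) * ennreal ((cmod (fourier (moment \<psi> g) k))\<^sup>2)"
      by (rule ennreal_mult) simp_all
    also have "\<dots> \<le> ennreal (norm k powr \<gamma>) *
        ((2 * (ennreal (lam\<^sup>2 * norm k powr (2 * a)) * e k) + 2 * q k) * L2sq (r k))"
      by (rule mult_left_mono[OF R]) simp
    also have "\<dots> = ennreal (2 * lam\<^sup>2) * (ennreal (norm k powr \<gamma>) * ennreal (norm k powr (2 * a)) * L2sq (r k)) * e k
        + 2 * (ennreal (norm k powr \<gamma>) * L2sq (r k)) * q k"
    proof -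
      have s: "ennreal (lam\<^sup>2 * norm k powr (2 * a)) = ennreal (lam\<^sup>2) * ennreal (norm k powr (2 * a))"
        by (rule ennreal_mult) simp_all
      have t: "ennreal (2 * lam\<^sup>2) = 2 * ennreal (lam\<^sup>2)"
        by (subst ennreal_mult) simp_all
      show ?thesis unfolding s t by (simp only: distrib_left distrib_right mult_ac)
    qed
    also have "ennreal (norm k powr \<gamma>) * ennreal (norm k powr (2 * a)) = ennreal (norm k powr (2 * a + \<gamma>))"
      by (simp add: ennreal_mult[symmetric] powr_add mult.commute)
    also have "ennreal (2 * lam\<^sup>2) * (ennreal (norm k powr (2 * a + \<gamma>)) * L2sq (r k)) * e k
        + 2 * (ennreal (norm k powr \<gamma>) * L2sq (r k)) * q k
      \<le> ennreal (2 * lam\<^sup>2) * ennreal (A * lam powr (2 * a + \<gamma> - 2)) * e k + 2 * ennreal (A * lam powr (\<gamma> - 2)) * q k"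
      using a gam by (intro add_mono mult_right_mono mult_left_mono W) (auto simp: a_def)
    also have "ennreal (2 * lam\<^sup>2) * ennreal (A * lam powr (2 * a + \<gamma> - 2)) = ennreal (2 * A * lam powr (2 * a + \<gamma>))"
    proof -
      have "2 * lam\<^sup>2 * (A * lam powr (2 * a + \<gamma> - 2)) = 2 * A * lam powr (2 * a + \<gamma>)"
        using lam by (simp add: powr_diff)
      then show ?thesis using Apos by (simp add: ennreal_mult[symmetric])
    qed
    also have "2 * ennreal (A * lam powr (\<gamma> - 2)) = ennreal (2 * A * lam powr (\<gamma> - 2))"
    proof -
      have "ennreal (2 * (A * lam powr (\<gamma> - 2))) = ennreal 2 * ennreal (A * lam powr (\<gamma> - 2))"
        using Apos by (intro ennreal_mult) auto
      then show ?thesis by (simp add: mult.assoc)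
    qed
    finally show ?case .
  qed
  have "Hdot_seminorm_sq (\<gamma> / 2) (moment \<psi> g)
      \<le> (\<integral>\<^sup>+k. ennreal (2 * A * lam powr (2 * a + \<gamma>)) * e k + ennreal (2 * A * lam powr (\<gamma> - 2)) * q k \<partial>lborel)"
    unfolding Hdot_seminorm_sq_def by (rule nn_integral_mono_AE) (use point in simp)
  also have "\<dots> = ennreal (2 * A * lam powr (2 * a + \<gamma>)) * L2sq FE + ennreal (2 * A * lam powr (\<gamma> - 2)) * L2sq FQ"
    by (subst nn_integral_add) (simp_all add: nn_integral_cmult L2sq_pair(2)[of FE] L2sq_pair(2)[of FQ] e_def q_def)
  also have "\<dots> \<le> ennreal (2 * A * lam powr (2 * a + \<gamma>)) * ennreal (2 * (2 * pi) ^ CARD('n) * (L2norm E)\<^sup>2)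
      + ennreal (2 * A * lam powr (\<gamma> - 2)) * ennreal (2 * (2 * pi) ^ CARD('n) * (L2norm Q)\<^sup>2)"
  proof -
    have "L2sq (fourier_x F) \<le> ennreal (2 * (2 * pi) ^ CARD('n) * (L2norm F)\<^sup>2)"
      if F: "F \<in> L2" for F :: "'n phase \<Rightarrow> complex"
    proof -
      have "L2sq (fourier_x F) \<le> ennreal 2 * (ennreal ((2 * pi) ^ CARD('n)) * ennreal ((L2norm F)\<^sup>2))"
        using fourier_x(3)[OF F] nn_integral_L2[OF F] by (simp add: L2sq_def)
      also have "\<dots> = ennreal (2 * ((2 * pi) ^ CARD('n) * (L2norm F)\<^sup>2))"
        by (subst ennreal_mult, simp, simp, subst ennreal_mult) simp_all
      finally show ?thesis by (simp only: mult.assoc)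
    qed
    then show ?thesis unfolding FE_def FQ_def using E Q by (intro add_mono mult_left_mono) auto
  qed
  also have "\<dots> = ennreal (4 * A * (2 * pi) ^ CARD('n) *
        (lam powr (2 * a + \<gamma>) * (L2norm E)\<^sup>2 + lam powr (\<gamma> - 2) * (L2norm Q)\<^sup>2))"
    using Apos by (simp add: ennreal_mult[symmetric] ennreal_plus[symmetric] algebra_simps del: ennreal_plus)
  finally show ?thesis unfolding a_def .
qed

text \<open>Bochner integrals subtract under integrability, which the product test functions supply;
  the two equations are combined against these.\<close>

lemma transport_diff_tensor:
  fixes F G :: "'n::finite phase \<Rightarrow> complex"
  assumes F: "F \<in> L2" and G: "G \<in> L2" and u: "u \<in> Cc_infinity" and v: "v \<in> Cc_infinity"
  shows "transport (\<lambda>z. F z - G z) (\<lambda>z. u (fst z) * v (snd z))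
      = transport F (\<lambda>z. u (fst z) * v (snd z)) - transport G (\<lambda>z. u (fst z) * v (snd z))"
    and "distr_of (\<lambda>z. F z - G z) (\<lambda>z. u (fst z) * v (snd z))
      = distr_of F (\<lambda>z. u (fst z) * v (snd z)) - distr_of G (\<lambda>z. u (fst z) * v (snd z))"
proof -
  show "transport (\<lambda>z. F z - G z) (\<lambda>z. u (fst z) * v (snd z))
      = transport F (\<lambda>z. u (fst z) * v (snd z)) - transport G (\<lambda>z. u (fst z) * v (snd z))"
    unfolding transport_tensor(2)[OF F u v] transport_tensor(2)[OF G u v]
      transport_tensor(2)[OF L2_diff[OF F G] u v] left_diff_distrib
    by (subst Bochner_Integration.integral_diff[OF transport_tensor(1)[OF F u v] transport_tensor(1)[OF G u v]]) simp
  have int: "integrable lborel (\<lambda>z. H z * (u (fst z) * v (snd z)))" if "H \<in> L2" for H :: "'n phase \<Rightarrow> complex"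
    by (rule integral_tensor(1)[OF that Cc_infinity_regular(2)[OF u] Cc_infinity_regular(2)[OF v]])
  show "distr_of (\<lambda>z. F z - G z) (\<lambda>z. u (fst z) * v (snd z))
      = distr_of F (\<lambda>z. u (fst z) * v (snd z)) - distr_of G (\<lambda>z. u (fst z) * v (snd z))"
    unfolding distr_of_def left_diff_distrib
    by (rule Bochner_Integration.integral_diff[OF int[OF F] int[OF G]])
qed

text \<open>\<open>l\<close> is the solution of \<open>l powr (2 + 2 * a) = (q / e)\<^sup>2\<close>,
  which says precisely that the two left-hand sides agree.\<close>

lemma optimal_balance:
  fixes q e a \<gamma> :: real
  assumes "q > 0" "e > 0" "0 \<le> a"
  defines "l \<equiv> (q / e) powr (1 / (1 + a))"
  shows "l powr (2 * a + \<gamma>) * e\<^sup>2 = e powr ((2 - \<gamma>) / (1 + a)) * q powr ((2 * a + \<gamma>) / (1 + a))"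
    and "l powr (\<gamma> - 2) * q\<^sup>2 = e powr ((2 - \<gamma>) / (1 + a)) * q powr ((2 * a + \<gamma>) / (1 + a))"
proof -
  have l: "l powr p = q powr (p / (1 + a)) * e powr (- (p / (1 + a)))" for p
    using assms by (simp add: l_def powr_powr powr_divide powr_minus_divide)
  have 1: "- ((2 * a + \<gamma>) / (1 + a)) + 2 = (2 - \<gamma>) / (1 + a)"
    and 2: "(\<gamma> - 2) / (1 + a) + 2 = (2 * a + \<gamma>) / (1 + a)"
    and 3: "- ((\<gamma> - 2) / (1 + a)) = (2 - \<gamma>) / (1 + a)"
    using assms(3) by (auto simp: field_simps)
  have sq: "x\<^sup>2 = x powr 2" if "x > 0" for x :: real using that by simp
  have "l powr (2 * a + \<gamma>) * e\<^sup>2 = q powr ((2 * a + \<gamma>) / (1 + a)) * e powr (- ((2 * a + \<gamma>) / (1 + a)) + 2)"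
    unfolding l sq[OF assms(2)] powr_add[of e _ 2] by (simp only: mult.assoc)
  then show "l powr (2 * a + \<gamma>) * e\<^sup>2 = e powr ((2 - \<gamma>) / (1 + a)) * q powr ((2 * a + \<gamma>) / (1 + a))"
    unfolding 1 by (simp only: mult.commute)
  have "l powr (\<gamma> - 2) * q\<^sup>2 = q powr ((\<gamma> - 2) / (1 + a) + 2) * e powr (- ((\<gamma> - 2) / (1 + a)))"
    unfolding l sq[OF assms(1)] powr_add[of q _ 2] by (simp only: mult_ac)
  then show "l powr (\<gamma> - 2) * q\<^sup>2 = e powr ((2 - \<gamma>) / (1 + a)) * q powr ((2 * a + \<gamma>) / (1 + a))"
    unfolding 2 3 by (simp only: mult.commute)
qed

theorem theorem2p7:
  fixes \<psi> :: "real ^ 'n \<Rightarrow> real" and \<alpha> :: "real ^ 'n"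
  assumes "\<psi> \<in> Cc_infinity"
    and "\<And>j. \<alpha> $ j \<ge> 0"
    and "order_of \<alpha> < 1 / 2"
  shows "\<exists>\<gamma> K1 K2 :: real. 0 < \<gamma> \<and> \<gamma> < 1 - 2 * order_of \<alpha> \<and> 0 < K1 \<and> 0 < K2 \<and>
    (\<forall>Q E M f :: 'n phase \<Rightarrow> complex.
       Q \<in> L2 \<and> L2_nonzero Q \<and> E \<in> L2 \<and> L2_nonzero E \<and> M \<in> L2 \<and> transport_eq M Q \<and>
       f \<in> L2 \<and> relaxation_eq \<alpha> (lambda_opt K2 \<alpha> Q E) M E f \<longrightarrow>
       Hdot_seminorm_sq (\<gamma> / 2) (moment \<psi> (\<lambda>z. f z - M z))
         \<le> ennreal (K1 * L2norm E powr ((2 - \<gamma>) / (1 + order_of \<alpha>))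
                       * L2norm Q powr ((2 * order_of \<alpha> + \<gamma>) / (1 + order_of \<alpha>)))) \<and>
    (\<forall>Q M :: 'n phase \<Rightarrow> complex.
       Q \<in> L2 \<and> L2_nonzero Q \<and> M \<in> L2 \<and> transport_eq M Q \<longrightarrow>
       (\<forall>\<epsilon>>0. \<exists>\<delta>>0. \<forall>E f :: 'n phase \<Rightarrow> complex.
          E \<in> L2 \<and> L2_nonzero E \<and> L2norm E < \<delta> \<and>
          f \<in> L2 \<and> relaxation_eq \<alpha> (lambda_opt K2 \<alpha> Q E) M E f \<longrightarrow>
          Hdot_seminorm_sq (\<gamma> / 2) (moment \<psi> (\<lambda>z. f z - M z)) < ennreal \<epsilon>))"
proof -
  define a where "a = order_of \<alpha>"
  \<comment> \<open>The midpoint of the admissible interval; then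
    \<open>2 * a + \<gamma> = a + 1 / 2\<close>, which is below 1.\<close>
  define \<gamma> where "\<gamma> = (1 - 2 * a) / 2"
  have a: "0 \<le> a" "a < 1 / 2" using order_of_nonneg[OF assms(2)] assms(3) by (auto simp: a_def)
  have gam: "0 < \<gamma>" "\<gamma> < 1 - 2 * a" "2 * a + \<gamma> \<le> 1" using a by (auto simp: \<gamma>_def field_simps)
  obtain B where B: "B > 0" "\<And>\<xi>. (\<psi> \<xi>)\<^sup>2 \<le> B * gauss \<xi>"
    using Cc_infinity_le_gauss[OF assms(1)] by blast
  define C where "C = 4 * (B * (sqrt (2 * pi) ^ CARD('n) * sqrt (2 * pi))) * (2 * pi) ^ CARD('n)"
  \<comment> \<open>At the balancing \<open>lam\<close> the two terms of
    \<open>averaging_bound\<close> coincide, which gives the factor 2.\<close>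
  define K1 where "K1 = 2 * C"
  have C: "C > 0" unfolding C_def using B(1) by simp
  define p where "p = (2 - \<gamma>) / (1 + a)"
  define r where "r = (2 * a + \<gamma>) / (1 + a)"
  have p: "p > 0" using a gam by (simp add: p_def)
  have main: "Hdot_seminorm_sq (\<gamma> / 2) (moment \<psi> (\<lambda>z. f z - M z))
      \<le> ennreal (K1 * L2norm E powr p * L2norm Q powr r)"
    if Q: "Q \<in> L2" "L2_nonzero Q" and E: "E \<in> L2" "L2_nonzero E" and M: "M \<in> L2" "transport_eq M Q"
      and f: "f \<in> L2" "relaxation_eq \<alpha> (lambda_opt 1 \<alpha> Q E) M E f" for Q E M f :: "'n phase \<Rightarrow> complex"
  proof -
    have pos: "L2norm Q > 0" "L2norm E > 0" using L2norm_pos Q E by auto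
    define lam where "lam = lambda_opt 1 \<alpha> Q E"
    have lam: "lam = (L2norm Q / L2norm E) powr (1 / (1 + a))" by (simp add: lam_def lambda_opt_def a_def)
    have "lam > 0" using pos by (simp add: lam)
    have eq: "transport (\<lambda>z. f z - M z) (\<lambda>z. u (fst z) * v (snd z))
          + of_real lam * distr_of (\<lambda>z. f z - M z) (\<lambda>z. u (fst z) * v (snd z))
        = of_real lam * frac_deriv \<alpha> E (\<lambda>z. u (fst z) * v (snd z)) - distr_of Q (\<lambda>z. u (fst z) * v (snd z))"
      if u: "u \<in> Cc_infinity" and v: "v \<in> Cc_infinity" for u v
    proof -
      note \<phi> = Cc_infinity_tensor[OF u v]
      have "transport M (\<lambda>z. u (fst z) * v (snd z)) = distr_of Q (\<lambda>z. u (fst z) * v (snd z))"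
        using M(2) \<phi> unfolding transport_eq_def by blast
      moreover have "transport f (\<lambda>z. u (fst z) * v (snd z)) + of_real lam * distr_of f (\<lambda>z. u (fst z) * v (snd z))
          = of_real lam * distr_of M (\<lambda>z. u (fst z) * v (snd z)) + of_real lam * frac_deriv \<alpha> E (\<lambda>z. u (fst z) * v (snd z))"
        using f(2) \<phi> unfolding relaxation_eq_def lam_def[symmetric] by blast
      ultimately show ?thesis
        unfolding transport_diff_tensor[OF f(1) M(1) u v] by (simp add: algebra_simps)
    qed
    have "Hdot_seminorm_sq (\<gamma> / 2) (moment \<psi> (\<lambda>z. f z - M z))
      \<le> ennreal (C * (lam powr (2 * a + \<gamma>) * (L2norm E)\<^sup>2 + lam powr (\<gamma> - 2) * (L2norm Q)\<^sup>2))"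
      unfolding C_def a_def
      by (rule averaging_bound[OF assms(1,2) _ _ B \<open>lam > 0\<close> L2_diff[OF f(1) M(1)] E(1) Q(1) eq])
        (use gam in \<open>auto simp: a_def\<close>)
    also have "C * (lam powr (2 * a + \<gamma>) * (L2norm E)\<^sup>2 + lam powr (\<gamma> - 2) * (L2norm Q)\<^sup>2)
        = K1 * L2norm E powr p * L2norm Q powr r"
      unfolding lam optimal_balance[OF pos a(1)] by (simp add: K1_def p_def r_def)
    finally show ?thesis .
  qed
  have vanish: "\<exists>\<delta>>0. \<forall>E f :: 'n phase \<Rightarrow> complex.
          E \<in> L2 \<and> L2_nonzero E \<and> L2norm E < \<delta> \<and>
          f \<in> L2 \<and> relaxation_eq \<alpha> (lambda_opt 1 \<alpha> Q E) M E f \<longrightarrow>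
          Hdot_seminorm_sq (\<gamma> / 2) (moment \<psi> (\<lambda>z. f z - M z)) < ennreal \<epsilon>"
    if Q: "Q \<in> L2" "L2_nonzero Q" and M: "M \<in> L2" "transport_eq M Q" and eps: "\<epsilon> > 0"
    for Q M :: "'n phase \<Rightarrow> complex" and \<epsilon> :: real
  proof -
    define D where "D = K1 * L2norm Q powr r"
    have D: "D > 0" using L2norm_pos[OF Q] C by (simp add: D_def K1_def)
    \<comment> \<open>The solution of \<open>D * \<delta> powr p = \<epsilon>\<close>; smallness of
      \<open>E\<close> helps because the exponent \<open>p\<close> is positive.\<close>
    define \<delta> where "\<delta> = (\<epsilon> / D) powr (1 / p)"
    have "\<delta> > 0" using D eps by (simp add: \<delta>_def)
    moreover have "Hdot_seminorm_sq (\<gamma> / 2) (moment \<psi> (\<lambda>z. f z - M z)) < ennreal \<epsilon>"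
      if E: "E \<in> L2" "L2_nonzero E" "L2norm E < \<delta>"
        and f: "f \<in> L2" "relaxation_eq \<alpha> (lambda_opt 1 \<alpha> Q E) M E f" for E f :: "'n phase \<Rightarrow> complex"
    proof -
      have "L2norm E powr p < \<delta> powr p"
        using L2norm_pos[OF E(1,2)] E(3) p by (intro powr_less_mono2) auto
      also have "\<delta> powr p = \<epsilon> / D" using p D eps by (simp add: \<delta>_def powr_powr)
      finally have "D * L2norm E powr p < \<epsilon>" using D by (simp add: field_simps)
      then have "ennreal (K1 * L2norm E powr p * L2norm Q powr r) < ennreal \<epsilon>"
        using eps by (intro ennreal_lessI) (simp_all add: D_def mult_ac)
      with main[OF Q E(1,2) M f] show ?thesis by (rule le_less_trans)
    qed
    ultimately show ?thesis by blast
  qed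
  \<comment> \<open>With \<open>K2 = 1\<close> the prescribed \<open>lambda_opt\<close> is exactly
    the balancing value \<open>l\<close> of \<open>optimal_balance\<close>.\<close>
  show ?thesis
    unfolding a_def[symmetric]
    by (rule exI[of _ \<gamma>], rule exI[of _ K1], rule exI[of _ "1::real"])
      (use gam C main vanish in \<open>auto simp: K1_def p_def r_def\<close>)
qed

end
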